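(* Let $n\ge2$ be even and $l\ge3$ odd, let $\mathbf c=(c_1,\dots,c_{n/2})$ be integers with $-n\le c_1<\dots<c_{n/2}\le-1$, and let $C_{10}\subseteq\{c_1,\dots,c_{n/2}\}$. The sum of the $Q$-weights of the vertically symmetric $(n,l)$-alternating sign trapezoids with $1$-column vector $\mathbf c$ such that, for each $i$, the column numbered $c_i$ is a $10$-column if and only if $c_i\in C_{10}$, equals $$\prod_{c_i\in C_{10}}\left(-\Delta^Q_{c_i}\right)\prod_{\substack{1\le i\le n/2\\ c_i\notin C_{10}}}\left(\mathrm{id}+\Delta^Q_{c_i}\right)\prod_{r=1}^{n/2}\left(-\Delta^Q_{c_r}\right)^{-c_r-1}F(c_1,\dots,c_{n/2}),$$ where, with $b=(l-5)/2$ and $N=n/2$, $$F(c_1,\dots,c_N)=\prod_{1\le s<t\le N}\left(\mathrm{E}_{c_s}+\mathrm{E}_{c_t}^{-1}-(2-Q)\mathrm{E}_{c_s}\mathrm{E}_{c_t}^{-1}\right)\left(\mathrm{E}_{c_s}+\mathrm{E}_{c_t}-(2-Q)\mathrm{E}_{c_s}\mathrm{E}_{c_t}\right)\left[\prod_{1\le i<j\le N}\frac{(c_j-c_i+j-i)(2b+n+1-c_i-c_j-i-j)}{(j-i)(i+j-1)}\right].$$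
   Context: Operators: $\mathrm{E}_x f(x)=f(x+1)$, $\mathrm{E}_x^{-1}f(x)=f(x-1)$, $\mathrm{id}$ the identity, $\Delta_x=\mathrm{E}_x-\mathrm{id}$, $\Delta^Q_x=\Delta_x(\mathrm{id}-(1-Q)\mathrm{E}_x)^{-1}$ (on polynomials the finite sum $Q^{-1}\sum_{i\ge0}(Q^{-1}-1)^i\Delta_x^{i+1}$). Operators in different variables commute; they are applied to the polynomial in the variables $c_1,\dots,c_N$, the exponents $-c_r-1$ being the fixed integers given by $\mathbf c$, and the result is evaluated at the given $\mathbf c$. An $(n,l)$-alternating sign trapezoid is an array $(a_{i,j})$ with entries in $\{-1,0,1\}$, indexed by $1\le i\le n$, $i\le j\le 2n+l-1-i$ (rows centred; column $j$, $1\le j\le 2n+l-2$, consists of the existing $a_{i,j}$), such that: nonzero entries alternate in sign along each row and each column; the topmost nonzero entry of each column (if any) is $1$; each row sums to $1$; the entries in the central $l-2$ columns (columns $n+1,\dots,n+l-2$) sum to $0$. It is vertically symmetric if $a_{i,j}=a_{i,2n+l-1-j}$. A $1$-column is a column with sum $1$; it is a $10$-column if its bottom entry (entry in the lowest row meeting the column) is $0$. Columns $1,\dots,n$ are numbered $-n,\dots,-1$ (column $j$ gets number $j-n-1$); the $1$-column vector is the increasing list of the numbers of the $1$-columns among these. The $Q$-weight is $Q$ raised to the number of entries $-1$ in the $n-1+(l-1)/2$ leftmost columns. *)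

theory Defs
  imports Main "HOL-Library.FuncSet"
begin

section \<open>Alternating sign trapezoids\<close>

definition cells :: "nat \<Rightarrow> nat \<Rightarrow> (nat \<times> nat) set" where
  "cells n l = {(i, j). 1 \<le> i \<and> i \<le> n \<and> i \<le> j \<and> j \<le> 2 * n + l - 1 - i}"

definition row_cells :: "nat \<Rightarrow> nat \<Rightarrow> nat \<Rightarrow> nat set" where
  "row_cells n l i = {j. (i, j) \<in> cells n l}"

definition col_cells :: "nat \<Rightarrow> nat \<Rightarrow> nat \<Rightarrow> nat set" where
  "col_cells n l j = {i. (i, j) \<in> cells n l}"

definition alternating :: "nat set \<Rightarrow> (nat \<Rightarrow> int) \<Rightarrow> bool" where
  "alternating S f \<longleftrightarrow>
     (\<forall>x\<in>S. \<forall>y\<in>S. x < y \<and> f x \<noteq> 0 \<and> f y \<noteq> 0 \<and> (\<forall>z\<in>S. x < z \<and> z < y \<longrightarrow> f z = 0)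
        \<longrightarrow> sgn (f y) = - sgn (f x))"

definition col_sum :: "nat \<Rightarrow> nat \<Rightarrow> (nat \<times> nat \<Rightarrow> int) \<Rightarrow> nat \<Rightarrow> int" where
  "col_sum n l a j = (\<Sum>i\<in>col_cells n l j. a (i, j))"

text \<open>Row 1 is the top (and longest) row. Arrays are extensional functions on the cells, so that
  distinct functions are distinct arrays.\<close>

definition as_trapezoid :: "nat \<Rightarrow> nat \<Rightarrow> (nat \<times> nat \<Rightarrow> int) \<Rightarrow> bool" where
  "as_trapezoid n l a \<longleftrightarrow>
     a \<in> cells n l \<rightarrow>\<^sub>E {-1, 0, 1} \<and>
     (\<forall>i\<in>{1..n}. alternating (row_cells n l i) (\<lambda>j. a (i, j))) \<and>
     (\<forall>j\<in>{1..2 * n + l - 2}. alternating (col_cells n l j) (\<lambda>i. a (i, j))) \<and>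
     (\<forall>j\<in>{1..2 * n + l - 2}. \<forall>i\<in>col_cells n l j.
        a (i, j) \<noteq> 0 \<and> (\<forall>k\<in>col_cells n l j. k < i \<longrightarrow> a (k, j) = 0) \<longrightarrow> a (i, j) = 1) \<and>
     (\<forall>i\<in>{1..n}. (\<Sum>j\<in>row_cells n l i. a (i, j)) = 1) \<and>
     (\<forall>j\<in>{n + 1..n + l - 2}. col_sum n l a j = 0)"

definition vertically_symmetric :: "nat \<Rightarrow> nat \<Rightarrow> (nat \<times> nat \<Rightarrow> int) \<Rightarrow> bool" where
  "vertically_symmetric n l a \<longleftrightarrow> (\<forall>(i, j)\<in>cells n l. a (i, j) = a (i, 2 * n + l - 1 - j))"

definition one_column :: "nat \<Rightarrow> nat \<Rightarrow> (nat \<times> nat \<Rightarrow> int) \<Rightarrow> nat \<Rightarrow> bool" where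
  "one_column n l a j \<longleftrightarrow> col_sum n l a j = 1"

definition ten_column :: "nat \<Rightarrow> nat \<Rightarrow> (nat \<times> nat \<Rightarrow> int) \<Rightarrow> nat \<Rightarrow> bool" where
  "ten_column n l a j \<longleftrightarrow> one_column n l a j \<and> a (Max (col_cells n l j), j) = 0"

definition one_column_vector :: "nat \<Rightarrow> nat \<Rightarrow> (nat \<times> nat \<Rightarrow> int) \<Rightarrow> int list" where
  "one_column_vector n l a =
     sorted_list_of_set {int j - int n - 1 | j. j \<in> {1..n} \<and> one_column n l a j}"

definition column_numbered :: "nat \<Rightarrow> int \<Rightarrow> nat" where
  "column_numbered n x = nat (x + int n + 1)"

definition Q_weight :: "'a::field_char_0 \<Rightarrow> nat \<Rightarrow> nat \<Rightarrow> (nat \<times> nat \<Rightarrow> int) \<Rightarrow> 'a" where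
  "Q_weight Q n l a =
     Q ^ card {(i, j). (i, j) \<in> cells n l \<and> j \<le> n - 1 + (l - 1) div 2 \<and> a (i, j) = -1}"

definition symmetric_trapezoids ::
  "nat \<Rightarrow> nat \<Rightarrow> (nat \<Rightarrow> int) \<Rightarrow> int set \<Rightarrow> (nat \<times> nat \<Rightarrow> int) set" where
  "symmetric_trapezoids n l c C10 =
     {a. as_trapezoid n l a \<and> vertically_symmetric n l a \<and>
         one_column_vector n l a = map c [1..<n div 2 + 1] \<and>
         (\<forall>i\<in>{1..n div 2}. ten_column n l a (column_numbered n (c i)) \<longleftrightarrow> c i \<in> C10)}"

section \<open>Operators\<close>

text \<open>A polynomial in the variables \<open>c\<^sub>1, \<dots>, c\<^sub>N\<close> over a field of characteristic 0 is determined by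
  its values at integer points and is represented by the function of these values.
  The first argument of an operator is the index of the variable it acts on.\<close>

type_synonym 'a polyfun = "(nat \<Rightarrow> int) \<Rightarrow> 'a"

definition shiftE :: "nat \<Rightarrow> 'a polyfun \<Rightarrow> 'a polyfun" where
  "shiftE r f = (\<lambda>c. f (c(r := c r + 1)))"

definition shiftE_inv :: "nat \<Rightarrow> 'a polyfun \<Rightarrow> 'a polyfun" where
  "shiftE_inv r f = (\<lambda>c. f (c(r := c r - 1)))"

definition fdiff :: "nat \<Rightarrow> 'a::field_char_0 polyfun \<Rightarrow> 'a polyfun" where
  "fdiff r f = (\<lambda>c. shiftE r f c - f c)"

text \<open>\<open>\<Delta>\<^sup>Q = Q\<^sup>-\<^sup>1 \<Sum>\<^sub>i (Q\<^sup>-\<^sup>1 - 1)\<^sup>i \<Delta>\<^sup>i\<^sup>+\<^sup>1\<close>. The sum ranges over the \<open>i\<close> with \<open>\<Delta>\<^sup>i\<^sup>+\<^sup>1 f \<noteq> 0\<close>, which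
  are finitely many if \<open>f\<close> is polynomial in the variable concerned. On other functions the value
  is meaningless.\<close>

definition qdiff :: "'a::field_char_0 \<Rightarrow> nat \<Rightarrow> 'a polyfun \<Rightarrow> 'a polyfun" where
  "qdiff Q r f = (\<lambda>c. inverse Q *
     (\<Sum>i | (fdiff r ^^ (i + 1)) f \<noteq> (\<lambda>_. 0). (inverse Q - 1) ^ i * (fdiff r ^^ (i + 1)) f c))"

definition neg_qdiff :: "'a::field_char_0 \<Rightarrow> nat \<Rightarrow> 'a polyfun \<Rightarrow> 'a polyfun" where
  "neg_qdiff Q r f = (\<lambda>c. - qdiff Q r f c)"

definition id_plus_qdiff :: "'a::field_char_0 \<Rightarrow> nat \<Rightarrow> 'a polyfun \<Rightarrow> 'a polyfun" where
  "id_plus_qdiff Q r f = (\<lambda>c. f c + qdiff Q r f c)"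

text \<open>Products of operators are compositions. The factors of all products below commute on
  polynomials, so the order of the list is immaterial.\<close>

definition op_prod :: "('f \<Rightarrow> 'f) list \<Rightarrow> 'f \<Rightarrow> 'f" where
  "op_prod ops = foldr (\<circ>) ops id"

definition pair_op1 :: "'a::field_char_0 \<Rightarrow> nat \<Rightarrow> nat \<Rightarrow> 'a polyfun \<Rightarrow> 'a polyfun" where
  "pair_op1 Q s t f =
     (\<lambda>c. shiftE s f c + shiftE_inv t f c - (2 - Q) * shiftE s (shiftE_inv t f) c)"

definition pair_op2 :: "'a::field_char_0 \<Rightarrow> nat \<Rightarrow> nat \<Rightarrow> 'a polyfun \<Rightarrow> 'a polyfun" where
  "pair_op2 Q s t f =
     (\<lambda>c. shiftE s f c + shiftE t f c - (2 - Q) * shiftE s (shiftE t f) c)"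

definition base_poly :: "nat \<Rightarrow> nat \<Rightarrow> 'a::field_char_0 polyfun" where
  "base_poly n l c =
     (let b = (of_nat l - 5) / 2 in
      \<Prod>(i, j)\<in>{(i, j). 1 \<le> i \<and> i < j \<and> j \<le> n div 2}.
        (of_int (c j) - of_int (c i) + of_nat j - of_nat i) *
        (2 * b + of_nat n + 1 - of_int (c i) - of_int (c j) - of_nat i - of_nat j) /
        ((of_nat j - of_nat i) * (of_nat i + of_nat j - 1)))"

definition F_poly :: "'a::field_char_0 \<Rightarrow> nat \<Rightarrow> nat \<Rightarrow> 'a polyfun" where
  "F_poly Q n l =
     op_prod [pair_op1 Q s t \<circ> pair_op2 Q s t. t \<leftarrow> [1..<n div 2 + 1], s \<leftarrow> [1..<t]]
       (base_poly n l)"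

text \<open>Justification of \<open>qdiff\<close>: on functions annihilated by a power of \<open>\<Delta>\<close>, it is
  \<open>\<Delta> (id - (1 - Q) E)\<^sup>-\<^sup>1\<close>.\<close>

lemma fdiff_zero: "fdiff r (\<lambda>_. 0) = (\<lambda>_. 0)"
  by (simp add: fdiff_def shiftE_def)

lemma fdiff_pow_zero_mono:
  assumes "(fdiff r ^^ k) f = (\<lambda>_. 0)" "k \<le> m"
  shows "(fdiff r ^^ m) f = (\<lambda>_. 0)"
  using assms(2,1) by (induction rule: dec_induct) (auto simp: fdiff_zero)

lemma qdiff_eq_sum:
  assumes "(fdiff r ^^ k) f = (\<lambda>_. 0)"
  shows "qdiff Q r f c =
    inverse Q * (\<Sum>i<k. (inverse Q - 1) ^ i * (fdiff r ^^ (i + 1)) f c)"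
proof -
  have sub: "{i. (fdiff r ^^ (i + 1)) f \<noteq> (\<lambda>_. 0)} \<subseteq> {..<k}"
  proof
    fix i assume i: "i \<in> {i. (fdiff r ^^ (i + 1)) f \<noteq> (\<lambda>_. 0)}"
    show "i \<in> {..<k}"
    proof (rule ccontr)
      assume "i \<notin> {..<k}"
      then have "k \<le> i + 1" by simp
      with fdiff_pow_zero_mono[OF assms this] i show False by simp
    qed
  qed
  show ?thesis unfolding qdiff_def
    by (rule arg_cong[where f = "\<lambda>x. inverse Q * x"], rule sum.mono_neutral_left)
       (use sub in auto)
qed

lemma fdiff_pow_lincomb:
  "(fdiff r ^^ m) (\<lambda>c. x * f c + y * g c) =
     (\<lambda>c. x * (fdiff r ^^ m) f c + y * (fdiff r ^^ m) g c)"
  by (induction m) (auto simp: fdiff_def shiftE_def algebra_simps)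

lemma qdiff_resolvent:
  assumes Q: "Q \<noteq> 0" and f: "(fdiff r ^^ k) f = (\<lambda>_. 0)"
  shows "qdiff Q r (\<lambda>c. f c - (1 - Q) * shiftE r f c) = fdiff r f"
proof
  fix c
  let ?D = "\<lambda>i. (fdiff r ^^ i) f"
  define q where "q = inverse Q - 1"
  have Qq: "Q * q = 1 - Q" using Q by (simp add: q_def algebra_simps)
  have h: "(\<lambda>c. f c - (1 - Q) * shiftE r f c) = (\<lambda>c. Q * f c + (- (1 - Q)) * fdiff r f c)"
    by (auto simp: fdiff_def algebra_simps)
  have D: "(fdiff r ^^ m) (\<lambda>c. f c - (1 - Q) * shiftE r f c) =
      (\<lambda>c. Q * ?D m c - Q * q * ?D (Suc m) c)" for m
    unfolding h fdiff_pow_lincomb Qq by (simp add: funpow_swap1 algebra_simps)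
  have z: "?D k = (\<lambda>_. 0)" "?D (Suc k) = (\<lambda>_. 0)"
    using f fdiff_pow_zero_mono[OF f, of "Suc k"] by auto
  have "qdiff Q r (\<lambda>c. f c - (1 - Q) * shiftE r f c) c =
      inverse Q * (\<Sum>i<k. q ^ i * (Q * ?D (Suc i) c - Q * q * ?D (Suc (Suc i)) c))"
    unfolding q_def[symmetric]
    by (subst qdiff_eq_sum[where k = k]) (unfold D z, auto simp: q_def)
  also have "\<dots> = inverse Q * (Q * (\<Sum>i<k. q ^ i * ?D (Suc i) c - q ^ Suc i * ?D (Suc (Suc i)) c))"
    by (simp add: sum_distrib_left algebra_simps)
  also have "\<dots> = (\<Sum>i<k. q ^ i * ?D (Suc i) c - q ^ Suc i * ?D (Suc (Suc i)) c)"
    using Q by simp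
  also have "\<dots> = ?D 1 c - q ^ k * ?D (Suc k) c"
    by (subst sum_lessThan_telescope') simp
  also have "\<dots> = fdiff r f c" using z by simp
  finally show "qdiff Q r (\<lambda>c. f c - (1 - Q) * shiftE r f c) c = fdiff r f c" .
qed

end

theory Submission
  imports Defs "HOL-Library.Poly_Mapping" "Jordan_Normal_Form.Determinant"
begin

text \<open>A vertically symmetric trapezoid is determined by the sets \<open>T\<^sub>i\<close> of columns left of the centre whose
  first \<open>i\<close> entries sum to 1. Consecutive sets interlace, \<open>T\<^sub>i\<close> has \<open>\<lfloor>i/2\<rfloor>\<close> elements, a \<open>-1\<close> in row \<open>i\<close> is
  an element of \<open>T\<^sub>i\<^sub>-\<^sub>1 - T\<^sub>i\<close>, and a column that has ended is frozen.

  Without freezing, the weighted number of sequences ending in \<open>k\<^sub>1 < \<dots> < k\<^sub>m\<close> is a Bethe-type expression: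
  an operator \<open>\<Prod>\<^sub>s\<^sub><\<^sub>t (E\<^sub>s\<^sup>-\<^sup>1 + E\<^sub>t - (2 - Q)) (E\<^sub>s\<^sup>-\<^sup>1 + E\<^sub>t\<^sup>-\<^sup>1 - (2 - Q))\<close>, up to shifts, applied to a
  determinant of binomial coefficients. To sum such an expression over an interlacing row, write it as
  an iterated difference of the analogous expression \<open>B\<close> with raised binomial coefficients. The sums
  telescope; the terms in which two summation variables meet at the same \<open>k\<^sub>i\<close> vanish because the
  operator is symmetric and the determinant is antisymmetric, and those at the centre vanish because
  \<open>B\<close> is odd in its last variable. The surviving terms are the Laplace expansion of the next determinant.

  Freezing the \<open>p\<close> leftmost entries means summing over the remaining ones only. In the surviving terms
  this replaces \<open>1 - (1 - Q) E\<^sub>i\<close> by \<open>\<Delta>\<^sub>i\<close> for \<open>i \<le> p\<close> and deletes those that are constant in some such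
  variable, which is the effect of \<open>\<Prod>\<^sub>i\<^sub>\<le>\<^sub>p \<Delta>\<^sup>Q\<^sub>i\<close>. A 10-column is a column that is frozen one row early.\<close>


subsection \<open>Shift operators\<close>

text \<open>The constant 2 - Q is forced by telescoping. Where two neighbouring summation variables
  meet at y, the terms left over are B(y,y) + B(y+1,y+1) - (2-Q) B(y,y+1): B(y,y+1) occurs once for
  an entry equal to y, and with -(Q-1) because a value missed by all entries is to have weight Q.
  The operator of this expression is just the factor by which the Bethe operator fails to be
  symmetric. The binomials have to serve steps of two kinds. The lower index is 2j in even rows. Its
  antidifference 2j+1 is odd about the central column, as required when the number of entries stays
  the same and only the centre bounds the last entry. The next antidifference 2j+2 = 2(j+1) is again
  of the first kind, and with a column of ones added it gives the determinant with one more
  variable. Operators are Laurent polynomials in the shifts, which form a commutative ring.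
  \<Delta>^Q is not among them. On functions killed by the K-th powers of all differences it agrees
  with a truncation that is, hence the bookkeeping with K. The identity \<Delta>^Q (id - (1-Q) E) =
  \<Delta>, which creates the operators for frozen entries, holds for the truncation on such
  functions only.\<close>

type_synonym 'a shift_op = "(nat \<Rightarrow>\<^sub>0 int) \<Rightarrow>\<^sub>0 'a"

text \<open>Exponents are finitely supported maps from variable indices to shifts, so
  \<open>shift_op\<close> is the ring of Laurent polynomials in the E_i, and by
  \<open>act_mult\<close> its product is composition. Reordering operators is thus
  \<open>mult_ac\<close>.\<close>

definition act :: "'a::comm_ring_1 shift_op \<Rightarrow> 'a polyfun \<Rightarrow> 'a polyfun" where
  "act p f c = (\<Sum>e\<in>Poly_Mapping.keys p.
     Poly_Mapping.lookup p e * f (\<lambda>i. c i + Poly_Mapping.lookup e i))"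

definition shf :: "nat \<Rightarrow> 'a::comm_ring_1 shift_op" where
  "shf i = Poly_Mapping.single (Poly_Mapping.single i 1) 1"

definition shb :: "nat \<Rightarrow> 'a::comm_ring_1 shift_op" where
  "shb i = Poly_Mapping.single (Poly_Mapping.single i (-1)) 1"

definition scal :: "'a \<Rightarrow> 'a::comm_ring_1 shift_op" where
  "scal x = Poly_Mapping.single 0 x"

lemma act_superset:
  assumes "finite A" "Poly_Mapping.keys p \<subseteq> A"
  shows "act p f c = (\<Sum>e\<in>A. Poly_Mapping.lookup p e * f (\<lambda>i. c i + Poly_Mapping.lookup e i))"
  unfolding act_def using assms
  by (intro sum.mono_neutral_left) (auto simp: in_keys_iff)

lemma act_zero [simp]: "act 0 f = (\<lambda>_. 0)"
  by (auto simp: act_def)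

lemma act_add: "act (p + q) f = (\<lambda>c. act p f c + act q f c)"
proof
  fix c
  let ?A = "Poly_Mapping.keys p \<union> Poly_Mapping.keys q"
  show "act (p + q) f c = act p f c + act q f c"
    using keys_add[of p q]
    by (simp add: act_superset[of ?A] lookup_add sum.distrib algebra_simps)
qed

lemma act_single:
  "act (Poly_Mapping.single e x) f c = x * f (\<lambda>i. c i + Poly_Mapping.lookup e i)"
  by (subst act_superset[of "{e}"]) auto

lemma act_sum: "act (\<Sum>i\<in>A. p i) f = (\<lambda>c. \<Sum>i\<in>A. act (p i) f c)"
  by (induction A rule: infinite_finite_induct) (auto simp: act_add)

lemma poly_mapping_sum_singles:
  "p = (\<Sum>e\<in>Poly_Mapping.keys p. Poly_Mapping.single e (Poly_Mapping.lookup p e))"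
  by (rule poly_mapping_eqI) (auto simp: lookup_sum lookup_single when_def in_keys_iff)

lemma act_fun_sum: "act p (\<lambda>c. \<Sum>i\<in>A. f i c) = (\<lambda>c. \<Sum>i\<in>A. act p (f i) c)"
  by (simp add: fun_eq_iff act_def sum_distrib_left sum.swap[of _ A])

lemma act_fun_scale: "act p (\<lambda>c. x * f c) = (\<lambda>c. x * act p f c)"
  by (simp add: fun_eq_iff act_def sum_distrib_left algebra_simps)

lemma act_fun_add: "act p (\<lambda>c. f c + g c) = (\<lambda>c. act p f c + act p g c)"
  by (simp add: fun_eq_iff act_def sum.distrib algebra_simps)

lemma act_fun_uminus: "act p (\<lambda>c. - f c) = (\<lambda>c. - act p f c)"
  by (simp add: fun_eq_iff act_def sum_negf)

lemma act_fun_zero [simp]: "act p (\<lambda>c. 0) = (\<lambda>_. 0)"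
  by (simp add: fun_eq_iff act_def)

lemma act_mult: "act (p * q) f = act p (act q f)"
proof
  fix c
  let ?s = Poly_Mapping.single and ?l = Poly_Mapping.lookup and ?K = Poly_Mapping.keys
  have "p * q = (\<Sum>e\<in>?K p. ?s e (?l p e)) * (\<Sum>e\<in>?K q. ?s e (?l q e))"
    using poly_mapping_sum_singles[of p] poly_mapping_sum_singles[of q] by simp
  also have "\<dots> = (\<Sum>e\<in>?K p. \<Sum>e'\<in>?K q. ?s (e + e') (?l p e * ?l q e'))"
    by (simp add: sum_product mult_single)
  finally have "act (p * q) f c =
      (\<Sum>e\<in>?K p. \<Sum>e'\<in>?K q. ?l p e * ?l q e' * f (\<lambda>i. c i + (?l e i + ?l e' i)))"
    by (simp add: act_sum act_single lookup_add)
  also have "\<dots> = act p (act q f) c"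
    by (simp add: fun_eq_iff act_def sum_distrib_left algebra_simps)
  finally show "act (p * q) f c = act p (act q f) c" .
qed

lemma act_one [simp]: "act 1 f = f"
  by (simp add: act_def fun_eq_iff)

lemma act_uminus: "act (- p) f = (\<lambda>c. - act p f c)"
  using act_add[of p "- p" f] by (auto simp: fun_eq_iff eq_neg_iff_add_eq_0 add.commute)

lemma act_diff: "act (p - q) f = (\<lambda>c. act p f c - act q f c)"
  using act_add[of p "- q" f] by (simp add: act_uminus)

lemma act_scal: "act (scal x) f = (\<lambda>c. x * f c)"
  by (simp add: scal_def act_single fun_eq_iff)

lemma add_single_eq_fun_upd:
  "(\<lambda>j. c j + Poly_Mapping.lookup (Poly_Mapping.single i x) j) = c(i := c i + (x::int))"
  by (auto simp: lookup_single when_def fun_eq_iff)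

lemma act_shf: "act (shf i) f = (\<lambda>c. f (c(i := c i + 1)))"
  by (simp only: shf_def act_single add_single_eq_fun_upd fun_eq_iff) simp

lemma act_shb: "act (shb i) f = (\<lambda>c. f (c(i := c i - 1)))"
  by (simp add: shb_def act_single add_single_eq_fun_upd fun_eq_iff)

lemma shf_shb [simp]: "shf i * shb i = 1" "shb i * shf i = 1"
  by (simp_all add: shf_def shb_def mult_single flip: single_add)

lemma scal_simps [simp]: "scal 1 = 1" "scal 0 = 0" 
  by (simp_all add: scal_def)

lemma scal_add: "scal (x + y) = scal x + scal y" and scal_diff: "scal (x - y) = scal x - scal y"
  and scal_mult: "scal (x * y) = scal x * scal y"
  by (simp_all add: scal_def single_add single_diff mult_single)

lemma scal_power: "scal x ^ n = scal (x ^ n)"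
  by (induction n) (simp_all add: scal_mult)

text \<open>Operators have to be moved past substitutions: p followed by the pullback f \<mapsto> f
  \<circ> \<sigma> is the pullback followed by q. The \<sigma> that occur fix variables, transpose
  two of them, reflect the last one or delete one.\<close>

definition intertwines ::
  "((nat \<Rightarrow> int) \<Rightarrow> nat \<Rightarrow> int) \<Rightarrow> 'a::comm_ring_1 shift_op \<Rightarrow> 'a shift_op \<Rightarrow> bool" where
  "intertwines \<sigma> p q \<longleftrightarrow> (\<forall>f c. act p f (\<sigma> c) = act q (\<lambda>c. f (\<sigma> c)) c)"

lemma intertwinesD: "intertwines \<sigma> p q \<Longrightarrow> act p f (\<sigma> c) = act q (\<lambda>c. f (\<sigma> c)) c"
  by (simp add: intertwines_def)

lemma intertwines_mult:
  assumes "intertwines \<sigma> p p'" "intertwines \<sigma> q q'"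
  shows "intertwines \<sigma> (p * q) (p' * q')"
  using assms by (simp add: intertwines_def act_mult)

lemma intertwines_add:
  assumes "intertwines \<sigma> p p'" "intertwines \<sigma> q q'"
  shows "intertwines \<sigma> (p + q) (p' + q')"
  using assms by (simp add: intertwines_def act_add)

lemma intertwines_diff:
  assumes "intertwines \<sigma> p p'" "intertwines \<sigma> q q'"
  shows "intertwines \<sigma> (p - q) (p' - q')"
  using assms by (simp add: intertwines_def act_diff)

lemma intertwines_uminus:
  assumes "intertwines \<sigma> p p'"
  shows "intertwines \<sigma> (- p) (- p')"
  using assms by (simp add: intertwines_def act_uminus)

lemma intertwines_scal [simp, intro]: "intertwines \<sigma> (scal x) (scal x)"
  by (simp add: intertwines_def act_scal)

lemma intertwines_one [simp, intro]: "intertwines \<sigma> 1 1"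
  by (simp add: intertwines_def)

lemma intertwines_prod:
  assumes "\<And>i. i \<in> A \<Longrightarrow> intertwines \<sigma> (p i) (q i)"
  shows "intertwines \<sigma> (\<Prod>i\<in>A. p i) (\<Prod>i\<in>A. q i)"
  using assms by (induction A rule: infinite_finite_induct) (auto intro: intertwines_mult)

lemma intertwines_sum:
  assumes "\<And>i. i \<in> A \<Longrightarrow> intertwines \<sigma> (p i) (q i)"
  shows "intertwines \<sigma> (\<Sum>i\<in>A. p i) (\<Sum>i\<in>A. q i)"
  using assms by (induction A rule: infinite_finite_induct)
    (auto intro: intertwines_add simp: intertwines_def[of _ 0 0])

lemma intertwines_power:
  assumes "intertwines \<sigma> p q"
  shows "intertwines \<sigma> (p ^ n) (q ^ n)"
  using assms by (induction n) (auto intro: intertwines_mult)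

lemma intertwines_shf:
  assumes "\<And>c. \<sigma> (c(t := c t + 1)) = (\<sigma> c)(s := \<sigma> c s + 1)"
  shows "intertwines \<sigma> (shf s) (shf t)"
  using assms by (simp add: intertwines_def act_shf)

lemma intertwines_shb:
  assumes "\<And>c. \<sigma> (c(t := c t - 1)) = (\<sigma> c)(s := \<sigma> c s - 1)"
  shows "intertwines \<sigma> (shb s) (shb t)"
  using assms by (simp add: intertwines_def act_shb)

lemmas intertwines_intros = intertwines_mult intertwines_add intertwines_diff intertwines_uminus
  intertwines_scal intertwines_one intertwines_prod intertwines_power

subsection \<open>Alternating determinants\<close>

definition altdet :: "(nat \<Rightarrow> int \<Rightarrow> 'a::comm_ring_1) \<Rightarrow> nat \<Rightarrow> 'a polyfun" where
  "altdet F m c = det (mat m m (\<lambda>(i, j). F j (c (Suc i))))"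

lemma altdet_expand:
  "altdet F m c = (\<Sum>p | p permutes {0..<m}. signof p * (\<Prod>i = 0..<m. F (p i) (c (Suc i))))"
proof -
  have "(\<Prod>i = 0..<m. mat m m (\<lambda>(i, j). F j (c (Suc i))) $$ (i, p i)) =
      (\<Prod>i = 0..<m. F (p i) (c (Suc i)))" if "p permutes {0..<m}" for p
    using that permutes_in_image[OF that] by (intro prod.cong) auto
  then show ?thesis
    unfolding altdet_def by (subst det_def'[where n = m]) (auto intro!: sum.cong)
qed

lemma altdet_transpose:
  assumes "1 \<le> s" "s < t" "t \<le> m"
  shows "altdet F m (\<lambda>i. c (Transposition.transpose s t i)) = - altdet F m c"
proof -
  let ?A = "mat m m (\<lambda>(i, j). F j (c (Suc i)))"
  have "mat m m (\<lambda>(i, j). F j (c (Transposition.transpose s t (Suc i)))) =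
      swaprows (s - 1) (t - 1) ?A"
    unfolding mat_swaprows_def using assms
    by (intro eq_matI) (auto simp: Transposition.transpose_def)
  then show ?thesis
    unfolding altdet_def using det_swaprows[of "s - 1" m "t - 1" ?A] assms by auto
qed

lemma altdet_reflect_last:
  assumes "\<And>j x. F j (2 * h - x) = - F j x" "1 \<le> m"
  shows "altdet F m (c(m := 2 * h - c m)) = - altdet F m c"
proof -
  let ?A = "mat m m (\<lambda>(i, j). F j (c (Suc i)))"
  have "mat m m (\<lambda>(i, j). F j ((c(m := 2 * h - c m)) (Suc i))) = multrow (m - 1) (-1) ?A"
    unfolding mat_multrow_def using assms by (intro eq_matI) auto
  then show ?thesis
    unfolding altdet_def using det_multrow[of "m - 1" m ?A "-1"] assms by auto
qed

text \<open>Expansion along the column of the constant function. Each term loses one variable and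
  the lowest function; this is how a row with one entry fewer enters.\<close>

lemma altdet_laplace:
  assumes "\<And>x. F 0 x = 1"
  shows "altdet F (Suc m) c =
    (\<Sum>q\<in>{1..Suc m}. (-1) ^ (q - 1) * altdet (\<lambda>j. F (Suc j)) m (\<lambda>i. if i < q then c i else c (Suc i)))"
proof -
  let ?A = "mat (Suc m) (Suc m) (\<lambda>(i, j). F j (c (Suc i)))"
  have D: "mat_delete ?A i 0 =
      mat m m (\<lambda>(i', j). F (Suc j) (if Suc i' < Suc i then c (Suc i') else c (Suc (Suc i'))))"
    if "i < Suc m" for i
    unfolding mat_delete_def using that by (intro eq_matI) auto
  have "altdet F (Suc m) c = (\<Sum>i<Suc m. ?A $$ (i, 0) * cofactor ?A i 0)"
    unfolding altdet_def by (rule laplace_expansion_column) auto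
  also have "\<dots> = (\<Sum>i<Suc m. (-1) ^ i *
      altdet (\<lambda>j. F (Suc j)) m (\<lambda>i'. if i' < Suc i then c i' else c (Suc i')))"
    by (intro sum.cong refl) (simp add: cofactor_def D altdet_def assms)
  also have "\<dots> = (\<Sum>q\<in>{1..Suc m}. (-1) ^ (q - 1) *
      altdet (\<lambda>j. F (Suc j)) m (\<lambda>i. if i < q then c i else c (Suc i)))"
    by (rule sum.reindex_bij_witness[where i = "\<lambda>q. q - 1" and j = Suc]) auto
  finally show ?thesis .
qed

lemma altdet_cong:
  assumes "\<And>i. 1 \<le> i \<Longrightarrow> i \<le> m \<Longrightarrow> c i = c' i"
  shows "altdet F m c = altdet F m c'"
  unfolding altdet_def using assms by (intro arg_cong[where f = det] eq_matI) auto

lemma act_difference_scale: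
  assumes "\<And>c y. f (c(r := y)) = f c"
  shows "act ((shf r - 1) ^ K) (\<lambda>c. g (c r) * f c) =
    (\<lambda>c. ((\<lambda>g x. g (x + 1) - g x) ^^ K) g (c r) * f c)"
proof (induction K)
  case (Suc K)
  show ?case
    by (simp only: power_Suc act_mult Suc.IH)
      (simp add: act_diff act_shf assms algebra_simps)
qed simp

lemma act_difference_prod:
  assumes "finite A"
  shows "act (\<Prod>i\<in>A. shf i - 1) (\<lambda>c. \<Prod>i\<in>A. g i (c i)) =
    (\<lambda>c. \<Prod>i\<in>A. (g i (c i + 1) - g i (c i)))"
proof -
  have out: "act (\<Prod>i\<in>A. shf i - 1) (\<lambda>c. u (c a) * f c) =
      (\<lambda>c. u (c a) * act (\<Prod>i\<in>A. shf i - 1) f c)"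
    if "finite A" "a \<notin> A" for A a and u :: "int \<Rightarrow> 'a" and f :: "'a polyfun"
    using that
  proof (induction A rule: finite_induct)
    case (insert b A)
    then show ?case
      by (simp add: act_mult act_diff act_shf algebra_simps)
  qed simp
  show ?thesis using assms
  proof (induction A rule: finite_induct)
    case (insert a A)
    have "(\<Prod>i\<in>A. g i ((c(a := y)) i + 1) - g i ((c(a := y)) i)) =
        (\<Prod>i\<in>A. g i (c i + 1) - g i (c i))" for c y
      using insert.hyps by (intro prod.cong) auto
    then have *: "act (shf a - 1) (\<lambda>c. g a (c a) * (\<Prod>i\<in>A. g i (c i + 1) - g i (c i))) =
        (\<lambda>c. \<Prod>i\<in>insert a A. g i (c i + 1) - g i (c i))"
      using insert.hyps by (simp add: act_diff act_shf algebra_simps)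
    have "act (\<Prod>i\<in>insert a A. shf i - 1) (\<lambda>c. \<Prod>i\<in>insert a A. g i (c i)) =
        act (shf a - 1) (act (\<Prod>i\<in>A. shf i - 1) (\<lambda>c. g a (c a) * (\<Prod>i\<in>A. g i (c i))))"
      using insert.hyps by (simp add: act_mult)
    then show ?case
      by (simp only: out[where u = "g a", OF insert.hyps] insert.IH *)
  qed simp
qed

text \<open>Each Leibniz term is a product with one factor per variable, so differencing every
  variable once differences every factor once.\<close>

lemma act_difference_altdet:
  "act (\<Prod>i\<in>{1..m}. shf i - 1) (altdet F m) = altdet (\<lambda>j x. F j (x + 1) - F j x) m"
proof -
  have "act (\<Prod>i\<in>{1..m}. shf i - 1) (\<lambda>c. \<Prod>i = 0..<m. F (p i) (c (Suc i))) c =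
      (\<Prod>i = 0..<m. F (p i) (c (Suc i) + 1) - F (p i) (c (Suc i)))" for p c
  proof -
    have re: "(\<Prod>i = 0..<m. G (p i) (c (Suc i))) = (\<Prod>i\<in>{1..m}. G (p (i - 1)) (c i))"
      for G :: "nat \<Rightarrow> int \<Rightarrow> 'a" and c
      by (rule prod.reindex_bij_witness[where i = "\<lambda>i. i - 1" and j = Suc]) auto
    show ?thesis
      unfolding re[where G = "\<lambda>j x. F j (x + 1) - F j x"] re
      using fun_cong[OF act_difference_prod[of "{1..m}" "\<lambda>i. F (p (i - 1))"], of c] by simp
  qed
  then show ?thesis
    unfolding altdet_expand[abs_def] act_fun_sum act_fun_scale fun_eq_iff by simp
qed

text \<open>A Leibniz term depends on variable r through the single factor
  \<open>F (p (r - 1))\<close>. A variable outside {1..m} does not occur at all; there one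
  difference already gives zero, which is where \<open>K > 0\<close> enters.\<close>

lemma act_difference_pow_altdet:
  assumes "\<And>j. j < m \<Longrightarrow> ((\<lambda>g x. g (x + 1) - g x) ^^ K) (F j) = (\<lambda>_. 0)" "K > 0"
  shows "act ((shf r - 1) ^ K) (altdet F m) = (\<lambda>_. 0)"
proof (cases "r \<in> {1..m}")
  case True
  have "act ((shf r - 1) ^ K) (\<lambda>c. \<Prod>i = 0..<m. F (p i) (c (Suc i))) = (\<lambda>_. 0)"
    if p: "p permutes {0..<m}" for p
  proof -
    let ?f = "\<lambda>c. \<Prod>i\<in>{0..<m} - {r - 1}. F (p i) (c (Suc i))"
    have eq: "(\<lambda>c. \<Prod>i = 0..<m. F (p i) (c (Suc i))) = (\<lambda>c. F (p (r - 1)) (c r) * ?f c)"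
      using True by (subst prod.remove[of _ "r - 1"]) auto
    have indep: "\<And>c y. ?f (c(r := y)) = ?f c"
      by (intro prod.cong) auto
    have "act ((shf r - 1) ^ K) (\<lambda>c. \<Prod>i = 0..<m. F (p i) (c (Suc i))) =
        (\<lambda>c. ((\<lambda>g x. g (x + 1) - g x) ^^ K) (F (p (r - 1))) (c r) * ?f c)"
      unfolding eq by (rule act_difference_scale[where f = ?f and g = "F (p (r - 1))", OF indep])
    moreover have "p (r - 1) < m" using permutes_in_image[OF p, of "r - 1"] True by auto
    ultimately show ?thesis by (simp add: assms)
  qed
  then show ?thesis
    unfolding altdet_expand[abs_def] act_fun_sum act_fun_scale by (simp add: fun_eq_iff)
next
  case False
  obtain K' where K: "K = Suc K'" using assms by (cases K) auto
  have "altdet F m (c(r := y)) = altdet F m c" for c y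
    by (rule altdet_cong) (use False in auto)
  then have "act (shf r - 1) (altdet F m) = (\<lambda>_. 0)"
    by (simp add: act_diff act_shf)
  then show ?thesis
    unfolding K power_Suc2 act_mult by simp
qed

text \<open>As a polynomial in the last node the determinant has degree at most m and vanishes at
  the other m nodes, so its coefficient of degree m, a determinant of size m, fixes it.\<close>

lemma det_poly_vandermonde:
  fixes p :: "nat \<Rightarrow> 'a::idom poly" and v :: "nat \<Rightarrow> 'a"
  assumes "\<And>j. degree (p j) \<le> j"
  shows "det (mat m m (\<lambda>(i, j). poly (p j) (v i))) =
    (\<Prod>j<m. poly.coeff (p j) j) * (\<Prod>j<m. \<Prod>i<j. v j - v i)"
proof (induction m)
  case 0
  then show ?case by (simp add: det_dim_zero)
next
  case (Suc m)
  \<comment> \<open>The last node becomes an indeterminate x. The cofactors of the last row do not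
    see it, so \<open>P\<close> may be built from those at x = 0.\<close>
  let ?M = "\<lambda>x. mat (Suc m) (Suc m) (\<lambda>(i, j). poly (p j) (if i < m then v i else x))"
  have row: "?M x \<in> carrier_mat (Suc m) (Suc m)" for x by auto
  define P where "P = (\<Sum>j<Suc m. smult (cofactor (?M 0) m j) (p j))"
  have "mat_delete (?M x) m j = mat_delete (?M 0) m j" for x j
    unfolding mat_delete_def by (intro eq_matI) auto
  then have cof: "cofactor (?M x) m j = cofactor (?M 0) m j" for x j
    unfolding cofactor_def by (rule arg_cong[where f = "\<lambda>A. (-1) ^ (m + j) * det A"])
  have polyP: "poly P x = det (?M x)" for x
  proof -
    have "det (?M x) = (\<Sum>j<Suc m. ?M x $$ (m, j) * cofactor (?M x) m j)"
      by (rule laplace_expansion_row) auto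
    also have "\<dots> = poly P x"
      unfolding P_def poly_sum poly_smult cof[of x]
      by (intro sum.cong) (auto simp: mult.commute)
    finally show ?thesis ..
  qed
  define d where "d = det (mat m m (\<lambda>(i, j). poly (p j) (v i)))"
  have del: "mat_delete (?M 0) m m = mat m m (\<lambda>(i, j). poly (p j) (v i))"
    unfolding mat_delete_def by (intro eq_matI) auto
  have cm: "cofactor (?M 0) m m = d"
    by (simp add: cofactor_def del d_def flip: mult_2)
  have degP: "degree P \<le> m"
    unfolding P_def using assms
    by (intro degree_sum_le) (auto intro: le_trans[OF degree_smult_le] le_trans[OF assms])
  have coeffP: "poly.coeff P m = d * poly.coeff (p m) m"
  proof -
    have "poly.coeff (p j) m = 0" if "j < m" for j
      using assms[of j] that by (intro coeff_eq_0) auto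
    then show ?thesis unfolding P_def by (simp add: coeff_sum cm)
  qed
  have zero: "poly P (v i) = 0" if "i < m" for i
    unfolding polyP by (rule det_identical_rows[OF row, of i m]) (use that in auto)
  define R where "R = smult (d * poly.coeff (p m) m) (\<Prod>i<m. [:- v i, 1:])"
  \<comment> \<open>Distinct nodes give m common values. With equal coefficients at degree m and no
    higher terms, this determines the polynomial.\<close>
  have "P = R" if inj: "inj_on v {..<m}"
  proof (rule poly_eqI_degree_lead_coeff[where n = m and A = "v ` {..<m}"])
    have dp: "degree (\<Prod>i<m. [:- v i, 1:]) = m"
      by (subst degree_prod_eq_sum_degree) auto
    moreover have "lead_coeff (\<Prod>i<m. [:- v i, 1:]) = 1"
      by (simp add: lead_coeff_prod)
    ultimately show "poly.coeff P m = poly.coeff R m"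
      by (simp add: coeffP R_def)
    show "degree R \<le> m" unfolding R_def by (rule le_trans[OF degree_smult_le]) (simp add: dp)
    show "card (v ` {..<m}) \<ge> m" using inj by (simp add: card_image)
    show "poly P z = poly R z" if "z \<in> v ` {..<m}" for z
      using that zero by (auto simp: R_def poly_prod)
  qed (use degP in auto)
  \<comment> \<open>With two equal nodes the zeros no longer suffice, but then all minors avoiding
    the last row have two equal rows and both sides vanish.\<close>
  moreover have "d = 0 \<and> P = 0" if "\<not> inj_on v {..<m}"
  proof -
    from that obtain i j where ij: "i < m" "j < m" "i \<noteq> j" "v i = v j"
      by (auto simp: inj_on_def)
    have "d = 0" unfolding d_def
      by (rule det_identical_rows[of _ m i j]) (use ij in auto)
    moreover have "P = 0"
    proof -
      have "poly P x = 0" for x unfolding polyP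
        by (rule det_identical_rows[OF row, of i j]) (use ij in auto)
      moreover have "cofactor (?M 0) m k = 0" if "k < Suc m" for k
        unfolding cofactor_def
      proof (rule mult_eq_0_iff[THEN iffD2], rule disjI2, rule det_identical_rows[of _ m i j])
        show "row (mat_delete (?M 0) m k) i = row (mat_delete (?M 0) m k) j"
          unfolding mat_delete_def using ij by (intro eq_vecI) auto
      qed (use ij in \<open>auto simp: mat_delete_def\<close>)
      ultimately show ?thesis unfolding P_def by simp
    qed
    ultimately show ?thesis by simp
  qed
  ultimately have "P = R" unfolding R_def by (cases "inj_on v {..<m}") auto
  moreover have "det (mat (Suc m) (Suc m) (\<lambda>(i, j). poly (p j) (v i))) = poly P (v m)"
    unfolding polyP by (intro arg_cong[where f = det] eq_matI) (auto simp: less_Suc_eq)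
  ultimately show ?case
    by (simp add: R_def poly_prod Suc.IH d_def algebra_simps)
qed

subsection \<open>Weighted sums over interlacing vectors\<close>

text \<open>Sums over the entries \<open>p + 1, \<dots>, p + d\<close> of a row interlacing with \<open>k\<close>, from the right; \<open>u\<close> is the largest
  value still available, and the weight of a \<open>k r\<close> that no entry hits is \<open>Q\<close>.\<close>

primrec il_sum :: "'a::field_char_0 \<Rightarrow> nat \<Rightarrow> (nat \<Rightarrow> int) \<Rightarrow> nat \<Rightarrow> int \<Rightarrow> 'a polyfun \<Rightarrow> 'a polyfun"
where
  "il_sum Q p k 0 u f = f"
| "il_sum Q p k (Suc d) u f = (let r = Suc (p + d) in (\<lambda>c.
     il_sum Q p k d (k r - 1) (\<lambda>c. f (c(r := k r))) c +
     (\<Sum>y\<in>{k r<..u}. il_sum Q p k d (k r) (\<lambda>c. f (c(r := y))) c +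
        (Q - 1) * il_sum Q p k d (k r - 1) (\<lambda>c. f (c(r := y))) c)))"

text \<open>The terms that survive telescoping: all variables are at their lower limits, respectively those
  from some index on are at their upper limits and only the earlier ones at their lower limits.\<close>

primrec lower_part :: "'a::field_char_0 \<Rightarrow> nat \<Rightarrow> (nat \<Rightarrow> int) \<Rightarrow> nat \<Rightarrow> 'a polyfun \<Rightarrow> 'a polyfun"
where
  "lower_part Q p k 0 f = f"
| "lower_part Q p k (Suc d) f = (let r = Suc (p + d) in
     lower_part Q p k d (\<lambda>c. (1 - Q) * f (c(r := k r + 1)) - f (c(r := k r))))"

primrec upper_part :: "'a::field_char_0 \<Rightarrow> nat \<Rightarrow> (nat \<Rightarrow> int) \<Rightarrow> nat \<Rightarrow> 'a polyfun \<Rightarrow> 'a polyfun"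
where
  "upper_part Q p k 0 f = (\<lambda>_. 0)"
| "upper_part Q p k (Suc d) f = (let r = Suc (p + d) in (\<lambda>c.
     upper_part Q p k d (\<lambda>c. f (c(p + d := k r + 1)) - (1 - Q) * f (c(p + d := k r))) c +
     Q * lower_part Q p k d f c))"

lemma lower_part_lincomb:
  "lower_part Q p k d (\<lambda>c. a * f c + b * g c) =
     (\<lambda>c. a * lower_part Q p k d f c + b * lower_part Q p k d g c)"
proof (induction d arbitrary: f g)
  case (Suc d)
  let ?h = "\<lambda>f c. (1 - Q) * f (c(Suc (p + d) := k (Suc (p + d)) + 1)) -
    f (c(Suc (p + d) := k (Suc (p + d))))"
  have "?h (\<lambda>c. a * f c + b * g c) = (\<lambda>c. a * ?h f c + b * ?h g c)"
    by (auto simp: algebra_simps)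
  then show ?case by (simp only: lower_part.simps Let_def Suc.IH)
qed simp

lemma upper_part_lincomb:
  "upper_part Q p k d (\<lambda>c. a * f c + b * g c) =
     (\<lambda>c. a * upper_part Q p k d f c + b * upper_part Q p k d g c)"
proof (induction d arbitrary: f g)
  case (Suc d)
  let ?h = "\<lambda>f c. f (c(p + d := k (Suc (p + d)) + 1)) -
    (1 - Q) * f (c(p + d := k (Suc (p + d))))"
  have "?h (\<lambda>c. a * f c + b * g c) = (\<lambda>c. a * ?h f c + b * ?h g c)"
    by (auto simp: algebra_simps)
  then show ?case
    by (simp only: upper_part.simps Let_def Suc.IH lower_part_lincomb) (simp add: algebra_simps)
qed simp

lemma upper_part_diff_scale:
  "upper_part Q p k d (\<lambda>c. f c - a * g c) c = upper_part Q p k d f c - a * upper_part Q p k d g c"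
  using fun_cong[OF upper_part_lincomb[of Q p k d 1 f "- a" g], of c] by simp

lemma il_sum_lincomb:
  "il_sum Q p k d u (\<lambda>c. a * f c + b * g c) =
     (\<lambda>c. a * il_sum Q p k d u f c + b * il_sum Q p k d u g c)"
proof (induction d arbitrary: u f g)
  case (Suc d)
  show ?case
    by (simp only: il_sum.simps Let_def Suc.IH)
      (simp add: algebra_simps sum.distrib sum_distrib_left sum_subtractf)
qed simp

lemma telescope_greaterThanAtMost_int:
  fixes g :: "int \<Rightarrow> 'a::ab_group_add"
  assumes "a \<le> b"
  shows "(\<Sum>y\<in>{a<..b}. g (y + 1) - g y) = g (b + 1) - g (a + 1)"
  using assms
proof (induction b rule: int_ge_induct)
  case (step b)
  then have "{a<..b + 1} = insert (b + 1) {a<..b}" by auto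
  then show ?case using step.IH by simp
qed simp

text \<open>Telescoping from the last variable inwards. The third hypothesis is the cancellation
  needed because the upper limit of variable i and the lower limit of variable i + 1 are the same
  \<open>k (Suc i)\<close>.\<close>

lemma il_sum_antidifference:
  assumes "\<And>i. p < i \<Longrightarrow> i < p + d \<Longrightarrow> k i < k (Suc i)"
    and "d > 0 \<Longrightarrow> k (p + d) \<le> u"
    and "\<And>i c y. p < i \<Longrightarrow> i < p + d \<Longrightarrow>
      B (c(i := y, Suc i := y)) + B (c(i := y + 1, Suc i := y + 1)) =
      (2 - Q) * B (c(i := y, Suc i := y + 1))"
  shows "il_sum Q p k d u (act (\<Prod>i\<in>{p<..p + d}. shf i - 1) B) =
    (\<lambda>c. upper_part Q p k d (\<lambda>c. B (c(p + d := u + 1))) c + lower_part Q p k d B c)"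
  using assms
proof (induction d arbitrary: u B)
  case (Suc d)
  define r where "r = Suc (p + d)"
  define P where "P = (\<Prod>i\<in>{p<..p + d}. shf i - 1 :: 'a shift_op)"
  let ?f = "act (\<Prod>i\<in>{p<..p + Suc d}. shf i - 1) B"
  show ?case
  proof
    fix c
    \<comment> \<open>\<open>X a y\<close> and \<open>Y y\<close> are what the first d variables
      leave at their upper and lower limits when variable r has value y; a is one more than the
      largest value allowed to variable p + d.\<close>
    define X where "X a y = upper_part Q p k d (\<lambda>c. B (c(p + d := a, r := y))) c" for a y
    define Y where "Y y = lower_part Q p k d (\<lambda>c. B (c(r := y))) c" for y
    have S: "{p<..p + Suc d} = insert r {p<..p + d}" "r \<notin> {p<..p + d}" by (auto simp: r_def)
    have f: "?f = act P (act (shf r - 1) B)"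
      unfolding S(1) using S(2) by (simp add: P_def act_mult mult.commute flip: act_mult)
    have fy: "(\<lambda>c. ?f (c(r := y))) = act P (\<lambda>c. 1 * B (c(r := y + 1)) + (-1) * B (c(r := y)))" for y
    proof
      fix c
      have "intertwines (\<lambda>c. c(r := y)) P P"
        unfolding P_def
        by (intro intertwines_intros intertwines_shf) (auto simp: r_def)
      from intertwinesD[OF this, of "act (shf r - 1) B" c]
      show "?f (c(r := y)) = act P (\<lambda>c. 1 * B (c(r := y + 1)) + (-1) * B (c(r := y))) c"
        unfolding f by (simp add: act_diff act_shf)
    qed
    have step: "il_sum Q p k d v (\<lambda>c. ?f (c(r := y))) c =
        (X (v + 1) (y + 1) + Y (y + 1)) - (X (v + 1) y + Y y)"
      if v: "d > 0 \<Longrightarrow> k (p + d) \<le> v" for v y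
    proof -
      let ?B = "\<lambda>c. 1 * B (c(r := y + 1)) + (-1) * B (c(r := y))"
      have lin: "1 * a + - 1 * a' + (1 * b + - 1 * b') = q * (1 * e + - 1 * e')"
        if "a + b = q * e" "a' + b' = q * e'" for a a' b b' q e e' :: 'a
      proof -
        have "1 * a + - 1 * a' + (1 * b + - 1 * b') = (a + b) - (a' + b')" by simp
        then show ?thesis unfolding that by (simp add: right_diff_distrib)
      qed
      have coll: "?B (c(i := z, Suc i := z)) + ?B (c(i := z + 1, Suc i := z + 1)) =
          (2 - Q) * ?B (c(i := z, Suc i := z + 1))" if "p < i" "i < p + d" for i z c
      proof -
        have *: "i \<noteq> r" "Suc i \<noteq> r" using that by (auto simp: r_def)
        have sw: "(c(i := a, Suc i := b))(r := e) = (c(r := e))(i := a, Suc i := b)" for a b e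
          using * by (simp add: fun_upd_twist)
        have "B ((c(r := e))(i := z, Suc i := z)) + B ((c(r := e))(i := z + 1, Suc i := z + 1)) =
          (2 - Q) * B ((c(r := e))(i := z, Suc i := z + 1))" for e
          by (rule Suc.prems(3)) (use that in simp_all)
        from this[of "y + 1"] this[of y] show ?thesis
          unfolding sw by (rule lin)
      qed
      have "il_sum Q p k d v (act P ?B) =
          (\<lambda>c. upper_part Q p k d (\<lambda>c. ?B (c(p + d := v + 1))) c + lower_part Q p k d ?B c)"
        unfolding P_def
        by (rule Suc.IH[OF _ v coll]) (use Suc.prems(1) in auto)
      then show ?thesis
        unfolding fy upper_part_lincomb lower_part_lincomb X_def Y_def by simp
    qed
    \<comment> \<open>An antidifference in y of the summand for y > \<open>k r\<close>; the
      coefficient \<open>Q - 1\<close> is that of \<open>il_sum\<close>.\<close>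
    define G where "G y = X (k r + 1) y + Y y + (Q - 1) * (X (k r) y + Y y)" for y
    have v: "d > 0 \<Longrightarrow> k (p + d) \<le> k r" "d > 0 \<Longrightarrow> k (p + d) \<le> k r - 1"
      using Suc.prems(1)[of "p + d"] by (auto simp: r_def)
    have "il_sum Q p k (Suc d) u ?f c =
        il_sum Q p k d (k r - 1) (\<lambda>c. ?f (c(r := k r))) c + (\<Sum>y\<in>{k r<..u}. G (y + 1) - G y)"
      unfolding il_sum.simps Let_def r_def[symmetric]
      by (intro arg_cong2[where f = "(+)"] sum.cong refl)
        (simp only: step[OF v(1)] step[OF v(2)], simp add: G_def algebra_simps)
    also have "(\<Sum>y\<in>{k r<..u}. G (y + 1) - G y) = G (u + 1) - G (k r + 1)"
      by (rule telescope_greaterThanAtMost_int) (use Suc.prems(2) in \<open>auto simp: r_def\<close>)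
    also have "il_sum Q p k d (k r - 1) (\<lambda>c. ?f (c(r := k r))) c =
        X (k r) (k r + 1) + Y (k r + 1) - (X (k r) (k r) + Y (k r))"
      by (subst step[OF v(2)]) auto
    finally have L: "il_sum Q p k (Suc d) u ?f c =
        X (k r) (k r + 1) + Y (k r + 1) - (X (k r) (k r) + Y (k r)) + (G (u + 1) - G (k r + 1))" .
    \<comment> \<open>This removes every \<open>X\<close> term at the lower end:
      \<open>X (k r) (k r + 1)\<close> comes once from y = \<open>k r\<close> and with -(Q - 1) from
      \<open>G (k r + 1)\<close>, in total 2 - Q. For d = 0 all \<open>X\<close> are zero.\<close>
    have coll: "X (k r) (k r) + X (k r + 1) (k r + 1) = (2 - Q) * X (k r) (k r + 1)"
    proof (cases "d = 0")
      case False
      have e: "B (c(p + d := k r, r := k r)) + B (c(p + d := k r + 1, r := k r + 1)) =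
          (2 - Q) * B (c(p + d := k r, r := k r + 1))" for c
        unfolding r_def by (rule Suc.prems(3)) (use False in simp_all)
      have "1 * B (c(p + d := k r, r := k r)) + 1 * B (c(p + d := k r + 1, r := k r + 1)) =
          (2 - Q) * B (c(p + d := k r, r := k r + 1)) + 0 * B c" for c
        by (simp only: e mult_1_left mult_zero_left add_0_right)
      then have "upper_part Q p k d (\<lambda>c. 1 * B (c(p + d := k r, r := k r)) +
            1 * B (c(p + d := k r + 1, r := k r + 1))) c =
          upper_part Q p k d (\<lambda>c. (2 - Q) * B (c(p + d := k r, r := k r + 1)) + 0 * B c) c"
        by (simp only:)
      then show ?thesis unfolding upper_part_lincomb X_def by simp
    qed (simp add: X_def)
    have U: "upper_part Q p k (Suc d) (\<lambda>c. B (c(p + Suc d := u + 1))) c =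
        X (k r + 1) (u + 1) - (1 - Q) * X (k r) (u + 1) + Q * Y (u + 1)"
    proof -
      have "upper_part Q p k d (\<lambda>c. B (c(p + d := k r + 1, r := u + 1)) -
            (1 - Q) * B (c(p + d := k r, r := u + 1))) c = X (k r + 1) (u + 1) - (1 - Q) * X (k r) (u + 1)"
        by (simp only: upper_part_diff_scale X_def)
      then show ?thesis
        by (simp add: Let_def Y_def flip: r_def)
    qed
    have W: "lower_part Q p k (Suc d) B c = (1 - Q) * Y (k r + 1) - Y (k r)"
      using fun_cong[OF lower_part_lincomb[of Q p k d "1 - Q" "\<lambda>c. B (c(r := k r + 1))"
          "-1" "\<lambda>c. B (c(r := k r))"], of c]
      by (simp add: Let_def Y_def flip: r_def)
    show "il_sum Q p k (Suc d) u ?f c =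
        upper_part Q p k (Suc d) (\<lambda>c. B (c(p + Suc d := u + 1))) c + lower_part Q p k (Suc d) B c"
      unfolding L U W G_def eq_diff_eq[THEN iffD2, OF coll] by (simp add: algebra_simps)
  qed
qed simp

text \<open>Up to sign, the contribution of a variable at its lower limit, and at the same time the
  denominator id - (1 - Q) E of \<Delta>^Q. This coincidence is what brings \<Delta>^Q in.
  \<open>up_op\<close> belongs to the upper limits.\<close>

definition low_op :: "'a::comm_ring_1 \<Rightarrow> nat \<Rightarrow> 'a shift_op" where
  "low_op Q i = 1 - scal (1 - Q) * shf i"

definition up_op :: "'a::comm_ring_1 \<Rightarrow> nat \<Rightarrow> 'a shift_op" where
  "up_op Q i = shf i - scal (1 - Q)"

lemma lower_part_closed:
  "lower_part Q p k d B c =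
     (-1) ^ d * act (\<Prod>i\<in>{p<..p + d}. low_op Q i) B (\<lambda>i. if p < i \<and> i \<le> p + d then k i else c i)"
proof (induction d arbitrary: B)
  case (Suc d)
  define r where "r = Suc (p + d)"
  define P where "P = (\<Prod>i\<in>{p<..p + d}. low_op Q i)"
  define c' where "c' = (\<lambda>i. if p < i \<and> i \<le> p + d then k i else c i)"
  have S: "{p<..p + Suc d} = insert r {p<..p + d}" "r \<notin> {p<..p + d}" by (auto simp: r_def)
  have c': "c'(r := k r) = (\<lambda>i. if p < i \<and> i \<le> p + Suc d then k i else c i)"
    by (auto simp: c'_def r_def)
  have i: "intertwines (\<lambda>c. c(r := k r)) P P"
    unfolding P_def low_op_def by (intro intertwines_intros intertwines_shf) (auto simp: r_def)
  have "(\<lambda>c. (1 - Q) * B (c(r := k r + 1)) - B (c(r := k r))) =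
      (\<lambda>c. - act (low_op Q r) B (c(r := k r)))"
    by (auto simp: low_op_def act_diff act_mult act_scal act_shf)
  then have "lower_part Q p k (Suc d) B c = (-1) ^ d * act P (\<lambda>c. - act (low_op Q r) B (c(r := k r))) c'"
    by (simp add: Let_def Suc.IH P_def c'_def flip: r_def)
  also have "\<dots> = (-1) ^ Suc d * act (P * low_op Q r) B (c'(r := k r))"
    by (simp add: act_fun_uminus act_mult flip: intertwinesD[OF i])
  finally show ?case
    unfolding c' S(1) using S(2) by (simp add: P_def mult.commute)
next
  case 0
  have "(\<lambda>i. if p < i \<and> i \<le> p then k i else c i) = c" by auto
  then show ?case by simp
qed

text \<open>Variables before index p + q sit at their own \<open>k i\<close>, the later ones at
  \<open>k (Suc i)\<close>, so exactly \<open>k (p + q)\<close> is left out: the shape of a term of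
  the Laplace expansion.\<close>

lemma upper_part_closed:
  "upper_part Q p k d B c =
     Q * (\<Sum>q\<in>{1..d}. (-1) ^ (q - 1) *
        act ((\<Prod>i\<in>{p<..<p + q}. low_op Q i) * (\<Prod>i\<in>{p + q..<p + d}. up_op Q i)) B
          (\<lambda>i. if p < i \<and> i < p + q then k i else if p + q \<le> i \<and> i < p + d then k (Suc i) else c i))"
proof (induction d arbitrary: B)
  case (Suc d)
  define r where "r = Suc (p + d)"
  define P where "P q = (\<Prod>i\<in>{p<..<p + q}. low_op Q i) * (\<Prod>i\<in>{p + q..<p + d}. up_op Q i)" for q
  define P' where "P' q = (\<Prod>i\<in>{p<..<p + q}. low_op Q i) * (\<Prod>i\<in>{p + q..<p + Suc d}. up_op Q i)" for q
  define pt where "pt q = (\<lambda>i. if p < i \<and> i < p + q then k i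
    else if p + q \<le> i \<and> i < p + d then k (Suc i) else c i)" for q
  define pt' where "pt' q = (\<lambda>i. if p < i \<and> i < p + q then k i
    else if p + q \<le> i \<and> i < p + Suc d then k (Suc i) else c i)" for q
  have B: "(\<lambda>c. B (c(p + d := k r + 1)) - (1 - Q) * B (c(p + d := k r))) =
      (\<lambda>c. act (up_op Q (p + d)) B (c(p + d := k r)))"
    by (auto simp: up_op_def act_diff act_scal act_shf)
  have "act (P q) (\<lambda>c. act (up_op Q (p + d)) B (c(p + d := k r))) (pt q) = act (P' q) B (pt' q)"
    if "q \<in> {1..d}" for q
  proof -
    have i: "intertwines (\<lambda>c. c(p + d := k r)) (P q) (P q)"
      unfolding P_def low_op_def up_op_def using that
      by (intro intertwines_intros intertwines_shf) auto
    have "{p + q..<p + Suc d} = insert (p + d) {p + q..<p + d}" using that by auto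
    then have "P' q = P q * up_op Q (p + d)"
      by (simp add: P_def P'_def mult_ac)
    moreover have "(pt q)(p + d := k r) = pt' q"
      using that by (auto simp: pt_def pt'_def r_def)
    ultimately show ?thesis
      by (simp add: act_mult flip: intertwinesD[OF i])
  qed
  then have 1: "upper_part Q p k d (\<lambda>c. act (up_op Q (p + d)) B (c(p + d := k r))) c =
      Q * (\<Sum>q\<in>{1..d}. (-1) ^ (q - 1) * act (P' q) B (pt' q))"
    unfolding Suc.IH P_def[symmetric] pt_def[symmetric] by simp
  have "{p<..<p + Suc d} = {p<..p + d}" by auto
  moreover have "pt' (Suc d) = (\<lambda>i. if p < i \<and> i \<le> p + d then k i else c i)"
    by (auto simp: pt'_def)
  ultimately have 2: "lower_part Q p k d B c = (-1) ^ d * act (P' (Suc d)) B (pt' (Suc d))"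
    by (simp add: lower_part_closed P'_def)
  have "upper_part Q p k (Suc d) B c =
      Q * (\<Sum>q\<in>{1..Suc d}. (-1) ^ (q - 1) * act (P' q) B (pt' q))"
    unfolding upper_part.simps Let_def r_def[symmetric] B 1 2 by (simp add: algebra_simps)
  then show ?case unfolding P'_def pt'_def .
qed simp

lemma il_sum_act_commute:
  assumes "\<And>r y. p < r \<Longrightarrow> intertwines (\<lambda>c. c(r := y)) T T"
  shows "il_sum Q p k d u (act T f) = act T (il_sum Q p k d u f)"
proof (induction d arbitrary: u f)
  case (Suc d)
  have "(\<lambda>c. act T f (c(Suc (p + d) := y))) = act T (\<lambda>c. f (c(Suc (p + d) := y)))" for y
    using assms[of "Suc (p + d)" y] by (auto simp: intertwines_def)
  then show ?case
    by (simp only: il_sum.simps Let_def Suc.IH act_fun_add act_fun_sum act_fun_scale)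
qed simp

subsection \<open>Symmetries of the generating operator\<close>

text \<open>Raising e is taking an antidifference. For e = 1 and z = x - h the binomial is (z + j)
  ... (z - j) / (2j + 1)!, hence odd in z. For e = 2 it is, up to sign and a shift, the one for e =
  0 and j + 1. The sign (-1)^j makes the determinant for e = 0 a shifted \<open>base_poly\<close>
  without a global sign.\<close>

definition sbinom :: "int \<Rightarrow> nat \<Rightarrow> nat \<Rightarrow> int \<Rightarrow> 'a::field_char_0" where
  "sbinom h e j x = (-1) ^ j * ((of_int (x - h) + of_nat j) gchoose (2 * j + e))"

lemma sbinom_difference: "sbinom h (Suc e) j (x + 1) - sbinom h (Suc e) j x = sbinom h e j x"
  using gbinomial_Suc_Suc[of "of_int (x - h) + of_nat j :: 'a" "2 * j + e"]
  by (simp add: sbinom_def algebra_simps)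

lemma sbinom_1_odd: "sbinom h 1 j (2 * h - x) = - sbinom h 1 j x"
  using gbinomial_minus[of "of_int (x - h) - of_nat j :: 'a" "2 * j + 1"]
  by (simp add: sbinom_def algebra_simps)

lemma sbinom_0_Suc: "sbinom h 0 (Suc j) x = - sbinom h 2 j (x + 1)"
  by (simp add: sbinom_def algebra_simps)

lemma sbinom_0_0 [simp]: "sbinom h 0 0 x = 1"
  by (simp add: sbinom_def)

lemma sbinom_difference_pow:
  assumes "2 * j + e < K"
  shows "((\<lambda>g x. g (x + 1) - g x) ^^ K) (sbinom h e j) = (\<lambda>_. 0 :: 'a::field_char_0)"
proof -
  let ?D = "\<lambda>(g :: int \<Rightarrow> 'a) x. g (x + 1) - g x"
  let ?b = "\<lambda>k x. (-1) ^ j * ((of_int (x - h) + of_nat j :: 'a) gchoose k)"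
  have D: "?D (?b (Suc k)) = ?b k" for k
  proof
    show "?D (?b (Suc k)) x = ?b k x" for x
      using gbinomial_Suc_Suc[of "of_int (x - h) + of_nat j :: 'a" k]
      by (simp add: algebra_simps)
  qed
  have D0: "(?D ^^ Suc k) (?b k) = (\<lambda>_. 0)" for k
  proof (induction k)
    case (Suc k)
    have "(?D ^^ Suc (Suc k)) (?b (Suc k)) = (?D ^^ Suc k) (?D (?b (Suc k)))"
      by (simp only: funpow_Suc_right comp_def)
    then show ?case using Suc.IH by (simp only: D)
  qed simp
  have Z: "(?D ^^ i) (\<lambda>_. 0) = (\<lambda>_. 0)" for i by (induction i) auto
  obtain K' where K: "K = K' + Suc (2 * j + e)"
    using assms by (metis Suc_leI le_add_diff_inverse2)
  have "(?D ^^ K) (?b (2 * j + e)) = (?D ^^ K') ((?D ^^ Suc (2 * j + e)) (?b (2 * j + e)))"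
    unfolding K by (simp only: funpow_add comp_apply)
  then show ?thesis unfolding D0 Z sbinom_def[abs_def] .
qed

definition bdet :: "int \<Rightarrow> nat \<Rightarrow> nat \<Rightarrow> 'a::field_char_0 polyfun" where
  "bdet h e m = altdet (sbinom h e) m"

lemma act_difference_bdet: "act (\<Prod>i\<in>{1..m}. shf i - 1) (bdet h (Suc e) m) = bdet h e m"
  by (simp only: bdet_def act_difference_altdet sbinom_difference)

lemma bdet_transpose:
  assumes "1 \<le> s" "s < t" "t \<le> m"
  shows "bdet h e m (\<lambda>i. c (Transposition.transpose s t i)) = - bdet h e m c"
  unfolding bdet_def using assms by (rule altdet_transpose)

lemma bdet_reflect_last:
  assumes "1 \<le> m"
  shows "bdet h 1 m (c(m := 2 * h - c m)) = - bdet h 1 m c"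
  unfolding bdet_def using assms sbinom_1_odd by (intro altdet_reflect_last)

definition skip :: "nat \<Rightarrow> (nat \<Rightarrow> int) \<Rightarrow> nat \<Rightarrow> int" where
  "skip q c = (\<lambda>i. if i < q then c i else c (Suc i))"

lemma act_prod_shf:
  assumes "finite A"
  shows "act (\<Prod>i\<in>A. shf i) f c = f (\<lambda>i. if i \<in> A then c i + 1 else c i)"
  using assms
proof (induction A arbitrary: c rule: finite_induct)
  case (insert a A)
  have "(\<lambda>i. if i \<in> A then (c(a := c a + 1)) i + 1 else (c(a := c a + 1)) i) =
      (\<lambda>i. if i \<in> insert a A then c i + 1 else c i)"
    using insert.hyps by auto
  then show ?case using insert by (simp add: act_mult act_shf)
qed simp

text \<open>For e = 0 the column j = 0 is constant, and every other column is minus a column for e =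
  2 moved by one, whence (-1)^m and the shifts.\<close>

lemma bdet_laplace:
  "bdet h 0 (Suc m) c = (\<Sum>q\<in>{1..Suc m}. (-1) ^ (q - 1) * (-1) ^ m *
     act (\<Prod>i\<in>{1..m}. shf i) (bdet h 2 m) (skip q c))"
proof -
  have *: "altdet (\<lambda>j. sbinom h 0 (Suc j)) m c' = (-1) ^ m * act (\<Prod>i\<in>{1..m}. shf i) (bdet h 2 m) c'" for c' :: "nat \<Rightarrow> int"
  proof -
    have "altdet (\<lambda>j. sbinom h 0 (Suc j)) m c' =
        (-1) ^ m * altdet (\<lambda>j x. sbinom h 2 j (x + 1)) m c'"
      unfolding altdet_expand sbinom_0_Suc sum_distrib_left
      by (intro sum.cong refl) (simp add: prod_uminus mult_ac)
    also have "altdet (\<lambda>j x. sbinom h 2 j (x + 1)) m c' =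
        bdet h 2 m (\<lambda>i. if i \<in> {1..m} then c' i + 1 else c' i)"
      unfolding bdet_def altdet_def by (intro arg_cong[where f = det] eq_matI) auto
    finally show ?thesis by (subst act_prod_shf) simp_all
  qed
  show ?thesis
    unfolding bdet_def[of h 0] altdet_laplace[of "sbinom h 0", OF sbinom_0_0] * skip_def mult.assoc ..
qed

section \<open>The Bethe operator and its symmetries\<close>

definition bfac :: "'a::comm_ring_1 \<Rightarrow> nat \<Rightarrow> nat \<Rightarrow> 'a shift_op" where
  "bfac Q s t = (shb s + shf t - scal (2 - Q)) * (shb s + shb t - scal (2 - Q))"

definition pairs :: "nat \<Rightarrow> (nat \<times> nat) set" where
  "pairs m = {(s, t). 1 \<le> s \<and> s < t \<and> t \<le> m}"

lemma finite_pairs [simp]: "finite (pairs m)"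
  by (rule finite_subset[of _ "{1..m} \<times> {1..m}"]) (auto simp: pairs_def)

text \<open>In F each pair s < t contributes \<open>shf s\<close> twice besides
  \<open>bfac Q s t\<close>, which makes 2(m - s) shifts of variable s; \<open>base_poly\<close> is
  the determinant shifted back by m - s, and the exponent m - s remains.\<close>

definition bop :: "'a::comm_ring_1 \<Rightarrow> nat \<Rightarrow> 'a shift_op" where
  "bop Q m = (\<Prod>s\<in>{1..m}. shf s ^ (m - s)) * (\<Prod>(s, t)\<in>pairs m. bfac Q s t)"

lemma intertwines_bfac:
  fixes Q :: "'a::comm_ring_1"
  assumes "intertwines \<sigma> (shb s :: 'a shift_op) (shb s')"
    "intertwines \<sigma> (shb t :: 'a shift_op) (shb t')" "intertwines \<sigma> (shf t :: 'a shift_op) (shf t')"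
  shows "intertwines \<sigma> (bfac Q s t) (bfac Q s' t')"
  unfolding bfac_def by (intro intertwines_intros assms)

lemma intertwines_transpose:
  "intertwines (\<lambda>c i. c (Transposition.transpose s t i)) (shf i :: 'a::comm_ring_1 shift_op) (shf (Transposition.transpose s t i))"
  "intertwines (\<lambda>c i. c (Transposition.transpose s t i)) (shb i :: 'a::comm_ring_1 shift_op) (shb (Transposition.transpose s t i))"
  by (intro intertwines_shf intertwines_shb; auto simp: fun_eq_iff Transposition.transpose_def)+

lemma intertwines_prod_bij:
  assumes "bij_betw \<pi> A A" "\<And>i. i \<in> A \<Longrightarrow> intertwines \<sigma> (p i) (p (\<pi> i))"
  shows "intertwines \<sigma> (\<Prod>i\<in>A. p i) (\<Prod>i\<in>A. p i)"
proof -
  have "intertwines \<sigma> (\<Prod>i\<in>A. p i) (\<Prod>i\<in>A. p (\<pi> i))"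
    by (rule intertwines_prod) (rule assms(2))
  then show ?thesis using prod.reindex_bij_betw[OF assms(1), of p] by simp
qed

text \<open>At a point with c_s = c_(s+1) = y it gives f(y,y) + f(y+1,y+1) - (2-Q) f(y,y+1), whose
  vanishing \<open>il_sum_antidifference\<close> demands.\<close>

definition collision :: "'a::comm_ring_1 \<Rightarrow> nat \<Rightarrow> 'a shift_op" where
  "collision Q s = 1 + shf s * shf (Suc s) - scal (2 - Q) * shf (Suc s)"

text \<open>\<open>collision\<close> is E_(s+1) times E_(s+1)^-1 + E_s - (2 - Q), the mirror image
  of the first factor of \<open>bfac Q s (Suc s)\<close>, and its E_(s+1) makes the exponents of E_s
  and E_(s+1) equal. The other pairs are permuted in order, s and s + 1 being neighbours.\<close>

lemma intertwines_collision_bop: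
  assumes "1 \<le> s" "Suc s \<le> m"
  shows "intertwines (\<lambda>c i. c (Transposition.transpose s (Suc s) i)) (collision Q s * bop Q m) (collision Q s * bop Q m)"
proof -
  let ?\<tau> = "Transposition.transpose s (Suc s)"
  let ?\<sigma> = "\<lambda>(c :: nat \<Rightarrow> int) i. c (?\<tau> i)"
  let ?P = "pairs m - {(s, Suc s)}" and ?S = "{1..m} - {s, Suc s}"
  have P: "(\<Prod>(s, t)\<in>pairs m. bfac Q s t) = bfac Q s (Suc s) * (\<Prod>(s, t)\<in>?P. bfac Q s t)"
  proof -
    have "(s, Suc s) \<in> pairs m" using assms by (simp add: pairs_def)
    then show ?thesis by (subst prod.remove[OF finite_pairs]) auto
  qed
  have S: "(\<Prod>s\<in>{1..m}. shf s ^ (m - s)) =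
      shf s ^ (m - s) * shf (Suc s) ^ (m - Suc s) * (\<Prod>s\<in>?S. shf s ^ (m - s) :: 'a shift_op)"
    using assms by (subst prod.subset_diff[of "{s, Suc s}"]) (auto simp: mult_ac)
  define x where "x = (shf s :: 'a shift_op)"
  define y where "y = (shf (Suc s) :: 'a shift_op)"
  define x' where "x' = (shb s :: 'a shift_op)"
  define y' where "y' = (shb (Suc s) :: 'a shift_op)"
  define a where "a = (scal (2 - Q) :: 'a shift_op)"
  \<comment> \<open>The part of the operator in s and s + 1 alone, now visibly symmetric.\<close>
  define M where "M = (\<lambda>x y x' y'. (x * y) ^ (m - s) *
      ((y' + x - a) * (x' + y - a) * (x' + y' - a)))"
  have xy: "x * x' = 1" "y * y' = 1" by (simp_all add: x_def x'_def y_def y'_def)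
  have e1: "(x * y) ^ (m - s) = x ^ (m - s) * y ^ (m - Suc s) * y"
  proof -
    have "m - s = Suc (m - Suc s)" using assms by simp
    then show ?thesis by (simp add: power_mult_distrib mult_ac)
  qed
  have e2: "1 + x * y - a * y = y * (y' + x - a)" using xy by (simp add: algebra_simps)
  have eM: "M x y x' y' = (1 + x * y - a * y) * (x ^ (m - s) * y ^ (m - Suc s)) *
       ((x' + y - a) * (x' + y' - a))"
    by (simp only: M_def e1 e2 mult_ac)
  have eq: "collision Q s * bop Q m = M x y x' y' *
      (\<Prod>s\<in>?S. shf s ^ (m - s)) * (\<Prod>(s, t)\<in>?P. bfac Q s t)"
    unfolding bop_def P S collision_def bfac_def[of _ s "Suc s"]
      x_def[symmetric] y_def[symmetric] x'_def[symmetric] y'_def[symmetric] a_def[symmetric] eM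
    by (simp only: mult_ac)
  have xyi: "intertwines ?\<sigma> x y" "intertwines ?\<sigma> y x" "intertwines ?\<sigma> x' y'" "intertwines ?\<sigma> y' x'"
    "intertwines ?\<sigma> a a"
    using intertwines_transpose[where 'a = 'a, of s "Suc s" s]
      intertwines_transpose[where 'a = 'a, of s "Suc s" "Suc s"]
    by (simp_all add: x_def y_def x'_def y'_def a_def)
  have "M y x y' x' = M x y x' y'" by (simp add: M_def algebra_simps)
  moreover have "intertwines ?\<sigma> (M x y x' y') (M y x y' x')"
    unfolding M_def by (intro intertwines_intros xyi)
  ultimately have 1: "intertwines ?\<sigma> (M x y x' y') (M x y x' y')" by simp
  have 2: "intertwines ?\<sigma> (\<Prod>s\<in>?S. shf s ^ (m - s) :: 'a shift_op) (\<Prod>s\<in>?S. shf s ^ (m - s))"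
  proof (rule intertwines_prod)
    fix i assume "i \<in> ?S"
    then have "?\<tau> i = i" by simp
    then show "intertwines ?\<sigma> (shf i ^ (m - i) :: 'a shift_op) (shf i ^ (m - i))"
      using intertwines_transpose(1)[where 'a = 'a, of s "Suc s" i] by (simp add: intertwines_power)
  qed
  have 3: "intertwines ?\<sigma> (\<Prod>(s, t)\<in>?P. bfac Q s t) (\<Prod>(s, t)\<in>?P. bfac Q s t)"
  proof (rule intertwines_prod_bij[where \<pi> = "map_prod ?\<tau> ?\<tau>"])
    have sub: "map_prod ?\<tau> ?\<tau> ` ?P \<subseteq> ?P"
      using assms by (auto simp: pairs_def Transposition.transpose_def split: if_splits)
    moreover have "map_prod ?\<tau> ?\<tau> (map_prod ?\<tau> ?\<tau> z) = z" for z by (cases z) simp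
    ultimately show "bij_betw (map_prod ?\<tau> ?\<tau>) ?P ?P"
      by (intro bij_betw_byWitness[where f' = "map_prod ?\<tau> ?\<tau>"]) auto
    show "intertwines ?\<sigma> (case z of (s, t) \<Rightarrow> bfac Q s t)
        (case map_prod ?\<tau> ?\<tau> z of (s, t) \<Rightarrow> bfac Q s t)" for z
      by (cases z) (auto intro!: intertwines_bfac intertwines_transpose)
  qed
  show ?thesis unfolding eq by (intro intertwines_mult 1 2 3)
qed

text \<open>A symmetric operator keeps an antisymmetric function antisymmetric, so the result
  vanishes on the diagonal. R leaves room for the differences of frozen variables and for
  \<open>low_op\<close> factors.\<close>

lemma act_collision_zero:
  assumes s: "1 \<le> s" "Suc s \<le> m"
    and R: "intertwines (\<lambda>c i. c (Transposition.transpose s (Suc s) i)) R R"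
    and c: "c s = c (Suc s)"
  shows "act (collision Q s * (R * bop Q m)) (bdet h e m) c = 0"
proof -
  let ?\<sigma> = "\<lambda>(c :: nat \<Rightarrow> int) i. c (Transposition.transpose s (Suc s) i)"
  let ?T = "collision Q s * (R * bop Q m)"
  have "intertwines ?\<sigma> ?T ?T"
    using intertwines_mult[OF R intertwines_collision_bop[OF s, of Q]] by (simp add: mult_ac)
  from intertwinesD[OF this, of "bdet h e m" c]
  have "act ?T (bdet h e m) (?\<sigma> c) = - act ?T (bdet h e m) c"
    using s by (simp add: bdet_transpose act_fun_uminus)
  moreover have "?\<sigma> c = c" using c by (auto simp: Transposition.transpose_def)
  ultimately show ?thesis by simp
qed

text \<open>Reflection at h exchanges E_m and E_m^-1 and with them the two factors of
  \<open>bfac Q s m\<close>; E_m has exponent 0 in the power part of \<open>bop\<close>, and as p <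
  m the differences do not involve m. So the operator is invariant while the determinant for e = 1
  changes sign.\<close>

lemma act_reflect_zero:
  assumes "p < m" "c m = h"
  shows "act ((\<Prod>i\<in>{1..p}. shf i - 1) * bop Q m) (bdet h 1 m) c = 0"
proof -
  let ?\<sigma> = "\<lambda>c :: nat \<Rightarrow> int. c(m := 2 * h - c m)"
  let ?T = "(\<Prod>i\<in>{1..p}. shf i - 1) * bop Q m"
  have o: "intertwines ?\<sigma> (shf i) (shf i)" "intertwines ?\<sigma> (shb i) (shb i)" if "i \<noteq> m" for i
    using that by (auto intro!: intertwines_shf intertwines_shb)
  have m: "intertwines ?\<sigma> (shf m) (shb m)" "intertwines ?\<sigma> (shb m) (shf m)"
    by (auto simp: intertwines_def act_shf act_shb algebra_simps)
  have "intertwines ?\<sigma> (bfac Q s t) (bfac Q s t)" if "(s, t) \<in> pairs m" for s t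
  proof (cases "t = m")
    case True
    have "intertwines ?\<sigma> (bfac Q s m) ((shb s + shb m - scal (2 - Q)) * (shb s + shf m - scal (2 - Q)))"
      unfolding bfac_def using that m o(2)[of s] by (intro intertwines_intros) (auto simp: pairs_def)
    then show ?thesis using True by (simp add: bfac_def mult.commute)
  next
    case False
    then show ?thesis using that by (intro intertwines_bfac o) (auto simp: pairs_def)
  qed
  then have "intertwines ?\<sigma> (\<Prod>(s, t)\<in>pairs m. bfac Q s t) (\<Prod>(s, t)\<in>pairs m. bfac Q s t)"
    by (intro intertwines_prod) auto
  moreover have "intertwines ?\<sigma> (shf s ^ (m - s)) (shf s ^ (m - s))" for s
    by (cases "s = m") (auto intro: intertwines_power o)
  moreover have "intertwines ?\<sigma> (\<Prod>i\<in>{1..p}. shf i - 1) (\<Prod>i\<in>{1..p}. shf i - 1)"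
    using assms(1) by (intro intertwines_intros o) auto
  ultimately have "intertwines ?\<sigma> ?T ?T"
    unfolding bop_def by (intro intertwines_mult intertwines_prod[of "{1..m}"])
  from intertwinesD[OF this, of "bdet h 1 m" c]
  have "act ?T (bdet h 1 m) (?\<sigma> c) = - act ?T (bdet h 1 m) c"
    using assms by (simp add: bdet_reflect_last[unfolded One_nat_def] act_fun_uminus)
  moreover have "?\<sigma> c = c" using assms by auto
  ultimately show ?thesis by simp
qed

section \<open>Functions that do not depend on one variable\<close>

lemma intertwines_skip:
  "i < q \<Longrightarrow> intertwines (skip q) (shf i) (shf i)"
  "i < q \<Longrightarrow> intertwines (skip q) (shb i) (shb i)"
  "q \<le> i \<Longrightarrow> intertwines (skip q) (shf i) (shf (Suc i))"
  "q \<le> i \<Longrightarrow> intertwines (skip q) (shb i) (shb (Suc i))"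
  "intertwines (skip q) 1 (shf q)"
  "intertwines (skip q) 1 (shb q)"
proof -
  have "skip q (c(q := y)) = skip q c" for c y by (auto simp: skip_def)
  then show "intertwines (skip q) 1 (shf q)" "intertwines (skip q) 1 (shb q)"
    by (simp_all add: intertwines_def act_shf act_shb)
qed (auto intro!: intertwines_shf intertwines_shb simp: skip_def fun_eq_iff)

lemma shb_low_op: "shb i * low_op Q i = shb i - scal (1 - Q)"
proof -
  have "shb i * low_op Q i = shb i - scal (1 - Q) * (shf i * shb i)"
    by (simp only: low_op_def right_diff_distrib mult_1_right mult_1_left mult_ac)
  then show ?thesis by simp
qed

text \<open>Behind \<open>skip q\<close> the shift of variable q acts as 1. Then
  \<open>bfac Q i q\<close> with i < q becomes the square of \<open>shb i * low_op Q i\<close>, and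
  \<open>bfac Q q (Suc i)\<close> becomes \<open>shb i * low_op Q i * up_op Q i\<close>. For i < q
  one \<open>shb i\<close> is absorbed by the exponent of E_i, which grows by one with m. Apart from
  a product over all i, this leaves the \<open>low_op\<close> and \<open>up_op\<close> of
  \<open>upper_part_closed\<close>.\<close>

lemma intertwines_skip_bop:
  assumes "1 \<le> q" "q \<le> Suc m"
  shows "intertwines (skip q)
    (bop Q m * (\<Prod>i\<in>{1..m}. shb i * low_op Q i) * ((\<Prod>i\<in>{1..<q}. low_op Q i) * (\<Prod>i\<in>{q..m}. up_op Q i)))
    (bop Q (Suc m))"
proof -
  \<comment> \<open>The renumbering of the m old variables that leaves the index q free.\<close>
  define \<iota> where "\<iota> i = (if i < q then i else Suc i)" for i
  have inj: "inj \<iota>" by (auto simp: inj_def \<iota>_def split: if_splits)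
  let ?L = "{1..<q}" and ?R = "{Suc q..Suc m}"
  have im: "\<iota> ` {1..m} = {1..Suc m} - {q}"
  proof
    show "{1..Suc m} - {q} \<subseteq> \<iota> ` {1..m}"
    proof
      fix x assume "x \<in> {1..Suc m} - {q}"
      then have "x = \<iota> (if x < q then x else x - 1)" "(if x < q then x else x - 1) \<in> {1..m}"
        using assms by (auto simp: \<iota>_def)
      then show "x \<in> \<iota> ` {1..m}" by blast
    qed
  qed (use assms in \<open>auto simp: \<iota>_def\<close>)
  have pow: "(\<Prod>s\<in>{1..Suc m}. shf s ^ (Suc m - s)) =
      shf q ^ (Suc m - q) * ((\<Prod>s\<in>{1..m}. shf (\<iota> s) ^ (m - s)) * (\<Prod>i\<in>?L. shf i :: 'a shift_op))"
  proof -
    have "(\<Prod>s\<in>{1..Suc m} - {q}. shf s ^ (Suc m - s) :: 'a shift_op) =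
        (\<Prod>s\<in>{1..m}. shf (\<iota> s) ^ (Suc m - \<iota> s))"
      unfolding im[symmetric] using inj by (subst prod.reindex) (auto intro: inj_on_subset)
    also have "\<dots> = (\<Prod>s\<in>{1..m}. shf (\<iota> s) ^ (m - s) * (if s \<in> ?L then shf s else 1))"
      using assms by (intro prod.cong refl) (auto simp: \<iota>_def Suc_diff_le mult.commute)
    also have "\<dots> = (\<Prod>s\<in>{1..m}. shf (\<iota> s) ^ (m - s)) * (\<Prod>i\<in>?L. shf i)"
    proof -
      have "{1..m} \<inter> {i. i \<in> ?L} = ?L" using assms by auto
      then show ?thesis unfolding prod.distrib by (subst prod.If_cases) simp_all
    qed
    finally show ?thesis using assms by (subst prod.remove[of _ q]) auto
  qed
  have prs: "(\<Prod>(s, t)\<in>pairs (Suc m). bfac Q s t) =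
      (\<Prod>(s, t)\<in>pairs m. bfac Q (\<iota> s) (\<iota> t)) * ((\<Prod>i\<in>?L. bfac Q i q) * (\<Prod>i\<in>?R. bfac Q q i))"
  proof -
    let ?A = "map_prod \<iota> \<iota> ` pairs m" and ?B = "(\<lambda>i. (i, q)) ` ?L" and ?C = "(\<lambda>i. (q, i)) ` ?R"
    have split: "pairs (Suc m) = ?A \<union> (?B \<union> ?C)"
    proof
      show "pairs (Suc m) \<subseteq> ?A \<union> (?B \<union> ?C)"
      proof
        fix z assume z: "z \<in> pairs (Suc m)"
        obtain s t where st: "z = (s, t)" by (cases z)
        consider "s = q" | "t = q" | "s \<noteq> q" "t \<noteq> q" by blast
        then show "z \<in> ?A \<union> (?B \<union> ?C)"
        proof cases
          case 3
          let ?f = "\<lambda>x. if x < q then x else x - 1"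
          have "\<iota> (?f s) = s" "\<iota> (?f t) = t" using 3 assms by (auto simp: \<iota>_def)
          moreover have "?f s < ?f t" "1 \<le> ?f s" "?f t \<le> m"
            using z assms 3 by (auto simp: st pairs_def)
          ultimately have "z = map_prod \<iota> \<iota> (?f s, ?f t)" "(?f s, ?f t) \<in> pairs m"
            unfolding st pairs_def by (simp_all only: map_prod_simp mem_Collect_eq split_conv)
          then show ?thesis by (metis UnI1 imageI)
        qed (use z in \<open>auto simp: st pairs_def\<close>)
      qed
      show "?A \<union> (?B \<union> ?C) \<subseteq> pairs (Suc m)"
        using assms by (auto simp: pairs_def \<iota>_def)
    qed
    have fin: "finite ?A" "finite ?B" "finite ?C" by auto
    have "\<iota> i \<noteq> q" for i by (simp add: \<iota>_def)
    then have A: "fst z \<noteq> q \<and> snd z \<noteq> q" if "z \<in> ?A" for z using that by fastforce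
    have BC: "fst z = q \<or> snd z = q" if "z \<in> ?B \<union> ?C" for z using that by auto
    have disj: "?A \<inter> (?B \<union> ?C) = {}" using A BC by blast
    have disj': "?B \<inter> ?C = {}" by auto
    have "(\<Prod>z\<in>?A. case z of (s, t) \<Rightarrow> bfac Q s t) = (\<Prod>(s, t)\<in>pairs m. bfac Q (\<iota> s) (\<iota> t))"
      using inj by (subst prod.reindex) (auto intro!: prod.cong simp: inj_on_def inj_def)
    moreover have "(\<Prod>z\<in>?B. case z of (s, t) \<Rightarrow> bfac Q s t) = (\<Prod>i\<in>?L. bfac Q i q)"
      by (subst prod.reindex) (auto simp: inj_on_def)
    moreover have "(\<Prod>z\<in>?C. case z of (s, t) \<Rightarrow> bfac Q s t) = (\<Prod>i\<in>?R. bfac Q q i)"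
      by (subst prod.reindex) (auto simp: inj_on_def)
    ultimately show ?thesis
      unfolding split prod.union_disjoint[OF fin(1) finite_UnI[OF fin(2,3)] disj]
        prod.union_disjoint[OF fin(2,3) disj'] by simp
  qed
  have RR: "(\<Prod>i\<in>?R. bfac Q q i) = (\<Prod>i\<in>{q..m}. bfac Q q (Suc i))"
    by (rule prod.reindex_bij_witness[where i = Suc and j = "\<lambda>i. i - 1"]) auto
  have target: "bop Q (Suc m) = shf q ^ (Suc m - q) *
      ((\<Prod>s\<in>{1..m}. shf (\<iota> s) ^ (m - s)) * (\<Prod>(s, t)\<in>pairs m. bfac Q (\<iota> s) (\<iota> t))) *
      ((\<Prod>i\<in>?L. shf i * bfac Q i q) * (\<Prod>i\<in>{q..m}. bfac Q q (Suc i)))"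
    unfolding bop_def pow prs RR prod.distrib by (simp only: mult_ac)
  have \<iota>E: "intertwines (skip q) (shf i) (shf (\<iota> i))" "intertwines (skip q) (shb i) (shb (\<iota> i))" for i
    by (auto simp: \<iota>_def intro: intertwines_skip)
  have a: "scal (2 - Q) = 1 + scal (1 - Q)"
    using scal_add[of 1 "1 - Q"] by simp
  have L: "intertwines (skip q) (shb i * low_op Q i * low_op Q i) (shf i * bfac Q i q)" if "i \<in> ?L" for i
  proof -
    have "shf i * ((shb i + 1 - scal (2 - Q)) * (shb i + 1 - scal (2 - Q))) = shb i * low_op Q i * low_op Q i"
    proof -
      have "shb i + 1 - scal (2 - Q) = shb i * low_op Q i"
        by (simp add: a shb_low_op)
      moreover have "shf i * ((shb i * low_op Q i) * (shb i * low_op Q i)) =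
          (shf i * shb i) * (shb i * low_op Q i * low_op Q i)"
        by (simp only: mult_ac)
      ultimately show ?thesis by simp
    qed
    moreover have "intertwines (skip q) (shf i * ((shb i + 1 - scal (2 - Q)) * (shb i + 1 - scal (2 - Q))))
        (shf i * bfac Q i q)"
      unfolding bfac_def using that by (intro intertwines_intros intertwines_skip) auto
    ultimately show ?thesis by simp
  qed
  have R: "intertwines (skip q) (shb i * low_op Q i * up_op Q i) (bfac Q q (Suc i))" if "i \<in> {q..m}" for i
  proof -
    have "1 + shb i - scal (2 - Q) = shb i * low_op Q i" "1 + shf i - scal (2 - Q) = up_op Q i"
      by (simp_all add: a shb_low_op up_op_def)
    then have "(1 + shf i - scal (2 - Q)) * (1 + shb i - scal (2 - Q)) = shb i * low_op Q i * up_op Q i"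
      by (simp add: mult_ac)
    moreover have "intertwines (skip q) ((1 + shf i - scal (2 - Q)) * (1 + shb i - scal (2 - Q))) (bfac Q q (Suc i))"
      unfolding bfac_def using that by (intro intertwines_intros intertwines_skip) auto
    ultimately show ?thesis by simp
  qed
  have "{1..m} = ?L \<union> {q..m}" using assms by auto
  then have un: "(\<Prod>i\<in>{1..m}. f i) = (\<Prod>i\<in>?L. f i) * (\<Prod>i\<in>{q..m}. f i)" for f :: "nat \<Rightarrow> 'a shift_op"
    by (simp only:) (rule prod.union_disjoint, auto)
  have src: "(\<Prod>i\<in>{1..m}. shb i * low_op Q i) * ((\<Prod>i\<in>?L. low_op Q i) * (\<Prod>i\<in>{q..m}. up_op Q i)) =
      (\<Prod>i\<in>?L. shb i * low_op Q i * low_op Q i) * (\<Prod>i\<in>{q..m}. shb i * low_op Q i * up_op Q i)"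
    unfolding un prod.distrib by (simp only: mult_ac)
  have 1: "intertwines (skip q) (1 ^ (Suc m - q)) (shf q ^ (Suc m - q))"
    by (intro intertwines_power intertwines_skip)
  have 2: "intertwines (skip q) (bop Q m)
      ((\<Prod>s\<in>{1..m}. shf (\<iota> s) ^ (m - s)) * (\<Prod>(s, t)\<in>pairs m. bfac Q (\<iota> s) (\<iota> t)))"
    unfolding bop_def
    by (intro intertwines_mult intertwines_prod intertwines_power \<iota>E)
      (auto intro!: intertwines_bfac \<iota>E)
  have "intertwines (skip q) (1 ^ (Suc m - q) * bop Q m *
      ((\<Prod>i\<in>?L. shb i * low_op Q i * low_op Q i) * (\<Prod>i\<in>{q..m}. shb i * low_op Q i * up_op Q i))) (bop Q (Suc m))"
    unfolding target by (intro intertwines_mult[OF intertwines_mult[OF 1 2]] intertwines_mult intertwines_prod L R)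
  then show ?thesis unfolding src[symmetric] by (simp add: mult.assoc)
qed

definition level_even :: "'a::field_char_0 \<Rightarrow> int \<Rightarrow> nat \<Rightarrow> 'a polyfun" where
  "level_even Q h m = act (bop Q m) (bdet h 0 m)"

text \<open>One summation of \<open>level_even\<close>: only the lower limits survive, each with a
  factor -\<open>low_op\<close>, and e rises to 1.\<close>

definition level_odd :: "'a::field_char_0 \<Rightarrow> int \<Rightarrow> nat \<Rightarrow> 'a polyfun" where
  "level_odd Q h m = (\<lambda>c. (-1) ^ m * act ((\<Prod>i\<in>{1..m}. low_op Q i) * bop Q m) (bdet h 1 m) c)"

text \<open>The shifts of \<open>bdet_laplace\<close> cancel the inverse shifts of
  \<open>intertwines_skip_bop\<close>. What remains has the form of the terms in
  \<open>upper_part_closed\<close>, with q as the deleted index.\<close>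

lemma level_even_Suc:
  "level_even Q h (Suc m) c = (\<Sum>q\<in>{1..Suc m}. (-1) ^ (q - 1) * (-1) ^ m *
     act (bop Q m * (\<Prod>i\<in>{1..m}. low_op Q i) * ((\<Prod>i\<in>{1..<q}. low_op Q i) * (\<Prod>i\<in>{q..m}. up_op Q i)))
       (bdet h 2 m) (skip q c))"
proof -
  have "act (bop Q (Suc m)) (\<lambda>c. act (\<Prod>i\<in>{1..m}. shf i) (bdet h 2 m) (skip q c)) c =
      act (bop Q m * (\<Prod>i\<in>{1..m}. low_op Q i) * ((\<Prod>i\<in>{1..<q}. low_op Q i) * (\<Prod>i\<in>{q..m}. up_op Q i)))
       (bdet h 2 m) (skip q c)" if "q \<in> {1..Suc m}" for q
  proof -
    have q: "1 \<le> q" "q \<le> Suc m" using that by auto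
    have "(\<Prod>i\<in>{1..m}. shb i * low_op Q i) * (\<Prod>i\<in>{1..m}. shf i) = (\<Prod>i\<in>{1..m}. low_op Q i)"
    proof -
      have "shb i * low_op Q i * shf i = (shf i * shb i) * low_op Q i" for i by (simp only: mult_ac)
      then show ?thesis unfolding prod.distrib[symmetric] by (intro prod.cong refl) simp
    qed
    moreover have "bop Q m * X * Y * Z = bop Q m * (X * Z) * Y" for X Y Z by (simp only: mult_ac)
    ultimately have "bop Q m * (\<Prod>i\<in>{1..m}. shb i * low_op Q i) *
        ((\<Prod>i\<in>{1..<q}. low_op Q i) * (\<Prod>i\<in>{q..m}. up_op Q i)) * (\<Prod>i\<in>{1..m}. shf i) =
        bop Q m * (\<Prod>i\<in>{1..m}. low_op Q i) * ((\<Prod>i\<in>{1..<q}. low_op Q i) * (\<Prod>i\<in>{q..m}. up_op Q i))"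
      by simp
    then show ?thesis
      by (simp only: act_mult[symmetric] flip: intertwinesD[OF intertwines_skip_bop[OF q]])
  qed
  then show ?thesis
    unfolding level_even_def bdet_laplace[abs_def] act_fun_sum act_fun_scale
    by (intro sum.cong) auto
qed

subsection \<open>Difference operators on polynomial functions\<close>

text \<open>Stands in for polynomiality: it makes the series of \<Delta>^Q finite, with one bound K
  for all variables, and is inherited by \<open>act T f\<close>.\<close>

definition nilp :: "nat \<Rightarrow> 'a::field_char_0 polyfun \<Rightarrow> bool" where
  "nilp K f \<longleftrightarrow> (\<forall>r. act ((shf r - 1) ^ K) f = (\<lambda>_. 0))"

lemma fdiff_pow_eq_act: "(fdiff r ^^ i) f = act ((shf r - 1) ^ i) f"
  by (induction i) (simp_all add: act_mult act_diff act_shf fdiff_def shiftE_def)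

lemma nilp_act:
  assumes "nilp K f"
  shows "nilp K (act T f)"
proof -
  have "act ((shf r - 1) ^ K) (act T f) = act T (act ((shf r - 1) ^ K) f)" for r
    by (simp only: act_mult[symmetric] mult.commute)
  then show ?thesis using assms by (simp add: nilp_def)
qed

lemma nilp_bdet:
  assumes "2 * m + e \<le> K" "K > 0"
  shows "nilp K (bdet h e m)"
  unfolding nilp_def bdet_def
  by (intro allI act_difference_pow_altdet sbinom_difference_pow) (use assms in auto)

text \<open>The truncation of \<Delta>^Q after K terms. Being a Laurent polynomial it can be
  multiplied in the ring.\<close>

definition qd_op :: "'a::field_char_0 \<Rightarrow> nat \<Rightarrow> nat \<Rightarrow> 'a shift_op" where
  "qd_op Q K r = scal (inverse Q) * (\<Sum>i<K. scal ((inverse Q - 1) ^ i) * (shf r - 1) ^ i) * (shf r - 1)"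

lemma qdiff_eq_act:
  assumes "nilp K f"
  shows "qdiff Q r f = act (qd_op Q K r) f"
proof
  fix c
  have "(fdiff r ^^ K) f = (\<lambda>_. 0)" using assms by (simp add: nilp_def fdiff_pow_eq_act)
  from qdiff_eq_sum[OF this] show "qdiff Q r f c = act (qd_op Q K r) f c"
    unfolding fdiff_pow_eq_act Suc_eq_plus1[symmetric] power_Suc2
    by (simp add: qd_op_def act_mult act_scal act_sum)
qed

text \<open>Not an identity in the ring: the truncated series leaves a multiple of
  \<open>(shf r - 1) ^ (K + 1)\<close>, which kills f.\<close>

lemma act_qd_op_low_op:
  assumes "Q \<noteq> 0" "nilp K f"
  shows "act (qd_op Q K r * low_op Q r) f = act (shf r - 1) f"
proof -
  have "act (low_op Q r) f = (\<lambda>c. f c - (1 - Q) * shiftE r f c)"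
    by (simp add: low_op_def act_diff act_mult act_scal act_shf shiftE_def)
  then have "act (qd_op Q K r * low_op Q r) f = qdiff Q r (\<lambda>c. f c - (1 - Q) * shiftE r f c)"
    by (metis act_mult qdiff_eq_act[OF nilp_act[OF assms(2)]])
  also have "\<dots> = fdiff r f"
    by (rule qdiff_resolvent[OF assms(1), where k = K])
      (use assms in \<open>simp add: nilp_def fdiff_pow_eq_act\<close>)
  finally show ?thesis using fdiff_pow_eq_act[of 1 r f] by simp
qed

lemma act_prod_qd_op_low_op:
  assumes "Q \<noteq> 0" "nilp K f" "finite A"
  shows "act (\<Prod>i\<in>A. qd_op Q K i * low_op Q i) f = act (\<Prod>i\<in>A. shf i - 1) f"
  using assms(3)
proof (induction A rule: finite_induct)
  case (insert a A)
  have "act (\<Prod>i\<in>insert a A. qd_op Q K i * low_op Q i) f =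
      act (qd_op Q K a * low_op Q a) (act (\<Prod>i\<in>A. shf i - 1) f)"
    using insert.hyps by (simp add: insert.IH act_mult)
  also have "\<dots> = act (shf a - 1) (act (\<Prod>i\<in>A. shf i - 1) f)"
    by (rule act_qd_op_low_op[OF assms(1) nilp_act[OF assms(2)]])
  finally show ?case using insert.hyps by (simp add: act_mult)
qed simp

text \<open>Only variables in A are shifted. In this encoding the others may be overwritten by
  constants before or after acting, so closure under the ring operations follows from the lemmas on
  \<open>intertwines\<close>.\<close>

definition local_op :: "nat set \<Rightarrow> 'a::comm_ring_1 shift_op \<Rightarrow> bool" where
  "local_op A T \<longleftrightarrow> (\<forall>c'. intertwines (\<lambda>c i. if i \<in> A then c i else c' i) T T)"

lemma local_opD: "local_op A T \<Longrightarrow> intertwines (\<lambda>c i. if i \<in> A then c i else c' i) T T"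
  by (simp add: local_op_def)

lemma local_op_intros:
  "i \<in> A \<Longrightarrow> local_op A (shf i)" "i \<in> A \<Longrightarrow> local_op A (shb i)"
  "local_op A (scal x)" "local_op A 1"
  "local_op A S \<Longrightarrow> local_op A T \<Longrightarrow> local_op A (S * T)"
  "local_op A S \<Longrightarrow> local_op A T \<Longrightarrow> local_op A (S + T)"
  "local_op A S \<Longrightarrow> local_op A T \<Longrightarrow> local_op A (S - T)"
  "local_op A S \<Longrightarrow> local_op A (- S)"
  "local_op A S \<Longrightarrow> local_op A (S ^ k)"
  "(\<And>j. j \<in> B \<Longrightarrow> local_op A (F j)) \<Longrightarrow> local_op A (\<Prod>j\<in>B. F j)"
  "(\<And>j. j \<in> B \<Longrightarrow> local_op A (F j)) \<Longrightarrow> local_op A (\<Sum>j\<in>B. F j)"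
  unfolding local_op_def
  by (auto intro!: intertwines_intros intertwines_sum intertwines_shf intertwines_shb simp: fun_eq_iff)

lemma local_op_low_op: "i \<in> A \<Longrightarrow> local_op A (low_op Q i)" "i \<in> A \<Longrightarrow> local_op A (up_op Q i)"
  by (auto simp: low_op_def up_op_def intro!: local_op_intros)

lemma local_op_qd_op: "i \<in> A \<Longrightarrow> local_op A (qd_op Q K i)"
  unfolding qd_op_def by (intro local_op_intros)

lemma local_op_bop: "local_op {1..m} (bop Q m)"
proof -
  have "local_op {1..m} (bfac Q s t)" if "(s, t) \<in> pairs m" for s t
    unfolding bfac_def using that by (intro local_op_intros) (auto simp: pairs_def)
  then show ?thesis
    unfolding bop_def by (auto intro!: local_op_intros)
qed

lemma local_op_override:
  fixes T :: "'a::comm_ring_1 shift_op"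
  assumes "local_op A T" "A \<inter> B = {}"
  shows "intertwines (\<lambda>c i. if i \<in> B then k i else c i) T T"
  unfolding intertwines_def
proof (intro allI)
  fix f :: "'a polyfun" and c
  let ?s = "\<lambda>c i. if i \<in> B then k i else c i"
  \<comment> \<open>Locality is used twice, with the overridden point and with c as the constants
    outside A; by \<open>2\<close> the operator then acts on the same function.\<close>
  have 1: "(\<lambda>i. if i \<in> A then c i else ?s c i) = ?s c" "(\<lambda>i. if i \<in> A then c i else c i) = c"
    using assms(2) by (auto simp: fun_eq_iff)
  have 2: "(\<lambda>c'. f (\<lambda>i. if i \<in> A then c' i else ?s c i)) =
      (\<lambda>c'. f (?s (\<lambda>i. if i \<in> A then c' i else c i)))"
    using assms(2) by (intro ext arg_cong[where f = f]) (auto simp: fun_eq_iff)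
  show "act T f (?s c) = act T (\<lambda>c. f (?s c)) c"
    using intertwinesD[OF local_opD[OF assms(1), of "?s c"], of f c]
      intertwinesD[OF local_opD[OF assms(1), of c], of "\<lambda>c. f (?s c)" c]
    unfolding 1 2 by (rule trans[OF _ sym])
qed

lemma local_op_update:
  assumes "local_op A T" "r \<notin> A"
  shows "intertwines (\<lambda>c. c(r := y)) T T"
proof -
  have "(\<lambda>c i. if i \<in> {r} then y else c i) = (\<lambda>c. c(r := y))"
    by (auto simp: fun_eq_iff)
  with local_op_override[OF assms(1), of "{r}" "\<lambda>_. y"] assms(2) show ?thesis by simp
qed

lemma act_bdet_cong:
  assumes "local_op {1..m} T" "\<And>i. 1 \<le> i \<Longrightarrow> i \<le> m \<Longrightarrow> c i = c' i"
  shows "act T (bdet h e m) c = act T (bdet h e m) c'"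
proof -
  let ?\<sigma> = "\<lambda>c i. if i \<in> {1..m} then c i else 0 :: int"
  have eq: "(\<lambda>c. bdet h e m (?\<sigma> c)) = bdet h e m"
    unfolding bdet_def by (intro ext altdet_cong) auto
  have "act T (bdet h e m) (?\<sigma> c) = act T (bdet h e m) c" for c
    using intertwinesD[OF local_opD[OF assms(1), of "\<lambda>_. 0"], of "bdet h e m" c] unfolding eq .
  moreover have "?\<sigma> c = ?\<sigma> c'" using assms(2) by auto
  ultimately show ?thesis by metis
qed

lemma collision_identity:
  fixes Q :: "'a::field_char_0" and h :: int and e m :: nat
  assumes "1 \<le> i" "Suc i \<le> m"
    and "intertwines (\<lambda>c j. c (Transposition.transpose i (Suc i) j)) R R"
  defines "B \<equiv> act (R * bop Q m) (bdet h e m)"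
  shows "B (c(i := y, Suc i := y)) + B (c(i := y + 1, Suc i := y + 1)) =
      (2 - Q) * B (c(i := y, Suc i := y + 1))"
proof -
  have "act (collision Q i) B (c(i := y, Suc i := y)) = 0"
    unfolding B_def act_mult[symmetric] by (rule act_collision_zero[OF assms(1-3)]) simp
  then show ?thesis
    by (simp add: collision_def act_diff act_add act_mult act_shf act_scal fun_upd_twist)
qed

lemma intertwines_transpose_prod_fix:
  assumes "p < s"
  shows "intertwines (\<lambda>c j. c (Transposition.transpose s (Suc s) j)) (\<Prod>i\<in>{1..p}. shf i - 1) (\<Prod>i\<in>{1..p}. shf i - 1)"
proof (intro intertwines_prod intertwines_diff intertwines_one)
  fix i assume "i \<in> {1..p}"
  then have "Transposition.transpose s (Suc s) i = i" using assms by simp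
  then show "intertwines (\<lambda>c j. c (Transposition.transpose s (Suc s) j)) (shf i) (shf i)"
    by (metis intertwines_transpose(1))
qed

lemma intertwines_transpose_prod_low_op:
  assumes "1 \<le> s" "Suc s \<le> m"
  shows "intertwines (\<lambda>c j. c (Transposition.transpose s (Suc s) j)) (\<Prod>i\<in>{1..m}. low_op Q i) (\<Prod>i\<in>{1..m}. low_op Q i)"
proof (rule intertwines_prod_bij[where \<pi> = "Transposition.transpose s (Suc s)"])
  show "bij_betw (Transposition.transpose s (Suc s)) {1..m} {1..m}"
    by (rule bij_betw_byWitness[where f' = "Transposition.transpose s (Suc s)"])
      (use assms in \<open>auto simp: Transposition.transpose_def\<close>)
qed (auto simp: low_op_def intro!: intertwines_intros intertwines_transpose)

section \<open>Summation over one row with frozen entries\<close>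

lemma prod_split_ivl:
  assumes "p \<le> (m::nat)"
  shows "(\<Prod>i\<in>{1..m}. f i) = (\<Prod>i\<in>{1..p}. f i) * (\<Prod>i\<in>{p<..m}. f i :: 'b::comm_monoid_mult)"
proof -
  have "{1..m} = {1..p} \<union> {p<..m}" using assms by auto
  then show ?thesis by (simp only:) (rule prod.union_disjoint, auto)
qed

lemma prod_uminus_qd_op: "(\<Prod>i\<in>{1..p}. - qd_op Q K i) = scal ((-1) ^ p) * (\<Prod>i\<in>{1..p}. qd_op Q K i)"
proof -
  have "scal (-1) = (-1 :: 'a shift_op)" using scal_diff[of 0 "1::'a"] by simp
  then show ?thesis by (simp add: prod_uminus flip: scal_power)
qed

text \<open>The p frozen variables are not summed, so \<open>B\<close> keeps their differences.
  Where a summed variable receives \<open>low_op\<close>, a frozen one has \<Delta>, and \<Delta> =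
  \<Delta>^Q \<open>low_op\<close> completes the product. The upper terms have their last variable
  at h and vanish by reflection.\<close>

lemma row_sum_odd:
  assumes Q: "Q \<noteq> 0" and K: "2 * m + 1 \<le> K" and p: "p \<le> m"
    and mono: "\<And>i. p < i \<Longrightarrow> i < m \<Longrightarrow> k i < k (Suc i)" and km: "p < m \<Longrightarrow> k m < h"
  shows "il_sum Q p k (m - p) (h - 1) (level_even Q h m) c =
    act (\<Prod>i\<in>{1..p}. - qd_op Q K i) (level_odd Q h m) (\<lambda>i. if p < i \<and> i \<le> m then k i else c i)"
proof -
  define B where "B = act ((\<Prod>i\<in>{1..p}. shf i - 1) * bop Q m) (bdet h 1 m)"
  let ?pt = "\<lambda>i. if p < i \<and> i \<le> m then k i else c i"
  have pd: "p + (m - p) = m" using p by simp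
  have f: "level_even Q h m = act (\<Prod>i\<in>{p<..p + (m - p)}. shf i - 1) B"
  proof -
    have "(\<Prod>i\<in>{p<..m}. shf i - 1) * ((\<Prod>i\<in>{1..p}. shf i - 1) * bop Q m) = bop Q m * (\<Prod>i\<in>{1..m}. shf i - 1)"
      unfolding prod_split_ivl[OF p] by (simp only: mult_ac)
    then show ?thesis
      unfolding B_def pd level_even_def act_mult[symmetric]
      by (simp only: act_mult) (simp only: One_nat_def act_difference_bdet[unfolded One_nat_def])
  qed
  have coll: "B (c(i := y, Suc i := y)) + B (c(i := y + 1, Suc i := y + 1)) =
      (2 - Q) * B (c(i := y, Suc i := y + 1))" if "p < i" "i < p + (m - p)" for i c y
    unfolding B_def
    by (rule collision_identity[OF _ _ intertwines_transpose_prod_fix]) (use that in simp_all)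
  have "il_sum Q p k (m - p) (h - 1) (level_even Q h m) c =
      upper_part Q p k (m - p) (\<lambda>c. B (c(p + (m - p) := h - 1 + 1))) c + lower_part Q p k (m - p) B c"
    unfolding f by (subst il_sum_antidifference[OF _ _ coll]) (use mono km pd in auto)
  also have "upper_part Q p k (m - p) (\<lambda>c. B (c(p + (m - p) := h - 1 + 1))) c = 0"
  proof (cases "p < m")
    case True
    then have "(\<lambda>c. B (c(p + (m - p) := h - 1 + 1))) = (\<lambda>c. 0)"
      unfolding B_def pd by (intro ext act_reflect_zero) (use True in simp_all)
    then show ?thesis by (simp only: upper_part_closed act_fun_zero) simp
  qed simp
  also have "lower_part Q p k (m - p) B c = (-1) ^ (m - p) *
      act (bop Q m * (\<Prod>i\<in>{p<..m}. low_op Q i)) (act (\<Prod>i\<in>{1..p}. shf i - 1) (bdet h 1 m)) ?pt"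
    unfolding lower_part_closed pd B_def act_mult[symmetric] by (simp only: mult_ac)
  also have "act (\<Prod>i\<in>{1..p}. shf i - 1) (bdet h 1 m) = act (\<Prod>i\<in>{1..p}. qd_op Q K i * low_op Q i) (bdet h 1 m)"
    by (rule act_prod_qd_op_low_op[OF Q, symmetric]) (use K in \<open>auto intro: nilp_bdet\<close>)
  also have "act (bop Q m * (\<Prod>i\<in>{p<..m}. low_op Q i)) \<dots> =
      act (\<Prod>i\<in>{1..p}. qd_op Q K i) (act ((\<Prod>i\<in>{1..m}. low_op Q i) * bop Q m) (bdet h 1 m))"
    unfolding act_mult[symmetric] prod_split_ivl[OF p] prod.distrib by (simp only: mult_ac)
  finally have L: "il_sum Q p k (m - p) (h - 1) (level_even Q h m) c = (-1) ^ (m - p) *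
      act (\<Prod>i\<in>{1..p}. qd_op Q K i) (act ((\<Prod>i\<in>{1..m}. low_op Q i) * bop Q m) (bdet h 1 m)) ?pt" by simp
  \<comment> \<open>The sign lacking for each frozen variable becomes the minus sign of
    -\<Delta>^Q.\<close>
  have "(-1 :: 'a) ^ (m - p) = (-1) ^ p * (-1) ^ m"
    using p by (auto simp: minus_one_power_iff)
  then show ?thesis
    unfolding L prod_uminus_qd_op act_mult[of "scal _"] act_scal level_odd_def act_fun_scale by simp
qed

text \<open>Removes the Laplace terms in which the deleted index is that of a frozen variable: a
  frozen entry cannot be the one left out.\<close>

lemma act_qd_op_skip_zero: "act (qd_op Q K q) (\<lambda>c. f (skip q c)) = (\<lambda>_. 0)"
proof -
  have "skip q (c(q := y)) = skip q c" for c y by (auto simp: skip_def)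
  then have "act (shf q - 1) (\<lambda>c. f (skip q c)) = (\<lambda>_. 0)"
    by (simp add: act_diff act_shf)
  then show ?thesis unfolding qd_op_def act_mult by simp
qed

lemma act_prod_qd_op_skip_zero:
  assumes "q \<in> A" "finite A"
  shows "act (\<Prod>i\<in>A. qd_op Q K i) (\<lambda>c. f (skip q c)) = (\<lambda>_. 0)"
  using assms by (simp add: prod.remove[of A q] mult.commute[of "qd_op Q K q"] act_mult act_qd_op_skip_zero)

text \<open>Terms with q \<le> p are killed. In the others \<open>low_op Q i\<close> occurs twice
  for i \<le> p, and one copy is turned into \<Delta>_i.\<close>

lemma act_prod_qd_op_level_even:
  assumes Q: "Q \<noteq> 0" and K: "2 * m + 2 \<le> K" and p: "p \<le> Suc m"
  shows "act (\<Prod>i\<in>{1..p}. - qd_op Q K i) (level_even Q h (Suc m)) c =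
    (\<Sum>q\<in>{p<..Suc m}. (-1) ^ p * ((-1) ^ (q - 1) * (-1) ^ m *
       act ((\<Prod>i\<in>{1..p}. shf i - 1) * (\<Prod>i\<in>{1..m}. low_op Q i) * bop Q m *
         ((\<Prod>i\<in>{p<..<q}. low_op Q i) * (\<Prod>i\<in>{q..m}. up_op Q i))) (bdet h 2 m) (skip q c)))"
proof -
  define Z where "Z q = bop Q m * (\<Prod>i\<in>{1..m}. low_op Q i) *
    ((\<Prod>i\<in>{1..<q}. low_op Q i) * (\<Prod>i\<in>{q..m}. up_op Q i))" for q
  let ?D = "\<Prod>i\<in>{1..p}. qd_op Q K i"
  have "act ?D (level_even Q h (Suc m)) c =
      (\<Sum>q\<in>{1..Suc m}. (-1) ^ (q - 1) * (-1) ^ m * act ?D (\<lambda>c. act (Z q) (bdet h 2 m) (skip q c)) c)"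
    unfolding level_even_Suc[abs_def] Z_def[symmetric] act_fun_sum act_fun_scale ..
  also have "\<dots> = (\<Sum>q\<in>{p<..Suc m}. (-1) ^ (q - 1) * (-1) ^ m *
      act ?D (\<lambda>c. act (Z q) (bdet h 2 m) (skip q c)) c)"
    by (rule sum.mono_neutral_right) (use p in \<open>auto simp: act_prod_qd_op_skip_zero\<close>)
  also have "\<dots> = (\<Sum>q\<in>{p<..Suc m}. (-1) ^ (q - 1) * (-1) ^ m *
       act ((\<Prod>i\<in>{1..p}. shf i - 1) * (\<Prod>i\<in>{1..m}. low_op Q i) * bop Q m *
         ((\<Prod>i\<in>{p<..<q}. low_op Q i) * (\<Prod>i\<in>{q..m}. up_op Q i))) (bdet h 2 m) (skip q c))"
  proof (intro sum.cong refl arg_cong2[where f = "(*)"])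
    fix q assume q: "q \<in> {p<..Suc m}"
    have i: "intertwines (skip q) ?D ?D"
      unfolding qd_op_def using q by (intro intertwines_intros intertwines_sum intertwines_skip) auto
    have w: "(\<Prod>i\<in>{1..<q}. low_op Q i) = (\<Prod>i\<in>{1..p}. low_op Q i) * (\<Prod>i\<in>{p<..<q}. low_op Q i)"
    proof -
      have "{1..<q} = {1..p} \<union> {p<..<q}" using q by auto
      then show ?thesis by (simp only:) (rule prod.union_disjoint, auto)
    qed
    let ?X = "bop Q m * (\<Prod>i\<in>{1..m}. low_op Q i) * ((\<Prod>i\<in>{p<..<q}. low_op Q i) * (\<Prod>i\<in>{q..m}. up_op Q i))"
    have "act ?D (\<lambda>c. act (Z q) (bdet h 2 m) (skip q c)) c = act (?D * Z q) (bdet h 2 m) (skip q c)"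
      by (simp only: act_mult intertwinesD[OF i])
    also have "?D * Z q = ?X * (\<Prod>i\<in>{1..p}. qd_op Q K i * low_op Q i)"
      unfolding Z_def w prod.distrib by (simp only: mult_ac)
    also have "act \<dots> (bdet h 2 m) = act (?X * (\<Prod>i\<in>{1..p}. shf i - 1)) (bdet h 2 m)"
      unfolding act_mult[of ?X] by (subst act_prod_qd_op_low_op[OF Q]) (use K in \<open>auto intro: nilp_bdet\<close>)
    also have "?X * (\<Prod>i\<in>{1..p}. shf i - 1) = (\<Prod>i\<in>{1..p}. shf i - 1) * (\<Prod>i\<in>{1..m}. low_op Q i) * bop Q m *
         ((\<Prod>i\<in>{p<..<q}. low_op Q i) * (\<Prod>i\<in>{q..m}. up_op Q i))"
      by (simp only: mult_ac)
    finally show "act ?D (\<lambda>c. act (Z q) (bdet h 2 m) (skip q c)) c =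
      act ((\<Prod>i\<in>{1..p}. shf i - 1) * (\<Prod>i\<in>{1..m}. low_op Q i) * bop Q m *
         ((\<Prod>i\<in>{p<..<q}. low_op Q i) * (\<Prod>i\<in>{q..m}. up_op Q i))) (bdet h 2 m) (skip q c)" .
  qed
  finally show ?thesis
    unfolding prod_uminus_qd_op act_mult[of "scal _"] act_scal by (simp only: sum_distrib_left)
qed

text \<open>The row \<open>k\<close> has one entry more than the summed row. The coefficients 1 and
  Q - 1 give the last \<open>k\<close> weight Q if it is missed, and they combine the telescoped
  sums to \<open>upper_part\<close> for one more index, so no separate lower term is left
  over.\<close>

lemma row_sum_even:
  assumes Q: "Q \<noteq> 0" and K: "2 * m + 2 \<le> K" and p: "p \<le> m"
    and mono: "\<And>i. p < i \<Longrightarrow> i \<le> m \<Longrightarrow> k i < k (Suc i)"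
  shows "il_sum Q p k (m - p) (k (Suc m)) (level_odd Q h m) c +
      (Q - 1) * il_sum Q p k (m - p) (k (Suc m) - 1) (level_odd Q h m) c =
    Q * act (\<Prod>i\<in>{1..p}. - qd_op Q K i) (level_even Q h (Suc m)) (\<lambda>i. if p < i \<and> i \<le> Suc m then k i else c i)"
proof -
  define R where "R = (\<Prod>i\<in>{1..p}. shf i - 1) * (\<Prod>i\<in>{1..m}. low_op Q i)"
  define B where "B = act (R * bop Q m) (bdet h 2 m)"
  let ?d = "m - p"
  let ?pt = "\<lambda>i. if p < i \<and> i \<le> Suc m then k i else c i"
  have pd: "p + ?d = m" using p by simp
  have f: "level_odd Q h m = (\<lambda>c. (-1) ^ m * act (\<Prod>i\<in>{p<..p + ?d}. shf i - 1) B c + 0 * B c)"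
  proof -
    have eq: "(\<Prod>i\<in>{p<..m}. shf i - 1) * (R * bop Q m) =
        ((\<Prod>i\<in>{1..m}. low_op Q i) * bop Q m) * (\<Prod>i\<in>{1..m}. shf i - 1)"
      unfolding prod_split_ivl[OF p, of "\<lambda>i. shf i - 1"] R_def by (simp only: mult_ac)
    have "act (\<Prod>i\<in>{p<..p + ?d}. shf i - 1) B = act ((\<Prod>i\<in>{1..m}. low_op Q i) * bop Q m) (bdet h 1 m)"
      unfolding B_def pd act_mult[symmetric] eq
      by (simp only: act_mult numeral_2_eq_2 One_nat_def act_difference_bdet[unfolded One_nat_def])
    then show ?thesis unfolding level_odd_def by simp
  qed
  have coll: "B (c(i := y, Suc i := y)) + B (c(i := y + 1, Suc i := y + 1)) =
      (2 - Q) * B (c(i := y, Suc i := y + 1))" if "p < i" "i < p + ?d" for i c y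
    unfolding B_def R_def
    by (rule collision_identity[OF _ _ intertwines_mult[OF intertwines_transpose_prod_fix
        intertwines_transpose_prod_low_op]]) (use that in simp_all)
  have s: "il_sum Q p k ?d u (level_odd Q h m) c =
      (-1) ^ m * (upper_part Q p k ?d (\<lambda>c. B (c(p + ?d := u + 1))) c + lower_part Q p k ?d B c)"
    if "p < m \<longrightarrow> k m \<le> u" for u
    unfolding f il_sum_lincomb by (subst il_sum_antidifference[OF _ _ coll]) (use mono that pd in auto)
  have km: "p < m \<longrightarrow> k m \<le> k (Suc m)" "p < m \<longrightarrow> k m \<le> k (Suc m) - 1"
    using mono[of m] by auto
  have "il_sum Q p k ?d (k (Suc m)) (level_odd Q h m) c + (Q - 1) * il_sum Q p k ?d (k (Suc m) - 1) (level_odd Q h m) c =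
      (-1) ^ m * upper_part Q p k (Suc ?d) B c"
    unfolding s[OF km(1)] s[OF km(2)] upper_part.simps Let_def upper_part_diff_scale pd
    by (simp add: algebra_simps)
  \<comment> \<open>Only variables 1, ..., m matter, so the point may be written as the whole row
    with one entry skipped.\<close>
  also have "upper_part Q p k (Suc ?d) B c = Q * (\<Sum>q\<in>{1..Suc ?d}. (-1) ^ (q - 1) *
        act (((\<Prod>i\<in>{p<..<p + q}. low_op Q i) * (\<Prod>i\<in>{p + q..<p + Suc ?d}. up_op Q i)) * (R * bop Q m))
          (bdet h 2 m) (skip (p + q) ?pt))"
    unfolding upper_part_closed B_def act_mult[symmetric]
  proof (intro arg_cong2[where f = "(*)"] sum.cong refl act_bdet_cong)
    fix q assume q: "q \<in> {1..Suc ?d}"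
    show "local_op {1..m} (((\<Prod>i\<in>{p<..<p + q}. low_op Q i) *
        (\<Prod>i\<in>{p + q..<p + Suc ?d}. up_op Q i)) * (R * bop Q m))"
      unfolding R_def using q p by (intro local_op_intros local_op_low_op local_op_bop) auto
    show "(if p < i \<and> i < p + q then k i else if p + q \<le> i \<and> i < p + Suc ?d then k (Suc i) else c i) =
        skip (p + q) ?pt i" if "1 \<le> i" "i \<le> m" for i
      using that q p by (auto simp: skip_def)
  qed
  also have "\<dots> = Q * (\<Sum>q\<in>{p<..Suc m}. (-1) ^ (q - p - 1) *
        act (((\<Prod>i\<in>{p<..<q}. low_op Q i) * (\<Prod>i\<in>{q..m}. up_op Q i)) * (R * bop Q m))
          (bdet h 2 m) (skip q ?pt))"
    by (rule arg_cong[where f = "\<lambda>x. Q * x"],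
        rule sum.reindex_bij_witness[where i = "\<lambda>q. q - p" and j = "\<lambda>q. p + q"])
      (use p in \<open>auto simp: atLeastLessThanSuc_atLeastAtMost\<close>)
  also have "(-1) ^ m * (Q * (\<Sum>q\<in>{p<..Suc m}. (-1) ^ (q - p - 1) *
        act (((\<Prod>i\<in>{p<..<q}. low_op Q i) * (\<Prod>i\<in>{q..m}. up_op Q i)) * (R * bop Q m))
          (bdet h 2 m) (skip q ?pt))) =
      Q * (\<Sum>q\<in>{p<..Suc m}. (-1) ^ p * ((-1) ^ (q - 1) * (-1) ^ m *
       act ((\<Prod>i\<in>{1..p}. shf i - 1) * (\<Prod>i\<in>{1..m}. low_op Q i) * bop Q m *
         ((\<Prod>i\<in>{p<..<q}. low_op Q i) * (\<Prod>i\<in>{q..m}. up_op Q i))) (bdet h 2 m) (skip q ?pt)))"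
    unfolding sum_distrib_left
  proof (intro sum.cong refl)
    fix q assume q: "q \<in> {p<..Suc m}"
    have sg: "(-1 :: 'a) ^ (q - p - 1) = (-1) ^ p * (-1) ^ (q - 1)"
      using q by (auto simp: minus_one_power_iff)
    have "((\<Prod>i\<in>{p<..<q}. low_op Q i) * (\<Prod>i\<in>{q..m}. up_op Q i)) * (R * bop Q m) =
        (\<Prod>i\<in>{1..p}. shf i - 1) * (\<Prod>i\<in>{1..m}. low_op Q i) * bop Q m *
         ((\<Prod>i\<in>{p<..<q}. low_op Q i) * (\<Prod>i\<in>{q..m}. up_op Q i))"
      unfolding R_def by (simp only: mult_ac)
    then show "(-1) ^ m * (Q * ((-1) ^ (q - p - 1) *
        act (((\<Prod>i\<in>{p<..<q}. low_op Q i) * (\<Prod>i\<in>{q..m}. up_op Q i)) * (R * bop Q m))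
          (bdet h 2 m) (skip q ?pt))) =
       Q * ((-1) ^ p * ((-1) ^ (q - 1) * (-1) ^ m *
       act ((\<Prod>i\<in>{1..p}. shf i - 1) * (\<Prod>i\<in>{1..m}. low_op Q i) * bop Q m *
         ((\<Prod>i\<in>{p<..<q}. low_op Q i) * (\<Prod>i\<in>{q..m}. up_op Q i))) (bdet h 2 m) (skip q ?pt)))"
      unfolding sg by (simp only: mult_ac)
  qed
  also have "\<dots> = Q * act (\<Prod>i\<in>{1..p}. - qd_op Q K i) (level_even Q h (Suc m)) ?pt"
    by (subst act_prod_qd_op_level_even[OF Q K]) (use p in auto)
  finally show ?thesis .
qed

text \<open>With all m + 1 entries frozen, every deleted index is a frozen one. This is the
  counterpart of \<open>il_sets_empty\<close>.\<close>

lemma act_prod_all_qd_op_level_even: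
  assumes "Q \<noteq> 0" "2 * m + 2 \<le> K"
  shows "act (\<Prod>i\<in>{1..Suc m}. - qd_op Q K i) (level_even Q h (Suc m)) = (\<lambda>_. 0)"
  by (rule ext, subst act_prod_qd_op_level_even[OF assms]) auto

subsection \<open>Interlacing vectors and interlacing sets\<close>

text \<open>Positions up to p are frozen and are supplied by \<open>ovr\<close>. The bound u is
  separate because the last entry has no \<open>k (Suc i)\<close> above it within the range.\<close>

definition il_vecs :: "nat \<Rightarrow> (nat \<Rightarrow> int) \<Rightarrow> nat \<Rightarrow> int \<Rightarrow> (nat \<Rightarrow> int) set" where
  "il_vecs p k d u = {l \<in> {p<..p + d} \<rightarrow>\<^sub>E UNIV.
     (\<forall>i\<in>{p<..p + d}. k i \<le> l i) \<and>
     (\<forall>i\<in>{p<..<p + d}. l i \<le> k (Suc i) \<and> l i < l (Suc i)) \<and> (0 < d \<longrightarrow> l (p + d) \<le> u)}"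

definition ovr :: "nat \<Rightarrow> nat \<Rightarrow> (nat \<Rightarrow> int) \<Rightarrow> (nat \<Rightarrow> int) \<Rightarrow> nat \<Rightarrow> int" where
  "ovr p d l c = (\<lambda>i. if p < i \<and> i \<le> p + d then l i else c i)"

definition missed :: "nat \<Rightarrow> nat \<Rightarrow> (nat \<Rightarrow> int) \<Rightarrow> int set \<Rightarrow> nat" where
  "missed p d k S = card {i \<in> {p<..p + d}. k i \<notin> S}"

lemma ilaceI:
  assumes "l \<in> {p<..p + d} \<rightarrow>\<^sub>E UNIV" "\<And>i. p < i \<Longrightarrow> i \<le> p + d \<Longrightarrow> k i \<le> l i"
    "\<And>i. p < i \<Longrightarrow> i < p + d \<Longrightarrow> l i \<le> k (Suc i)" "\<And>i. p < i \<Longrightarrow> i < p + d \<Longrightarrow> l i < l (Suc i)"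
    "0 < d \<Longrightarrow> l (p + d) \<le> u"
  shows "l \<in> il_vecs p k d u"
  using assms by (simp add: il_vecs_def)

lemma ilaceD:
  assumes "l \<in> il_vecs p k d u"
  shows "l \<in> {p<..p + d} \<rightarrow>\<^sub>E UNIV" "p < i \<Longrightarrow> i \<le> p + d \<Longrightarrow> k i \<le> l i"
    "p < i \<Longrightarrow> i < p + d \<Longrightarrow> l i \<le> k (Suc i)" "p < i \<Longrightarrow> i < p + d \<Longrightarrow> l i < l (Suc i)"
    "0 < d \<Longrightarrow> l (p + d) \<le> u"
  using assms by (simp_all add: il_vecs_def)

lemma finite_il_vecs: "finite (il_vecs p k d u)"
proof (rule finite_subset)
  show "il_vecs p k d u \<subseteq> PiE {p<..p + d} (\<lambda>i. {k i..max u (k (Suc i))})"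
  proof
    fix l assume l: "l \<in> il_vecs p k d u"
    have "l i \<in> {k i..max u (k (Suc i))}" if "i \<in> {p<..p + d}" for i
    proof (cases "i = p + d")
      case True
      then show ?thesis using l that by (auto simp: il_vecs_def)
    next
      case False
      then have "i \<in> {p<..<p + d}" using that by auto
      then have "k i \<le> l i" "l i \<le> k (Suc i)" using l that by (simp_all add: il_vecs_def)
      then show ?thesis by simp
    qed
    then show "l \<in> PiE {p<..p + d} (\<lambda>i. {k i..max u (k (Suc i))})"
      using l by (auto simp: il_vecs_def PiE_def)
  qed
qed (intro finite_PiE, auto)

lemma il_vecs_mono_less:
  assumes mono: "\<And>i. i \<in> {p<..<b} \<Longrightarrow> k i < (k (Suc i) :: int)" and "i \<in> {p<..b}" "j \<in> {p<..b}" "i < j"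
  shows "k i < k j"
proof -
  have "p < i \<Longrightarrow> i < j \<Longrightarrow> j \<le> b \<Longrightarrow> k i < k j" for j
  proof (induction j)
    case (Suc j)
    have "k j < k (Suc j)" by (rule mono) (use Suc.prems in simp)
    then show ?case using Suc.IH Suc.prems by (cases "i = j") simp_all
  qed simp
  then show ?thesis using assms(2-4) by simp
qed

lemma il_vecs_image_bound:
  assumes "l \<in> il_vecs p k d u" "i \<in> {p<..p + d}"
  shows "l i \<le> l (p + d)"
proof (cases "i = p + d")
  case False
  have "l i < l (p + d)"
    by (rule il_vecs_mono_less[of p "p + d" l]) (use False assms(2) ilaceD(4)[OF assms(1)] in simp_all)
  then show ?thesis by simp
qed simp

lemma il_vecs_subset: "u \<le> v \<Longrightarrow> il_vecs p k d u \<subseteq> il_vecs p k d v"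
  by (auto simp: il_vecs_def)

lemma il_vecs_pred_iff:
  assumes "l \<in> il_vecs p k d v"
  shows "l \<in> il_vecs p k d (v - 1) \<longleftrightarrow> v \<notin> l ` {p<..p + d}"
proof
  assume l: "l \<in> il_vecs p k d (v - 1)"
  show "v \<notin> l ` {p<..p + d}"
  proof
    assume "v \<in> l ` {p<..p + d}"
    then obtain i where i: "i \<in> {p<..p + d}" "v = l i" by auto
    then have "d > 0" by auto
    then show False using il_vecs_image_bound[OF assms i(1)] l i by (auto simp: il_vecs_def)
  qed
next
  assume "v \<notin> l ` {p<..p + d}"
  then have "0 < d \<Longrightarrow> l (p + d) \<noteq> v" by auto
  then show "l \<in> il_vecs p k d (v - 1)" using assms by (auto simp: il_vecs_def)
qed

text \<open>Vectors that miss v are those bounded by v - 1. They are counted in both sums, with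
  total coefficient 1 + (Q - 1) = Q.\<close>

lemma il_sum_pair_eq:
  assumes 1: "il_sum Q p k d v f c = (\<Sum>l\<in>il_vecs p k d v. Q ^ missed p d k (l ` {p<..p + d}) * f (ovr p d l c))"
    and 2: "il_sum Q p k d (v - 1) f c = (\<Sum>l\<in>il_vecs p k d (v - 1). Q ^ missed p d k (l ` {p<..p + d}) * f (ovr p d l c))"
  shows "il_sum Q p k d v f c + (Q - 1) * il_sum Q p k d (v - 1) f c =
    (\<Sum>l\<in>il_vecs p k d v. Q ^ (missed p d k (l ` {p<..p + d}) + of_bool (v \<notin> l ` {p<..p + d})) * f (ovr p d l c))"
proof -
  let ?t = "\<lambda>l. Q ^ missed p d k (l ` {p<..p + d}) * f (ovr p d l c)"
  have e: "(\<Sum>l\<in>il_vecs p k d (v - 1). ?t l) =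
      (\<Sum>l\<in>il_vecs p k d v. if l \<in> il_vecs p k d (v - 1) then ?t l else 0)"
    using il_vecs_subset[of "v - 1" v p k d] finite_il_vecs[of p k d v]
    by (simp add: sum.If_cases Int_absorb1)
  have "il_sum Q p k d v f c + (Q - 1) * il_sum Q p k d (v - 1) f c =
      (\<Sum>l\<in>il_vecs p k d v. ?t l + (Q - 1) * (if l \<in> il_vecs p k d (v - 1) then ?t l else 0))"
    unfolding 1 2 e sum.distrib sum_distrib_left[symmetric] ..
  also have "\<dots> = (\<Sum>l\<in>il_vecs p k d v.
      Q ^ (missed p d k (l ` {p<..p + d}) + of_bool (v \<notin> l ` {p<..p + d})) * f (ovr p d l c))"
    by (intro sum.cong refl) (simp add: il_vecs_pred_iff algebra_simps)
  finally show ?thesis .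
qed

text \<open>Splits off the last entry y. If y = \<open>k r\<close>, strictness pushes the previous
  entry below \<open>k r\<close>; if y > \<open>k r\<close>, the previous entry may equal
  \<open>k r\<close>.\<close>

lemma il_vecs_Suc:
  fixes p d :: nat
  defines "r \<equiv> Suc (p + d)"
  assumes u: "k r \<le> u"
  shows "bij_betw (\<lambda>(y, l). l(r := y))
    ({k r} \<times> il_vecs p k d (k r - 1) \<union> {k r<..u} \<times> il_vecs p k d (k r)) (il_vecs p k (Suc d) u)"
proof (rule bij_betw_byWitness[where f' = "\<lambda>l. (l r, l(r := undefined))"])
  have r: "r \<notin> {p<..p + d}" "{p<..p + Suc d} = insert r {p<..p + d}"
    "{p<..<p + Suc d} = {p<..p + d}" by (auto simp: r_def)
  show "\<forall>z\<in>{k r} \<times> il_vecs p k d (k r - 1) \<union> {k r<..u} \<times> il_vecs p k d (k r).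
      (\<lambda>l. (l r, l(r := undefined))) ((\<lambda>(y, l). l(r := y)) z) = z"
  proof -
    have "l(r := undefined) = l" if "l \<in> il_vecs p k d v" for l v
      by (rule fun_upd_idem) (use that r(1) in \<open>simp add: il_vecs_def PiE_def extensional_def\<close>)
    then show ?thesis by auto
  qed
  show "\<forall>l\<in>il_vecs p k (Suc d) u. (\<lambda>(y, l). l(r := y)) (l r, l(r := undefined)) = l"
    by simp
  show "(\<lambda>(y, l). l(r := y)) ` ({k r} \<times> il_vecs p k d (k r - 1) \<union> {k r<..u} \<times> il_vecs p k d (k r)) \<subseteq>
      il_vecs p k (Suc d) u"
  proof
    fix l' assume "l' \<in> (\<lambda>(y, l). l(r := y)) ` ({k r} \<times> il_vecs p k d (k r - 1) \<union> {k r<..u} \<times> il_vecs p k d (k r))"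
    then obtain y l where l': "l' = l(r := y)" and
      yl: "y = k r \<and> l \<in> il_vecs p k d (k r - 1) \<or> k r < y \<and> y \<le> u \<and> l \<in> il_vecs p k d (k r)"
      by force
    have y: "k r \<le> y" "y \<le> u" using yl u by auto
    have l: "l \<in> il_vecs p k d (k r)" using yl il_vecs_subset[of "k r - 1" "k r" p k d] by auto
    have ly: "l (p + d) < y" if "0 < d"
      using yl ilaceD(5)[OF _ that] by fastforce
    show "l' \<in> il_vecs p k (Suc d) u"
    proof (rule ilaceI)
      show "l' \<in> {p<..p + Suc d} \<rightarrow>\<^sub>E UNIV"
        using ilaceD(1)[OF l] unfolding r(2) l' by (simp add: PiE_def extensional_def)
      show "k i \<le> l' i" if "p < i" "i \<le> p + Suc d" for i
        using ilaceD(2)[OF l, of i] that y by (cases "i = r") (auto simp: l' r_def)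
      show "l' i \<le> k (Suc i)" if "p < i" "i < p + Suc d" for i
        using ilaceD(3)[OF l, of i] ilaceD(5)[OF l] that
        by (cases "i = p + d") (auto simp: l' r_def)
      show "l' i < l' (Suc i)" if "p < i" "i < p + Suc d" for i
        using ilaceD(4)[OF l, of i] ly that
        by (cases "i = p + d") (auto simp: l' r_def)
      show "l' (p + Suc d) \<le> u" using y by (simp add: l' r_def)
    qed
  qed
  show "(\<lambda>l. (l r, l(r := undefined))) ` il_vecs p k (Suc d) u \<subseteq>
      {k r} \<times> il_vecs p k d (k r - 1) \<union> {k r<..u} \<times> il_vecs p k d (k r)"
  proof
    fix z assume "z \<in> (\<lambda>l. (l r, l(r := undefined))) ` il_vecs p k (Suc d) u"
    then obtain l where z: "z = (l r, l(r := undefined))" and l: "l \<in> il_vecs p k (Suc d) u" by auto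
    have lr: "k r \<le> l r" "l r \<le> u" using ilaceD(2)[OF l, of r] ilaceD(5)[OF l] by (auto simp: r_def)
    have base: "l(r := undefined) \<in> il_vecs p k d v" if v: "0 < d \<Longrightarrow> l (p + d) \<le> v" for v
    proof (rule ilaceI)
      show "l(r := undefined) \<in> {p<..p + d} \<rightarrow>\<^sub>E UNIV"
        using ilaceD(1)[OF l] unfolding r(2) by (simp add: PiE_def extensional_def)
      show "k i \<le> (l(r := undefined)) i" if "p < i" "i \<le> p + d" for i
        using ilaceD(2)[OF l, of i] that by (auto simp: r_def)
      show "(l(r := undefined)) i \<le> k (Suc i)" if "p < i" "i < p + d" for i
        using ilaceD(3)[OF l, of i] that by (auto simp: r_def)
      show "(l(r := undefined)) i < (l(r := undefined)) (Suc i)" if "p < i" "i < p + d" for i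
        using ilaceD(4)[OF l, of i] that by (auto simp: r_def)
      show "(l(r := undefined)) (p + d) \<le> v" if "0 < d"
        using v[OF that] by (simp add: r_def)
    qed
    have "l(r := undefined) \<in> il_vecs p k d (k r)"
      by (rule base) (use ilaceD(3)[OF l, of "p + d"] in \<open>simp add: r_def\<close>)
    moreover have "l(r := undefined) \<in> il_vecs p k d (k r - 1)" if "l r = k r"
      by (rule base) (use ilaceD(4)[OF l, of "p + d"] that in \<open>simp add: r_def\<close>)
    ultimately show "z \<in> {k r} \<times> il_vecs p k d (k r - 1) \<union> {k r<..u} \<times> il_vecs p k d (k r)"
      unfolding z using lr by (cases "l r = k r") auto
  qed
qed

lemma sum_il_vecs_Suc:
  fixes p d :: nat
  defines "r \<equiv> Suc (p + d)"
  assumes u: "k r \<le> u"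
  shows "(\<Sum>l\<in>il_vecs p k (Suc d) u. g l) = (\<Sum>l\<in>il_vecs p k d (k r - 1). g (l(r := k r))) +
    (\<Sum>y\<in>{k r<..u}. \<Sum>l\<in>il_vecs p k d (k r). g (l(r := y)))"
proof -
  let ?A = "{k r} \<times> il_vecs p k d (k r - 1)" and ?B = "{k r<..u} \<times> il_vecs p k d (k r)"
  have "(\<Sum>l\<in>il_vecs p k (Suc d) u. g l) = (\<Sum>(y, l)\<in>?A \<union> ?B. g (l(r := y)))"
    using sum.reindex_bij_betw[OF il_vecs_Suc[where k = k and p = p and d = d and u = u,
      OF u[unfolded r_def]], of g] unfolding r_def
    by (simp add: case_prod_unfold)
  also have "\<dots> = (\<Sum>(y, l)\<in>?A. g (l(r := y))) + (\<Sum>(y, l)\<in>?B. g (l(r := y)))"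
    by (rule sum.union_disjoint) (auto simp: finite_il_vecs)
  finally show ?thesis
    by (simp add: sum.cartesian_product[symmetric])
qed

lemma il_sum_eq_sum_il_vecs:
  assumes "\<And>i. p < i \<Longrightarrow> i < p + d \<Longrightarrow> k i < k (Suc i)" and "0 < d \<Longrightarrow> k (p + d) \<le> u"
  shows "il_sum Q p k d u f c =
    (\<Sum>l\<in>il_vecs p k d u. Q ^ missed p d k (l ` {p<..p + d}) * f (ovr p d l c))"
  using assms
proof (induction d arbitrary: u f c)
  case 0
  have "il_vecs p k 0 u = {\<lambda>_. undefined}" by (auto simp: il_vecs_def)
  moreover have "ovr p 0 l c = c" for l by (auto simp: ovr_def fun_eq_iff)
  ultimately show ?case by (simp add: missed_def)
next
  case (Suc d)
  define r where "r = Suc (p + d)"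
  have r: "{p<..p + Suc d} = insert r {p<..p + d}" "r \<notin> {p<..p + d}" by (auto simp: r_def)
  have kr: "k i < k r" if "i \<in> {p<..p + d}" for i
    by (rule il_vecs_mono_less[of p "p + Suc d" k]) (use Suc.prems(1) that in \<open>auto simp: r_def\<close>)
  have ku: "k r \<le> u" using Suc.prems(2) by (simp add: r_def)
  have IH: "il_sum Q p k d v f' c' =
      (\<Sum>l\<in>il_vecs p k d v. Q ^ missed p d k (l ` {p<..p + d}) * f' (ovr p d l c'))"
    if "v \<in> {k r, k r - 1}" for v f' c'
    by (rule Suc.IH) (use Suc.prems(1) kr[of "p + d"] that in auto)
  have IH1: "il_sum Q p k d (k r) f' c' =
      (\<Sum>l\<in>il_vecs p k d (k r). Q ^ missed p d k (l ` {p<..p + d}) * f' (ovr p d l c'))" for f' c'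
    by (rule IH) simp
  have IH2: "il_sum Q p k d (k r - 1) f' c' =
      (\<Sum>l\<in>il_vecs p k d (k r - 1). Q ^ missed p d k (l ` {p<..p + d}) * f' (ovr p d l c'))" for f' c'
    by (rule IH) simp
  have im: "(l(r := y)) ` {p<..p + Suc d} = insert y (l ` {p<..p + d})" for l :: "nat \<Rightarrow> int" and y
    using r(2) unfolding r(1) by (auto simp: image_def)
  have ov: "(ovr p d l c)(r := y) = ovr p (Suc d) (l(r := y)) c" for l y
    by (auto simp: ovr_def r_def fun_eq_iff)
  have m1: "missed p (Suc d) k (insert (k r) S) = missed p d k S" for S
  proof -
    have "{i \<in> {p<..p + Suc d}. k i \<notin> insert (k r) S} = {i \<in> {p<..p + d}. k i \<notin> S}"
    proof -
      have "k i \<noteq> k r" if "i \<in> {p<..p + d}" for i using kr[OF that] by simp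
      then show ?thesis unfolding r(1) by auto
    qed
    then show ?thesis by (simp add: missed_def)
  qed
  \<comment> \<open>For y above \<open>k r\<close> it depends on the remaining entries whether
    \<open>k r\<close> is hit; this is the distinction behind \<open>Q - 1\<close> in
    \<open>il_sum\<close>.\<close>
  have m2: "missed p (Suc d) k (insert y S) = missed p d k S + of_bool (k r \<notin> S)" if "k r < y" for S y
  proof -
    have "{i \<in> {p<..p + Suc d}. k i \<notin> insert y S} =
        {i \<in> {p<..p + d}. k i \<notin> S} \<union> (if k r \<in> S then {} else {r})"
    proof -
      have "k i \<noteq> y" if "i \<in> {p<..p + d}" for i using kr[OF that] \<open>k r < y\<close> by simp
      moreover have "k r \<noteq> y" using that by simp
      ultimately show ?thesis unfolding r(1) by (auto split: if_splits)
    qed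
    then show ?thesis using r(2) by (simp add: missed_def)
  qed
  have "il_sum Q p k (Suc d) u f c = il_sum Q p k d (k r - 1) (\<lambda>c. f (c(r := k r))) c +
     (\<Sum>y\<in>{k r<..u}. il_sum Q p k d (k r) (\<lambda>c. f (c(r := y))) c +
        (Q - 1) * il_sum Q p k d (k r - 1) (\<lambda>c. f (c(r := y))) c)"
    by (simp add: Let_def r_def)
  also have "\<dots> = (\<Sum>l\<in>il_vecs p k d (k r - 1). Q ^ missed p (Suc d) k ((l(r := k r)) ` {p<..p + Suc d}) *
        f (ovr p (Suc d) (l(r := k r)) c)) +
     (\<Sum>y\<in>{k r<..u}. \<Sum>l\<in>il_vecs p k d (k r). Q ^ missed p (Suc d) k ((l(r := y)) ` {p<..p + Suc d}) *
        f (ovr p (Suc d) (l(r := y)) c))"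
  proof (intro arg_cong2[where f = "(+)"] sum.cong refl)
    show "il_sum Q p k d (k r - 1) (\<lambda>c. f (c(r := k r))) c =
        (\<Sum>l\<in>il_vecs p k d (k r - 1). Q ^ missed p (Suc d) k ((l(r := k r)) ` {p<..p + Suc d}) *
          f (ovr p (Suc d) (l(r := k r)) c))"
      unfolding im m1 IH2 ov ..
  next
    fix y assume y: "y \<in> {k r<..u}"
    show "il_sum Q p k d (k r) (\<lambda>c. f (c(r := y))) c +
        (Q - 1) * il_sum Q p k d (k r - 1) (\<lambda>c. f (c(r := y))) c =
       (\<Sum>l\<in>il_vecs p k d (k r). Q ^ missed p (Suc d) k ((l(r := y)) ` {p<..p + Suc d}) *
        f (ovr p (Suc d) (l(r := y)) c))"
      unfolding il_sum_pair_eq[OF IH1 IH2] im ov using y by (intro sum.cong refl) (simp add: m2)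
  qed
  also have "\<dots> = (\<Sum>l\<in>il_vecs p k (Suc d) u. Q ^ missed p (Suc d) k (l ` {p<..p + Suc d}) *
      f (ovr p (Suc d) l c))"
    unfolding r_def by (rule sum_il_vecs_Suc[symmetric]) (use ku in \<open>simp add: r_def\<close>)
  finally show ?case .
qed

section \<open>Interlacing sets of integers\<close>

definition cnt :: "int set \<Rightarrow> int \<Rightarrow> nat" where
  "cnt S x = card {s \<in> S. s \<le> x}"

text \<open>Stated by counting functions because their differences are the prefix sums of a row of
  the array; \<open>interlaces_iff\<close> recovers the inequalities between entries.\<close>

definition interlaces :: "int set \<Rightarrow> int set \<Rightarrow> bool" where
  "interlaces S S' \<longleftrightarrow> (\<forall>x. cnt S' x \<le> cnt S x \<and> cnt S x \<le> cnt S' x + 1)"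

text \<open>Candidates for the row before S. The central column has number h, and columns numbered
  below \<theta> are frozen.\<close>

definition il_sets :: "int set \<Rightarrow> nat \<Rightarrow> int \<Rightarrow> int \<Rightarrow> int set set" where
  "il_sets S m h \<theta> = {S'. finite S' \<and> card S' = m \<and> (\<forall>x\<in>S'. x < h) \<and> interlaces S S' \<and>
     (\<forall>x<\<theta>. x \<in> S \<longleftrightarrow> x \<in> S')}"

lemma strict_mono_on_enumeration:
  assumes "finite (S :: int set)"
  shows "\<exists>e. strict_mono_on {1..card S} e \<and> e ` {1..card S} = S"
proof (intro exI conjI)
  let ?xs = "sorted_list_of_set S"
  let ?e = "\<lambda>i. ?xs ! (i - 1)"
  show "strict_mono_on {1..card S} ?e"
    by (rule strict_mono_onI) (auto intro!: sorted_wrt_nth_less[where P = "(<)"] simp: assms)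
  have "?e ` {1..card S} = (!) ?xs ` {..<length ?xs}"
  proof -
    have "{..<length ?xs} = (\<lambda>i. i - 1) ` {1..card S}"
      using assms by (auto simp: image_iff intro!: bexI[of _ "Suc _"])
    then show ?thesis by (simp add: image_image)
  qed
  also have "\<dots> = S" using assms by (simp add: nth_image lessThan_atLeast0 flip: set_conv_nth)
  finally show "?e ` {1..card S} = S" .
qed

lemma strict_mono_on_Suc:
  assumes "\<And>i. 1 \<le> i \<Longrightarrow> i < m \<Longrightarrow> e i < (e (Suc i) :: int)"
  shows "strict_mono_on {1..m} e"
proof (rule strict_mono_onI)
  fix r s assume "r \<in> {1..m}" "s \<in> {1..m}" "r < s"
  then show "e r < e s"
    by (intro il_vecs_mono_less[of 0 m e r s, rotated]) (use assms in auto)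
qed

text \<open>Counting and increasing enumeration are adjoint; the translation between sets and
  vectors rests on this.\<close>

lemma cnt_ge_iff:
  assumes e: "strict_mono_on {1..m} e" and r: "r \<in> {1..m}"
  shows "r \<le> cnt (e ` {1..m}) x \<longleftrightarrow> e r \<le> x"
proof -
  have inj: "inj_on e {1..m}" using e by (rule strict_mono_on_imp_inj_on)
  have "{s \<in> e ` {1..m}. s \<le> x} = e ` {i \<in> {1..m}. e i \<le> x}" by auto
  then have c: "cnt (e ` {1..m}) x = card {i \<in> {1..m}. e i \<le> x}"
    unfolding cnt_def by (simp only:) (rule card_image[OF inj_on_subset[OF inj]], auto)
  show ?thesis
  proof
    assume "e r \<le> x"
    moreover have "e i \<le> e r" if "i \<in> {1..r}" for i
      using strict_mono_onD[OF e, of i r] that r by (cases "i = r") auto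
    ultimately have "{1..r} \<subseteq> {i \<in> {1..m}. e i \<le> x}" using r by force
    then have "card {1..r} \<le> card {i \<in> {1..m}. e i \<le> x}" by (intro card_mono) auto
    then show "r \<le> cnt (e ` {1..m}) x" unfolding c by simp
  next
    assume ge: "r \<le> cnt (e ` {1..m}) x"
    show "e r \<le> x"
    proof (rule ccontr)
      assume "\<not> e r \<le> x"
      moreover have "e r \<le> e i" if "i \<in> {1..m}" "r \<le> i" for i
        using strict_mono_onD[OF e, of r i] that r by (cases "i = r") auto
      ultimately have "{i \<in> {1..m}. e i \<le> x} \<subseteq> {1..<r}" by force
      then have "card {i \<in> {1..m}. e i \<le> x} \<le> card {1..<r}" by (intro card_mono) auto
      then show False using ge r unfolding c by auto
    qed
  qed
qed

lemma cnt_le: "finite S \<Longrightarrow> cnt S x \<le> card S"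
  unfolding cnt_def by (rule card_mono) auto

lemma strict_mono_on_image_eq:
  fixes e e' :: "nat \<Rightarrow> int"
  assumes "strict_mono_on {1..m} e" "strict_mono_on {1..m} e'" "e ` {1..m} = e' ` {1..m}" "r \<in> {1..m}"
  shows "e r = e' r"
proof -
  have "e r \<le> x \<longleftrightarrow> e' r \<le> x" for x
    using cnt_ge_iff[OF assms(1,4), of x] cnt_ge_iff[OF assms(2,4), of x] assms(3) by simp
  from this[of "e r"] this[of "e' r"] show ?thesis by simp
qed

lemma interlaces_iff:
  assumes k: "strict_mono_on {1..mk} k" and e: "strict_mono_on {1..m} e"
    and m: "m \<le> mk" "mk \<le> Suc m"
  shows "interlaces (k ` {1..mk}) (e ` {1..m}) \<longleftrightarrow>
    (\<forall>r\<in>{1..m}. k r \<le> e r \<and> (r < mk \<longrightarrow> e r \<le> k (Suc r)))"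
    (is "?L \<longleftrightarrow> ?R")
proof
  assume L: ?L
  show ?R
  proof
    fix r assume r: "r \<in> {1..m}"
    have "r \<le> cnt (k ` {1..mk}) (e r)"
      using L cnt_ge_iff[OF e r, of "e r"] by (auto simp: interlaces_def intro: le_trans)
    then have 1: "k r \<le> e r" using cnt_ge_iff[OF k, of r "e r"] r m by auto
    have 2: "e r \<le> k (Suc r)" if "r < mk"
    proof -
      have "Suc r \<le> cnt (k ` {1..mk}) (k (Suc r))"
        using cnt_ge_iff[OF k, of "Suc r" "k (Suc r)"] that by auto
      also have "\<dots> \<le> cnt (e ` {1..m}) (k (Suc r)) + 1" using L by (auto simp: interlaces_def)
      finally show ?thesis using cnt_ge_iff[OF e r, of "k (Suc r)"] by auto
    qed
    show "k r \<le> e r \<and> (r < mk \<longrightarrow> e r \<le> k (Suc r))" using 1 2 by simp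
  qed
next
  assume R: ?R
  have cke: "card (k ` {1..mk}) = mk" "card (e ` {1..m}) = m"
    using k e by (simp_all add: card_image strict_mono_on_imp_inj_on)
  show ?L unfolding interlaces_def
  proof (intro allI conjI)
    fix x
    let ?t = "cnt (e ` {1..m}) x"
    have "?t \<le> m" using cnt_le[of "e ` {1..m}" x] cke by simp
    show "?t \<le> cnt (k ` {1..mk}) x"
    proof (cases "?t = 0")
      case False
      then have t: "?t \<in> {1..m}" using \<open>?t \<le> m\<close> by auto
      have "e ?t \<le> x" using cnt_ge_iff[OF e t, of x] by simp
      moreover have "k ?t \<le> e ?t" using R t by blast
      ultimately have "k ?t \<le> x" by linarith
      then show ?thesis using cnt_ge_iff[OF k, of ?t x] t m by auto
    qed simp
    let ?s = "cnt (k ` {1..mk}) x"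
    have "?s \<le> mk" using cnt_le[of "k ` {1..mk}" x] cke by simp
    show "?s \<le> ?t + 1"
    proof (cases "?s \<le> 1")
      case False
      define r where "r = ?s - 1"
      have r: "r \<in> {1..m}" "Suc r = ?s" "r < mk" using False \<open>?s \<le> mk\<close> m by (auto simp: r_def)
      have "k (Suc r) \<le> x" using cnt_ge_iff[OF k, of ?s x] r \<open>?s \<le> mk\<close> by auto
      moreover have "e r \<le> k (Suc r)" using R r by blast
      ultimately have "e r \<le> x" by linarith
      then show ?thesis using cnt_ge_iff[OF e r(1), of x] r by auto
    qed simp
  qed
qed

text \<open>Since \<open>k r \<le> e r\<close>, an \<open>e r\<close> below \<theta> has its
  \<open>k r\<close> below \<theta> too, so agreement below \<theta> concerns an initial segment
  only.\<close>

lemma agree_iff: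
  assumes k: "strict_mono_on {1..mk} k" and e: "strict_mono_on {1..m} e"
    and m: "m \<le> mk" "mk \<le> Suc m" and il: "interlaces (k ` {1..mk}) (e ` {1..m})"
    and p: "p \<le> mk" "\<And>r. r \<in> {1..mk} \<Longrightarrow> k r < \<theta> \<longleftrightarrow> r \<le> p"
  shows "(\<forall>x<\<theta>. x \<in> k ` {1..mk} \<longleftrightarrow> x \<in> e ` {1..m}) \<longleftrightarrow> p \<le> m \<and> (\<forall>r\<in>{1..p}. e r = k r)"
    (is "?L \<longleftrightarrow> ?R")
proof
  note il' = il[unfolded interlaces_iff[OF k e m]]
  assume L: ?L
  have main: "r \<le> m \<and> e r = k r" if r: "r \<in> {1..p}" for r
  proof -
    have rk: "r \<in> {1..mk}" using r p by auto
    have lt: "k r < \<theta>" using p(2)[OF rk] r by simp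
    have "s \<in> k ` {1..mk} \<longleftrightarrow> s \<in> e ` {1..m}" if "s \<le> k r" for s
      using L lt that by (meson le_less_trans)
    then have "{s \<in> k ` {1..mk}. s \<le> k r} = {s \<in> e ` {1..m}. s \<le> k r}" by blast
    then have "cnt (k ` {1..mk}) (k r) = cnt (e ` {1..m}) (k r)" by (simp add: cnt_def)
    then have c: "r \<le> cnt (e ` {1..m}) (k r)" using cnt_ge_iff[OF k rk, of "k r"] by simp
    also have "\<dots> \<le> m" using cnt_le[of "e ` {1..m}" "k r"] e
      by (simp add: card_image strict_mono_on_imp_inj_on)
    finally have "r \<le> m" .
    then have rm: "r \<in> {1..m}" using r by simp
    have "e r \<le> k r" using cnt_ge_iff[OF e rm, of "k r"] c by simp
    moreover have "k r \<le> e r" using il' rm by blast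
    ultimately show ?thesis using \<open>r \<le> m\<close> by simp
  qed
  show ?R using main main[of p] by (cases "p = 0") auto
next
  note il' = il[unfolded interlaces_iff[OF k e m]]
  assume R: ?R
  show ?L
  proof (intro allI impI iffI)
    fix x assume x: "x < \<theta>" "x \<in> k ` {1..mk}"
    then obtain r where r: "r \<in> {1..mk}" "x = k r" by auto
    then have "r \<le> p" using p(2)[OF r(1)] x by simp
    then have "x = e r" "r \<in> {1..m}" using R r by auto
    then show "x \<in> e ` {1..m}" by blast
  next
    fix x assume x: "x < \<theta>" "x \<in> e ` {1..m}"
    then obtain r where r: "r \<in> {1..m}" "x = e r" by auto
    then have rk: "r \<in> {1..mk}" using m by auto
    have "k r \<le> e r" using il' r by blast
    then have "k r < \<theta>" using r x by linarith
    then have "r \<le> p" using p(2)[OF rk] by simp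
    then have "x = k r" using R r by auto
    then show "x \<in> k ` {1..mk}" using rk by blast
  qed
qed

lemma il_sets_empty:
  assumes "strict_mono_on {1..Suc m} k" "\<And>r. r \<in> {1..Suc m} \<Longrightarrow> k r < \<theta>"
  shows "il_sets (k ` {1..Suc m}) m h \<theta> = {}"
proof -
  have False if S': "S' \<in> il_sets (k ` {1..Suc m}) m h \<theta>" for S'
  proof -
    obtain e where e: "strict_mono_on {1..m} e" "e ` {1..m} = S'"
      using strict_mono_on_enumeration[of S'] S' by (auto simp: il_sets_def)
    have "(\<forall>x<\<theta>. x \<in> k ` {1..Suc m} \<longleftrightarrow> x \<in> e ` {1..m}) \<longleftrightarrow> Suc m \<le> m \<and> (\<forall>r\<in>{1..Suc m}. e r = k r)"
      by (rule agree_iff[OF assms(1) e(1)]) (use S' assms(2) e(2) in \<open>auto simp: il_sets_def\<close>)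
    then have "\<not> (\<forall>x<\<theta>. x \<in> k ` {1..Suc m} \<longleftrightarrow> x \<in> S')" unfolding e(2) by simp
    then show False using S' unfolding il_sets_def by blast
  qed
  then show ?thesis by blast
qed

text \<open>u unites the two parities: with equally many entries the last one is bounded by the
  centre, otherwise by the last entry of the larger row.\<close>

lemma il_sets_bij:
  assumes c: "strict_mono_on {1..mk} c" and ch: "\<And>r. r \<in> {1..mk} \<Longrightarrow> c r < h"
    and m: "m \<le> mk" "mk \<le> Suc m"
    and p: "p \<le> m" "\<And>r. r \<in> {1..mk} \<Longrightarrow> c r < \<theta> \<longleftrightarrow> r \<le> p"
    and u: "u = (if m = mk then h - 1 else c mk)"
  shows "bij_betw (\<lambda>l. ovr p (m - p) l c ` {1..m}) (il_vecs p c (m - p) u) (il_sets (c ` {1..mk}) m h \<theta>)"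
    and "l \<in> il_vecs p c (m - p) u \<Longrightarrow> strict_mono_on {1..m} (ovr p (m - p) l c)"
    and "l \<in> il_vecs p c (m - p) u \<Longrightarrow> r \<in> {1..m} \<Longrightarrow> c r \<le> ovr p (m - p) l c r"
proof -
  have pd: "p + (m - p) = m" using p by simp
  have cS: "c r < c (Suc r)" if "1 \<le> r" "r < mk" for r
    using strict_mono_onD[OF c, of r "Suc r"] that by auto
  let ?e = "\<lambda>l. ovr p (m - p) l c"
  have e: "?e l r = (if p < r \<and> r \<le> m then l r else c r)" for l r
    by (simp add: ovr_def pd)
  have sm: "strict_mono_on {1..m} (?e l)" if l: "l \<in> il_vecs p c (m - p) u" for l
  proof (rule strict_mono_on_Suc)
    fix i assume i: "1 \<le> i" "i < m"
    consider "i < p" | "i = p" | "p < i" by linarith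
    then show "?e l i < ?e l (Suc i)"
    proof cases
      case 1
      then show ?thesis using cS[of i] i m by (simp add: e)
    next
      case 2
      then show ?thesis using cS[of i] i m ilaceD(2)[OF l, of "Suc i"] by (simp add: e pd)
    next
      case 3
      then show ?thesis using ilaceD(4)[OF l, of i] i by (simp add: e pd)
    qed
  qed
  have ge: "c r \<le> ?e l r" if l: "l \<in> il_vecs p c (m - p) u" and "r \<in> {1..m}" for l r
    using ilaceD(2)[OF l, of r] that(2) by (auto simp: e pd)
  have le: "?e l r \<le> c (Suc r)" if l: "l \<in> il_vecs p c (m - p) u" and r: "r \<in> {1..m}" "r < mk" for l r
  proof -
    consider "r \<le> p" | "p < r" "r < m" | "p < r" "r = m" using r by force
    then show ?thesis
    proof cases
      case 1
      then show ?thesis using cS[of r] r by (simp add: e)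
    next
      case 2
      then show ?thesis using ilaceD(3)[OF l, of r] by (simp add: e pd)
    next
      case 3
      then have "mk = Suc m" using r m by simp
      then show ?thesis using ilaceD(5)[OF l] 3 u by (simp add: e pd)
    qed
  qed
  have lt: "?e l r < h" if l: "l \<in> il_vecs p c (m - p) u" and r: "r \<in> {1..m}" for l r
  proof (cases "r < mk")
    case True
    then show ?thesis using le[OF l r] ch[of "Suc r"] by auto
  next
    case False
    then have "r = mk" "m = mk" using r m by auto
    then show ?thesis using ilaceD(5)[OF l] ch[of r] u r e[of l r] pd by (cases "p < r") auto
  qed
  have il: "interlaces (c ` {1..mk}) (?e l ` {1..m})" if l: "l \<in> il_vecs p c (m - p) u" for l
    unfolding interlaces_iff[OF c sm[OF l] m] using ge[OF l] le[OF l] by blast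
  show "bij_betw (\<lambda>l. ?e l ` {1..m}) (il_vecs p c (m - p) u) (il_sets (c ` {1..mk}) m h \<theta>)"
    unfolding bij_betw_def
  proof
    show "inj_on (\<lambda>l. ?e l ` {1..m}) (il_vecs p c (m - p) u)"
    proof (rule inj_onI)
      fix l l' assume l: "l \<in> il_vecs p c (m - p) u" "l' \<in> il_vecs p c (m - p) u"
        and eq: "?e l ` {1..m} = ?e l' ` {1..m}"
      show "l = l'"
      proof (rule PiE_ext[OF ilaceD(1)[OF l(1)] ilaceD(1)[OF l(2)]])
        fix r assume "r \<in> {p<..p + (m - p)}"
        then have "r \<in> {1..m}" "p < r" by (auto simp: pd)
        then show "l r = l' r"
          using strict_mono_on_image_eq[OF sm[OF l(1)] sm[OF l(2)] eq, of r] by (simp add: e)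
      qed
    qed
    show "(\<lambda>l. ?e l ` {1..m}) ` il_vecs p c (m - p) u = il_sets (c ` {1..mk}) m h \<theta>"
    proof
      show "(\<lambda>l. ?e l ` {1..m}) ` il_vecs p c (m - p) u \<subseteq> il_sets (c ` {1..mk}) m h \<theta>"
      proof
        fix S' assume "S' \<in> (\<lambda>l. ?e l ` {1..m}) ` il_vecs p c (m - p) u"
        then obtain l where l: "l \<in> il_vecs p c (m - p) u" and S': "S' = ?e l ` {1..m}" by auto
        have "\<forall>x<\<theta>. x \<in> c ` {1..mk} \<longleftrightarrow> x \<in> ?e l ` {1..m}"
          by (subst agree_iff[OF c sm[OF l] m il[OF l], of p]) (use p m in \<open>auto simp: e\<close>)
        moreover have "card S' = m"
          using sm[OF l] by (simp add: S' card_image strict_mono_on_imp_inj_on)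
        ultimately show "S' \<in> il_sets (c ` {1..mk}) m h \<theta>"
          using lt[OF l] il[OF l] by (auto simp: il_sets_def S')
      qed
      show "il_sets (c ` {1..mk}) m h \<theta> \<subseteq> (\<lambda>l. ?e l ` {1..m}) ` il_vecs p c (m - p) u"
      proof
        fix S' assume S': "S' \<in> il_sets (c ` {1..mk}) m h \<theta>"
        obtain f where f: "strict_mono_on {1..m} f" "f ` {1..m} = S'"
          using strict_mono_on_enumeration[of S'] S' by (auto simp: il_sets_def)
        have ilf: "interlaces (c ` {1..mk}) (f ` {1..m})" using S' f by (simp add: il_sets_def)
        note ilf' = ilf[unfolded interlaces_iff[OF c f(1) m]]
        have ag: "\<forall>r\<in>{1..p}. f r = c r"
        proof -
          have "(\<forall>x<\<theta>. x \<in> c ` {1..mk} \<longleftrightarrow> x \<in> f ` {1..m}) \<longleftrightarrow> p \<le> m \<and> (\<forall>r\<in>{1..p}. f r = c r)"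
            by (rule agree_iff[OF c f(1) m ilf]) (use p m in auto)
          moreover have "\<forall>x<\<theta>. x \<in> c ` {1..mk} \<longleftrightarrow> x \<in> f ` {1..m}"
            using S' unfolding f(2) il_sets_def by blast
          ultimately show ?thesis by blast
        qed
        define l where "l = restrict f {p<..m}"
        have lf: "l r = f r" if "p < r" "r \<le> m" for r using that by (simp add: l_def)
        have "l \<in> il_vecs p c (m - p) u"
        proof (rule ilaceI)
          show "l \<in> {p<..p + (m - p)} \<rightarrow>\<^sub>E UNIV" by (simp add: l_def pd)
          show "c i \<le> l i" if "p < i" "i \<le> p + (m - p)" for i
            using that ilf' by (simp add: lf pd)
          show "l i \<le> c (Suc i)" if "p < i" "i < p + (m - p)" for i
            using that ilf' m by (simp add: lf pd)
          show "l i < l (Suc i)" if "p < i" "i < p + (m - p)" for i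
            using that strict_mono_onD[OF f(1), of i "Suc i"] by (simp add: lf pd)
          show "l (p + (m - p)) \<le> u" if "0 < m - p"
          proof (cases "m = mk")
            case True
            have "f m \<in> S'" using f(2) that by auto
            then have "f m < h" using S' by (auto simp: il_sets_def)
            then show ?thesis using True that by (simp add: u pd lf)
          next
            case False
            then have "mk = Suc m" using m by simp
            then show ?thesis using ilf' that by (simp add: u pd lf)
          qed
        qed
        moreover have "?e l ` {1..m} = S'"
          unfolding f(2)[symmetric] using ag by (intro image_cong refl) (auto simp: e lf)
        ultimately show "S' \<in> (\<lambda>l. ?e l ` {1..m}) ` il_vecs p c (m - p) u" by blast
      qed
    qed
  qed
  show "l \<in> il_vecs p c (m - p) u \<Longrightarrow> strict_mono_on {1..m} (ovr p (m - p) l c)"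
    by (rule sm)
  show "l \<in> il_vecs p c (m - p) u \<Longrightarrow> r \<in> {1..m} \<Longrightarrow> c r \<le> ovr p (m - p) l c r"
    by (rule ge)
qed

lemma card_diff_missed:
  assumes c: "strict_mono_on {1..mk} c" and p: "p \<le> m" "m \<le> mk"
  shows "card (c ` {1..mk} - ovr p (m - p) l c ` {1..m}) = missed p (mk - p) c (l ` {p<..m})"
proof -
  have inj: "inj_on c {1..mk}" using c by (rule strict_mono_on_imp_inj_on)
  have S': "ovr p (m - p) l c ` {1..m} = c ` {1..p} \<union> l ` {p<..m}"
  proof -
    have "{1..m} = {1..p} \<union> {p<..m}" using p by auto
    then have "ovr p (m - p) l c ` {1..m} = ovr p (m - p) l c ` {1..p} \<union> ovr p (m - p) l c ` {p<..m}"
      by (simp add: image_Un)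
    then show ?thesis using p by (simp add: ovr_def)
  qed
  have "c ` {1..mk} - ovr p (m - p) l c ` {1..m} = c ` {i \<in> {p<..mk}. c i \<notin> l ` {p<..m}}"
    (is "?A = ?B")
  proof
    show "?A \<subseteq> ?B"
    proof
      fix x assume x: "x \<in> ?A"
      then obtain i where i: "i \<in> {1..mk}" "x = c i" by auto
      have "i \<notin> {1..p}" using x i unfolding S' by blast
      then have "i \<in> {p<..mk}" using i by simp
      moreover have "c i \<notin> l ` {p<..m}" using x i(2) unfolding S' by simp
      ultimately show "x \<in> ?B" unfolding i(2) by (intro imageI) simp
    qed
    show "?B \<subseteq> ?A"
    proof
      fix x assume "x \<in> ?B"
      then obtain i where i: "i \<in> {p<..mk}" "c i \<notin> l ` {p<..m}" "x = c i" by auto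
      have "c i \<noteq> c j" if "j \<in> {1..p}" for j
        using inj_onD[OF inj, of i j] that i p by auto
      then have "c i \<notin> c ` {1..p}" by blast
      moreover have "i \<in> {1..mk}" using i(1) by simp
      ultimately show "x \<in> ?A" unfolding i(3) S' using i(2) by blast
    qed
  qed
  moreover have "inj_on c {i \<in> {p<..mk}. c i \<notin> l ` {p<..m}}"
    by (rule inj_on_subset[OF inj]) auto
  moreover have "p + (mk - p) = mk" using p by simp
  ultimately show ?thesis by (simp add: missed_def card_image)
qed

text \<open>The weight counts S' - S, the entries -1, whereas \<open>il_sum\<close> weighs the
  missed entries S - S'; the two numbers differ by the difference of the sizes.\<close>

lemma card_Diff_swap:
  assumes "finite A" "finite B"
  shows "card (A - B) + card B = card (B - A) + card A"
proof -
  have "card (A - B) = card A - card (A \<inter> B)" "card (B - A) = card B - card (A \<inter> B)"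
    using assms by (simp_all add: card_Diff_subset_Int Int_commute)
  moreover have "card (A \<inter> B) \<le> card A" "card (A \<inter> B) \<le> card B"
    using assms by (auto intro: card_mono)
  ultimately show ?thesis by simp
qed

lemma il_sets_sum_odd:
  fixes f :: "'a::field_char_0 polyfun"
  assumes c: "strict_mono_on {1..m} c" and ch: "\<And>r. r \<in> {1..m} \<Longrightarrow> c r < h"
    and p: "p \<le> m" "\<And>r. r \<in> {1..m} \<Longrightarrow> c r < \<theta> \<longleftrightarrow> r \<le> p"
    and g: "\<And>e. e ` {1..m} \<in> il_sets (c ` {1..m}) m h \<theta> \<Longrightarrow> strict_mono_on {1..m} e \<Longrightarrow>
      (\<And>r. \<not> (p < r \<and> r \<le> m) \<Longrightarrow> e r = c r) \<Longrightarrow> (\<And>r. r \<in> {1..m} \<Longrightarrow> c r \<le> e r) \<Longrightarrow> g (e ` {1..m}) = f e"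
  shows "(\<Sum>S'\<in>il_sets (c ` {1..m}) m h \<theta>. Q ^ card (S' - c ` {1..m}) * g S') =
    il_sum Q p c (m - p) (h - 1) f c"
proof -
  have pd: "p + (m - p) = m" using p by simp
  note fb = il_sets_bij[OF c ch _ _ p(1) p(2), of "h - 1", simplified]
  have "il_sum Q p c (m - p) (h - 1) f c = (\<Sum>l\<in>il_vecs p c (m - p) (h - 1).
      Q ^ missed p (m - p) c (l ` {p<..p + (m - p)}) * f (ovr p (m - p) l c))"
    by (rule il_sum_eq_sum_il_vecs) (use strict_mono_onD[OF c] ch[of m] pd in auto)
  also have "\<dots> = (\<Sum>l\<in>il_vecs p c (m - p) (h - 1).
      Q ^ card (ovr p (m - p) l c ` {1..m} - c ` {1..m}) * g (ovr p (m - p) l c ` {1..m}))"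
  proof (intro sum.cong refl arg_cong2[where f = "(*)"] arg_cong[where f = "\<lambda>i. Q ^ i"])
    fix l assume l: "l \<in> il_vecs p c (m - p) (h - 1)"
    let ?e = "ovr p (m - p) l c"
    have sm: "strict_mono_on {1..m} ?e" using fb(2)[OF l] by simp
    have "card (c ` {1..m} - ?e ` {1..m}) = missed p (m - p) c (l ` {p<..p + (m - p)})"
      unfolding pd by (rule card_diff_missed[OF c p(1)]) simp
    moreover have "card (c ` {1..m}) = m" "card (?e ` {1..m}) = m"
      using c sm by (simp_all add: card_image strict_mono_on_imp_inj_on)
    ultimately show "missed p (m - p) c (l ` {p<..p + (m - p)}) = card (?e ` {1..m} - c ` {1..m})"
      using card_Diff_swap[of "c ` {1..m}" "?e ` {1..m}"] by simp
    have "?e ` {1..m} \<in> il_sets (c ` {1..m}) m h \<theta>"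
      using fb(1) l by (auto simp: bij_betw_def)
    then show "f ?e = g (?e ` {1..m})"
      by (intro g[symmetric] sm) (use fb(3)[OF l] in \<open>auto simp: ovr_def pd\<close>)
  qed
  also have "\<dots> = (\<Sum>S'\<in>il_sets (c ` {1..m}) m h \<theta>. Q ^ card (S' - c ` {1..m}) * g S')"
    by (rule sum.reindex_bij_betw[where g = "\<lambda>S'. Q ^ card (S' - c ` {1..m}) * g S'"])
      (use fb(1) in simp)
  finally show ?thesis ..
qed

text \<open>S has one element more than S', so one more entry is missed than there are entries -1;
  hence the extra factor Q on the left.\<close>

lemma il_sets_sum_even:
  fixes f :: "'a::field_char_0 polyfun"
  assumes c: "strict_mono_on {1..Suc m} c" and ch: "\<And>r. r \<in> {1..Suc m} \<Longrightarrow> c r < h"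
    and p: "p \<le> m" "\<And>r. r \<in> {1..Suc m} \<Longrightarrow> c r < \<theta> \<longleftrightarrow> r \<le> p"
    and g: "\<And>e. e ` {1..m} \<in> il_sets (c ` {1..Suc m}) m h \<theta> \<Longrightarrow> strict_mono_on {1..m} e \<Longrightarrow>
      (\<And>r. \<not> (p < r \<and> r \<le> m) \<Longrightarrow> e r = c r) \<Longrightarrow> (\<And>r. r \<in> {1..m} \<Longrightarrow> c r \<le> e r) \<Longrightarrow> g (e ` {1..m}) = f e"
  shows "Q * (\<Sum>S'\<in>il_sets (c ` {1..Suc m}) m h \<theta>. Q ^ card (S' - c ` {1..Suc m}) * g S') =
    il_sum Q p c (m - p) (c (Suc m)) f c + (Q - 1) * il_sum Q p c (m - p) (c (Suc m) - 1) f c"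
proof -
  have pd: "p + (m - p) = m" using p by simp
  note fb = il_sets_bij[OF c ch _ _ p(1) p(2), of "c (Suc m)", simplified]
  have less: "c r < c (Suc r)" if "p < r" "r \<le> m" for r
    using strict_mono_onD[OF c, of r "Suc r"] that by simp
  have lm: "p < m \<Longrightarrow> c m < c (Suc m)" by (rule less) simp_all
  have i1: "il_sum Q p c (m - p) v f c = (\<Sum>l\<in>il_vecs p c (m - p) v.
      Q ^ missed p (m - p) c (l ` {p<..p + (m - p)}) * f (ovr p (m - p) l c))"
    if "v \<in> {c (Suc m), c (Suc m) - 1}" for v
  proof (rule il_sum_eq_sum_il_vecs)
    show "c i < c (Suc i)" if "p < i" "i < p + (m - p)" for i using less[of i] that by simp
    have "c (p + (m - p)) < c (Suc m)" if "0 < m - p" using lm that unfolding pd by simp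
    then show "c (p + (m - p)) \<le> v" if "0 < m - p" using \<open>v \<in> _\<close> that by fastforce
  qed
  have "il_sum Q p c (m - p) (c (Suc m)) f c + (Q - 1) * il_sum Q p c (m - p) (c (Suc m) - 1) f c =
     (\<Sum>l\<in>il_vecs p c (m - p) (c (Suc m)). Q ^ (missed p (m - p) c (l ` {p<..p + (m - p)}) +
        of_bool (c (Suc m) \<notin> l ` {p<..p + (m - p)})) * f (ovr p (m - p) l c))"
    by (rule il_sum_pair_eq) (rule i1, simp)+
  also have "\<dots> = (\<Sum>l\<in>il_vecs p c (m - p) (c (Suc m)).
      Q ^ Suc (card (ovr p (m - p) l c ` {1..m} - c ` {1..Suc m})) * g (ovr p (m - p) l c ` {1..m}))"
  proof (intro sum.cong refl arg_cong2[where f = "(*)"] arg_cong[where f = "\<lambda>i. Q ^ i"])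
    fix l assume l: "l \<in> il_vecs p c (m - p) (c (Suc m))"
    let ?e = "ovr p (m - p) l c"
    have sm: "strict_mono_on {1..m} ?e" using fb(2)[OF l] by simp
    have "card (c ` {1..Suc m} - ?e ` {1..m}) = missed p (Suc m - p) c (l ` {p<..m})"
      by (rule card_diff_missed[OF c p(1)]) simp
    also have "\<dots> = missed p (m - p) c (l ` {p<..m}) + of_bool (c (Suc m) \<notin> l ` {p<..m})"
    proof -
      have "p + (Suc m - p) = Suc m" using p by simp
      moreover have "{i \<in> {p<..Suc m}. c i \<notin> l ` {p<..m}} =
          {i \<in> {p<..m}. c i \<notin> l ` {p<..m}} \<union> (if c (Suc m) \<in> l ` {p<..m} then {} else {Suc m})"
        using p(1) by (auto simp: le_Suc_eq split: if_splits)
      ultimately show ?thesis by (simp add: missed_def pd)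
    qed
    finally have 1: "card (c ` {1..Suc m} - ?e ` {1..m}) = \<dots>" .
    have "card (c ` {1..Suc m}) = Suc m" "card (?e ` {1..m}) = m"
      using card_image[OF strict_mono_on_imp_inj_on[OF c]] card_image[OF strict_mono_on_imp_inj_on[OF sm]]
      by simp_all
    then have "card (c ` {1..Suc m} - ?e ` {1..m}) = Suc (card (?e ` {1..m} - c ` {1..Suc m}))"
      using card_Diff_swap[of "c ` {1..Suc m}" "?e ` {1..m}"] by simp
    then show "missed p (m - p) c (l ` {p<..p + (m - p)}) + of_bool (c (Suc m) \<notin> l ` {p<..p + (m - p)}) =
        Suc (card (?e ` {1..m} - c ` {1..Suc m}))"
      unfolding pd 1 .
    have "?e ` {1..m} \<in> il_sets (c ` {1..Suc m}) m h \<theta>"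
      using fb(1) l by (auto simp: bij_betw_def)
    then show "f ?e = g (?e ` {1..m})"
      by (intro g[symmetric] sm) (use fb(3)[OF l] in \<open>auto simp: ovr_def pd\<close>)
  qed
  also have "\<dots> = (\<Sum>S'\<in>il_sets (c ` {1..Suc m}) m h \<theta>. Q ^ Suc (card (S' - c ` {1..Suc m})) * g S')"
    by (rule sum.reindex_bij_betw[where g = "\<lambda>S'. Q ^ Suc (card (S' - c ` {1..Suc m})) * g S'"])
      (use fb(1) in simp)
  finally show ?thesis by (simp add: sum_distrib_left mult.assoc)
qed

subsection \<open>Weighted sums over rows of a trapezoid\<close>

text \<open>t is the number of column i, which for i \<le> n has its lowest cell in row i; columns
  numbered below t have ended earlier. A 1-column t is a 10-column exactly if its sum was 1 before
  that row, hence the condition on C.\<close>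

definition preds :: "nat \<Rightarrow> int \<Rightarrow> int set \<Rightarrow> nat \<Rightarrow> int set \<Rightarrow> int set set" where
  "preds n h C i S = (let t = int i - int n - 1 in
     {S' \<in> il_sets S ((i - 1) div 2) h t. t \<in> S \<longrightarrow> (t \<in> S' \<longleftrightarrow> t \<in> C)})"

primrec wsum :: "'a::field_char_0 \<Rightarrow> nat \<Rightarrow> int \<Rightarrow> int set \<Rightarrow> nat \<Rightarrow> int set \<Rightarrow> 'a" where
  "wsum Q n h C 0 S = 1"
| "wsum Q n h C (Suc i) S = (\<Sum>S'\<in>preds n h C (Suc i) S. Q ^ card (S' - S) * wsum Q n h C i S')"

definition level :: "'a::field_char_0 \<Rightarrow> int \<Rightarrow> nat \<Rightarrow> 'a polyfun" where
  "level Q h i = (if even i then level_even Q h (i div 2) else level_odd Q h (i div 2))"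

definition flag_op :: "'a::field_char_0 \<Rightarrow> nat \<Rightarrow> int set \<Rightarrow> nat \<Rightarrow> int \<Rightarrow> 'a shift_op" where
  "flag_op Q K C r x = (if x \<in> C then - qd_op Q K r else 1 + qd_op Q K r)"

text \<open>The 1-column numbered c_r ends in row c_r + n + 1. It gets \<open>flag_op\<close> for
  that row and -\<Delta>^Q for each later row up to i; for i = n these are -c_r - 1 factors.\<close>

definition freeze_ops :: "'a::field_char_0 \<Rightarrow> nat \<Rightarrow> int set \<Rightarrow> nat \<Rightarrow> nat \<Rightarrow> (nat \<Rightarrow> int) \<Rightarrow> 'a shift_op" where
  "freeze_ops Q K C n i c = (\<Prod>r\<in>{r \<in> {1..i div 2}. c r + int n + 1 \<le> int i}.
     flag_op Q K C r (c r) * (- qd_op Q K r) ^ nat (int i - (c r + int n + 1)))"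

lemma threshold_exists:
  assumes "strict_mono_on {1..m} (c :: nat \<Rightarrow> int)"
  obtains p where "p \<le> m" "\<And>r. r \<in> {1..m} \<Longrightarrow> c r < \<theta> \<longleftrightarrow> r \<le> p"
proof
  let ?p = "cnt (c ` {1..m}) (\<theta> - 1)"
  have "card (c ` {1..m}) = m" using card_image[OF strict_mono_on_imp_inj_on[OF assms]] by simp
  then show "?p \<le> m" using cnt_le[of "c ` {1..m}" "\<theta> - 1"] by simp
  show "c r < \<theta> \<longleftrightarrow> r \<le> ?p" if "r \<in> {1..m}" for r
    using cnt_ge_iff[OF assms that, of "\<theta> - 1"] by auto
qed

lemma finite_il_sets:
  assumes c: "strict_mono_on {1..mk} c" and ch: "\<And>r. r \<in> {1..mk} \<Longrightarrow> c r < h"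
    and m: "m \<le> mk" "mk \<le> Suc m"
  shows "finite (il_sets (c ` {1..mk}) m h \<theta>)"
proof -
  obtain p where p: "p \<le> mk" "\<And>r. r \<in> {1..mk} \<Longrightarrow> c r < \<theta> \<longleftrightarrow> r \<le> p"
    using threshold_exists[OF c] by blast
  show ?thesis
  proof (cases "p \<le> m")
    case True
    show ?thesis
      using bij_betw_finite[OF il_sets_bij(1)[OF c ch m True p(2) refl]] finite_il_vecs by blast
  next
    case False
    then have "mk = Suc m" "p = mk" using m p by auto
    then show ?thesis using il_sets_empty[of m c \<theta> h] c p by simp
  qed
qed

lemma local_op_flag_op: "r \<in> A \<Longrightarrow> local_op A (flag_op Q K C r x)"
  by (auto simp: flag_op_def intro!: local_op_intros local_op_qd_op)

text \<open>Two thresholds: the p0 entries below t carry the operators of earlier rows, the p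
  entries below \<theta> stay fixed in this summation. Both \<theta> = t and \<theta> = t + 1 are
  needed for the column that ends in this row.\<close>

lemma frozen_sum:
  fixes Q :: "'a::field_char_0"
  assumes Q: "Q \<noteq> 0" and K: "Suc i \<le> K"
    and c: "strict_mono_on {1..Suc i div 2} c" and ch: "\<And>r. r \<in> {1..Suc i div 2} \<Longrightarrow> c r < h"
    and IH: "\<And>e. strict_mono_on {1..i div 2} e \<Longrightarrow> (\<And>r. r \<in> {1..i div 2} \<Longrightarrow> e r < h) \<Longrightarrow>
      wsum Q n h C i (e ` {1..i div 2}) = act (freeze_ops Q K C n i e) (level Q h i) e"
    and t: "t = int i - int n" and \<theta>: "t \<le> \<theta>"
    and p0: "p0 \<le> p" "\<And>r. r \<in> {1..Suc i div 2} \<Longrightarrow> c r < t \<longleftrightarrow> r \<le> p0"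
    and p: "p \<le> Suc i div 2" "\<And>r. r \<in> {1..Suc i div 2} \<Longrightarrow> c r < \<theta> \<longleftrightarrow> r \<le> p"
  shows "(\<Sum>S'\<in>il_sets (c ` {1..Suc i div 2}) (i div 2) h \<theta>. Q ^ card (S' - c ` {1..Suc i div 2}) * wsum Q n h C i S') =
    act ((\<Prod>r\<in>{1..p0}. flag_op Q K C r (c r) * (- qd_op Q K r) ^ nat (int i - (c r + int n + 1))) *
      (\<Prod>r\<in>{1..p}. - qd_op Q K r)) (level Q h (Suc i)) c"
proof -
  define m where "m = i div 2"
  define mk where "mk = Suc i div 2"
  define T where "T = (\<Prod>r\<in>{1..p0}. flag_op Q K C r (c r) * (- qd_op Q K r) ^ nat (int i - (c r + int n + 1)))"
  define P where "P = (\<Prod>r\<in>{1..p}. - qd_op Q K r)"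
  have mm: "m \<le> mk" "mk \<le> Suc m" by (auto simp: m_def mk_def)
  have T: "local_op {1..p0} T"
    unfolding T_def by (intro local_op_intros local_op_flag_op local_op_qd_op) auto
  have upd: "intertwines (\<lambda>c. c(r := y)) T T" if "p < r" for r y
    by (rule local_op_update[OF T]) (use that p0 in auto)
  have ic: "il_sum Q p c d u (act T f) = act T (il_sum Q p c d u f)" for d u f
    by (rule il_sum_act_commute) (rule upd)
  \<comment> \<open>Entries below t are fixed and the others cannot drop below t, so
    \<open>freeze_ops\<close> is the same operator for all summands.\<close>
  have g: "wsum Q n h C i (e ` {1..m}) = act T (level Q h i) e"
    if pm: "p \<le> m" and e: "e ` {1..m} \<in> il_sets (c ` {1..mk}) m h \<theta>" "strict_mono_on {1..m} e"
      "\<And>r. \<not> (p < r \<and> r \<le> m) \<Longrightarrow> e r = c r" "\<And>r. r \<in> {1..m} \<Longrightarrow> c r \<le> e r" for e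
  proof -
    have "e r < h" if "r \<in> {1..m}" for r using e(1) that by (auto simp: il_sets_def)
    then have "wsum Q n h C i (e ` {1..m}) = act (freeze_ops Q K C n i e) (level Q h i) e"
      using IH[of e] e(2) by (simp add: m_def)
    moreover have "{r \<in> {1..m}. e r + int n + 1 \<le> int i} = {1..p0}"
    proof -
      have "e r < t \<longleftrightarrow> r \<le> p0" if r: "r \<in> {1..m}" for r
      proof (cases "r \<le> p0")
        case True
        then have "e r = c r" using e(3)[of r] p0(1) by auto
        then show ?thesis using p0(2)[of r] True r mm by (simp add: mk_def)
      next
        case False
        then have "t \<le> c r" using p0(2)[of r] r mm by (simp add: mk_def)
        then show ?thesis using e(4)[OF r] False by simp
      qed
      moreover have "e r + int n + 1 \<le> int i \<longleftrightarrow> e r < t" for r unfolding t by linarith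
      ultimately show ?thesis using p0(1) pm by auto
    qed
    then have "freeze_ops Q K C n i e = T"
      unfolding freeze_ops_def T_def m_def[symmetric] using e(3) p0(1)
      by (intro prod.cong) auto
    ultimately show ?thesis by simp
  qed
  let ?s = "\<lambda>c' r. if r \<in> {p<..mk} then c r else c' r"
  have sc: "?s c = c" by auto
  have disj: "{1..p0} \<inter> {p<..mk} = {}" using p0(1) by auto
  have ov: "act T (\<lambda>c'. act P (level Q h (Suc i)) (?s c')) c = act (T * P) (level Q h (Suc i)) c"
    using intertwinesD[OF local_op_override[OF T disj, of c], of "act P (level Q h (Suc i))" c]
    unfolding sc act_mult by (rule sym)
  show ?thesis
  proof (cases "even i")
    case True
    then have mk: "mk = m" and im: "i = 2 * m" by (auto simp: mk_def m_def elim: evenE)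
    have level: "level Q h i = level_even Q h m" "level Q h (Suc i) = level_odd Q h m"
      using True mk by (auto simp: level_def m_def mk_def)
    have pm: "p \<le> m" using p mk by (simp add: mk_def)
    have less: "c r < c (Suc r)" if "p < r" "r < m" for r
      using strict_mono_onD[OF c, of r "Suc r"] that mk by (simp add: mk_def)
    have "(\<Sum>S'\<in>il_sets (c ` {1..m}) m h \<theta>. Q ^ card (S' - c ` {1..m}) * wsum Q n h C i S') =
        il_sum Q p c (m - p) (h - 1) (act T (level Q h i)) c"
      by (rule il_sets_sum_odd) (use c ch pm p mk g in \<open>auto simp: mk_def\<close>)
    also have "\<dots> = act T (il_sum Q p c (m - p) (h - 1) (level_even Q h m)) c"
      unfolding level ic ..
    also have "il_sum Q p c (m - p) (h - 1) (level_even Q h m) = (\<lambda>c'. act P (level Q h (Suc i)) (?s c'))"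
      unfolding level P_def
      by (rule ext, subst row_sum_odd[where K = K]) (use Q K im pm less ch[of m] mk in \<open>auto simp: mk_def\<close>)
    finally have "(\<Sum>S'\<in>il_sets (c ` {1..m}) m h \<theta>. Q ^ card (S' - c ` {1..m}) * wsum Q n h C i S') =
        act (T * P) (level Q h (Suc i)) c"
      unfolding ov .
    then show ?thesis
      unfolding T_def P_def m_def[symmetric] mk_def[symmetric] mk .
  next
    case False
    then have mk: "mk = Suc m" and im: "i = Suc (2 * m)" by (auto simp: mk_def m_def elim!: oddE)
    have level: "level Q h i = level_odd Q h m" "level Q h (Suc i) = level_even Q h (Suc m)"
      using False mk by (auto simp: level_def m_def mk_def)
    have less: "c r < c (Suc r)" if "p < r" "r \<le> m" for r
      using strict_mono_onD[OF c, of r "Suc r"] that mk by (simp add: mk_def)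
    show ?thesis
    proof (cases "p \<le> m")
      case pm: True
      have "Q * (\<Sum>S'\<in>il_sets (c ` {1..Suc m}) m h \<theta>. Q ^ card (S' - c ` {1..Suc m}) * wsum Q n h C i S') =
          il_sum Q p c (m - p) (c (Suc m)) (act T (level Q h i)) c +
          (Q - 1) * il_sum Q p c (m - p) (c (Suc m) - 1) (act T (level Q h i)) c"
        by (rule il_sets_sum_even) (use c ch pm p mk g in \<open>auto simp: mk_def\<close>)
      also have "\<dots> = act T (\<lambda>c'. il_sum Q p c (m - p) (c (Suc m)) (level_odd Q h m) c' +
          (Q - 1) * il_sum Q p c (m - p) (c (Suc m) - 1) (level_odd Q h m) c') c"
        unfolding level ic act_fun_add act_fun_scale ..
      also have "(\<lambda>c'. il_sum Q p c (m - p) (c (Suc m)) (level_odd Q h m) c' +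
          (Q - 1) * il_sum Q p c (m - p) (c (Suc m) - 1) (level_odd Q h m) c') =
          (\<lambda>c'. Q * act P (level Q h (Suc i)) (?s c'))"
        unfolding level P_def
        by (rule ext, subst row_sum_even[where K = K]) (use Q K im pm less mk in auto)
      finally have "Q * (\<Sum>S'\<in>il_sets (c ` {1..Suc m}) m h \<theta>. Q ^ card (S' - c ` {1..Suc m}) * wsum Q n h C i S') =
          Q * act (T * P) (level Q h (Suc i)) c"
        unfolding act_fun_scale ov .
      then show ?thesis
        using Q unfolding T_def P_def m_def[symmetric] mk_def[symmetric] mk by simp
    next
      \<comment> \<open>All m + 1 entries are frozen: there is no predecessor, and the operators
        annihilate the level.\<close>
      case pm: False
      then have pm: "p = Suc m" using p mk by (simp add: mk_def)
      have "il_sets (c ` {1..Suc m}) m h \<theta> = {}"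
        by (rule il_sets_empty) (use c p pm mk in \<open>auto simp: mk_def\<close>)
      moreover have "act (T * P) (level Q h (Suc i)) c = 0"
        unfolding act_mult P_def level pm
        by (subst act_prod_all_qd_op_level_even[OF Q]) (use K im in auto)
      ultimately show ?thesis
        unfolding T_def P_def m_def[symmetric] mk_def[symmetric] mk by simp
    qed
  qed
qed

lemma wsum_eq_act:
  fixes Q :: "'a::field_char_0"
  assumes Q: "Q \<noteq> 0" and K: "i \<le> K"
    and c: "strict_mono_on {1..i div 2} c" and ch: "\<And>r. r \<in> {1..i div 2} \<Longrightarrow> c r < h"
  shows "wsum Q n h C i (c ` {1..i div 2}) = act (freeze_ops Q K C n i c) (level Q h i) c"
  using K c ch
proof (induction i arbitrary: c)
  case 0
  have "bdet h 0 0 c = 1" by (simp add: bdet_def altdet_def det_dim_zero)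
  moreover have "pairs 0 = {}" by (auto simp: pairs_def)
  ultimately show ?case by (simp add: freeze_ops_def level_def level_even_def bop_def)
next
  case (Suc i)
  define m where "m = i div 2"
  define mk where "mk = Suc i div 2"
  define S where "S = c ` {1..mk}"
  define t where "t = int i - int n"
  define fs where "fs \<theta> = (\<Sum>S'\<in>il_sets S m h \<theta>. Q ^ card (S' - S) * wsum Q n h C i S')" for \<theta>
  have c: "strict_mono_on {1..mk} c" using Suc.prems by (simp add: mk_def)
  obtain p0 where p0: "p0 \<le> mk" "\<And>r. r \<in> {1..mk} \<Longrightarrow> c r < t \<longleftrightarrow> r \<le> p0"
    using threshold_exists[OF c] by blast
  define T where "T = (\<Prod>r\<in>{1..p0}. flag_op Q K C r (c r) * (- qd_op Q K r) ^ nat (int i - (c r + int n + 1)))"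
  have IH: "wsum Q n h C i (e ` {1..i div 2}) = act (freeze_ops Q K C n i e) (level Q h i) e"
    if "strict_mono_on {1..i div 2} e" "\<And>r. r \<in> {1..i div 2} \<Longrightarrow> e r < h" for e
    by (rule Suc.IH) (use that Suc.prems in auto)
  have fs: "fs \<theta> = act (T * (\<Prod>r\<in>{1..p}. - qd_op Q K r)) (level Q h (Suc i)) c"
    if "t \<le> \<theta>" "p0 \<le> p" "p \<le> mk" "\<And>r. r \<in> {1..mk} \<Longrightarrow> c r < \<theta> \<longleftrightarrow> r \<le> p" for \<theta> p
    unfolding fs_def S_def T_def m_def mk_def
    by (rule frozen_sum[OF Q _ _ _ IH t_def]) (use Suc.prems that p0 in \<open>auto simp: mk_def\<close>)
  \<comment> \<open>Every column that ended in an earlier row acquires one more -\<Delta>^Q.\<close>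
  have T0: "(\<Prod>r\<in>{1..p0}. flag_op Q K C r (c r) * (- qd_op Q K r) ^ nat (int (Suc i) - (c r + int n + 1))) =
      T * (\<Prod>r\<in>{1..p0}. - qd_op Q K r)"
    unfolding T_def prod.distrib[symmetric]
  proof (intro prod.cong refl)
    fix r assume "r \<in> {1..p0}"
    then have "c r < t" using p0 by auto
    then have "nat (int (Suc i) - (c r + int n + 1)) = Suc (nat (int i - (c r + int n + 1)))"
      by (simp add: t_def)
    then show "flag_op Q K C r (c r) * (- qd_op Q K r) ^ nat (int (Suc i) - (c r + int n + 1)) =
        flag_op Q K C r (c r) * (- qd_op Q K r) ^ nat (int i - (c r + int n + 1)) * - qd_op Q K r"
      by (simp only: power_Suc2 mult.assoc)
  qed
  have idx: "{r \<in> {1..mk}. c r + int n + 1 \<le> int (Suc i)} = {r \<in> {1..mk}. c r \<le> t}"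
    by (auto simp: t_def)
  have nx: "preds n h C (Suc i) S = {S' \<in> il_sets S m h t. t \<in> S \<longrightarrow> (t \<in> S' \<longleftrightarrow> t \<in> C)}"
    by (simp add: preds_def Let_def t_def m_def)
  have GS: "wsum Q n h C (Suc i) S = (\<Sum>S'\<in>preds n h C (Suc i) S. Q ^ card (S' - S) * wsum Q n h C i S')"
    by simp
  have "wsum Q n h C (Suc i) S = act (freeze_ops Q K C n (Suc i) c) (level Q h (Suc i)) c"
  proof (cases "t \<in> S")
    case False
    then have "preds n h C (Suc i) S = il_sets S m h t" by (simp add: nx)
    then have "wsum Q n h C (Suc i) S = fs t" unfolding GS by (simp only: fs_def)
    moreover have "{r \<in> {1..mk}. c r \<le> t} = {1..p0}"
    proof -
      have "c r \<le> t \<longleftrightarrow> c r < t" if "r \<in> {1..mk}" for r using False that by (force simp: S_def)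
      then show ?thesis using p0 by auto
    qed
    ultimately show ?thesis
      unfolding freeze_ops_def mk_def[symmetric] idx using T0 fs[of t p0] p0 by simp
  next
    case True
    then obtain r where r: "r \<in> {1..mk}" "c r = t" by (auto simp: S_def)
    have rp: "r = Suc p0"
    proof -
      have "\<not> r \<le> p0" using p0(2)[OF r(1)] r(2) by simp
      moreover have "r - 1 \<le> p0"
      proof (cases "r = 1")
        case False
        then have "c (r - 1) < c r" using r by (intro strict_mono_onD[OF c]) auto
        moreover have "r - 1 \<in> {1..mk}" using r False by auto
        ultimately show ?thesis using p0(2)[of "r - 1"] r(2) by simp
      qed simp
      ultimately show ?thesis by simp
    qed
    have thr1: "c s < t + 1 \<longleftrightarrow> s \<le> Suc p0" if s: "s \<in> {1..mk}" for s
    proof -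
      have "c s = t \<longleftrightarrow> s = r"
        using inj_on_eq_iff[OF strict_mono_on_imp_inj_on[OF c] s r(1)] r(2) by simp
      then show ?thesis using p0(2)[OF s] rp by auto
    qed
    have f0: "fs t = act (T * (\<Prod>r\<in>{1..p0}. - qd_op Q K r)) (level Q h (Suc i)) c"
      by (rule fs) (use p0 in auto)
    have f1: "fs (t + 1) = act (T * (\<Prod>r\<in>{1..Suc p0}. - qd_op Q K r)) (level Q h (Suc i)) c"
      by (rule fs) (use r rp thr1 in auto)
    have idx1: "{s \<in> {1..mk}. c s \<le> t} = insert (Suc p0) {1..p0}"
    proof -
      have "c s \<le> t \<longleftrightarrow> s \<le> Suc p0" if "s \<in> {1..mk}" for s using thr1[OF that] by auto
      then show ?thesis using r rp by auto
    qed
    have freeze_ops: "freeze_ops Q K C n (Suc i) c = T * (\<Prod>r\<in>{1..p0}. - qd_op Q K r) * flag_op Q K C (Suc p0) t"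
    proof -
      have "freeze_ops Q K C n (Suc i) c = (flag_op Q K C (Suc p0) (c (Suc p0)) *
          (- qd_op Q K (Suc p0)) ^ nat (int (Suc i) - (c (Suc p0) + int n + 1))) *
          (T * (\<Prod>r\<in>{1..p0}. - qd_op Q K r))"
        unfolding freeze_ops_def mk_def[symmetric] idx idx1 T0[symmetric] by (rule prod.insert) auto
      moreover have "nat (int (Suc i) - (c (Suc p0) + int n + 1)) = 0"
        using r rp by (simp add: t_def)
      ultimately show ?thesis using r rp by (simp add: mult_ac)
    qed
    have sub: "il_sets S m h (t + 1) \<subseteq> il_sets S m h t" by (auto simp: il_sets_def)
    have mem: "S' \<in> il_sets S m h (t + 1) \<longleftrightarrow> t \<in> S'" if "S' \<in> il_sets S m h t" for S'
    proof -
      have "(\<forall>x<t + 1. x \<in> S \<longleftrightarrow> x \<in> S') \<longleftrightarrow> (\<forall>x<t. x \<in> S \<longleftrightarrow> x \<in> S') \<and> (t \<in> S \<longleftrightarrow> t \<in> S')"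
      proof -
        have lt: "x < t + 1 \<longleftrightarrow> x < t \<or> x = t" for x by auto
        show ?thesis unfolding lt by blast
      qed
      then show ?thesis using that True unfolding il_sets_def by blast
    qed
    have Z: "1 + qd_op Q K (Suc p0) = 1 - - qd_op Q K (Suc p0)" by simp
    show ?thesis
    \<comment> \<open>For a 10-column t is in the previous set as well, which is freezing with
      threshold t + 1 and yields -\<Delta>^Q. Otherwise t must be new, and subtracting threshold t +
      1 from threshold t yields id + \<Delta>^Q.\<close>
    proof (cases "t \<in> C")
      case tC: True
      have "preds n h C (Suc i) S = il_sets S m h (t + 1)"
        using sub mem tC True by (auto simp: nx)
      then have "wsum Q n h C (Suc i) S = fs (t + 1)" unfolding GS by (simp only: fs_def)
      then show ?thesis unfolding f1 freeze_ops using tC by (simp add: flag_op_def mult_ac)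
    next
      case tC: False
      have n: "preds n h C (Suc i) S = il_sets S m h t - il_sets S m h (t + 1)"
        using mem tC True by (auto simp: nx)
      have fin: "finite (il_sets S m h t)"
        unfolding S_def by (rule finite_il_sets[OF c]) (use Suc.prems in \<open>auto simp: m_def mk_def\<close>)
      have "wsum Q n h C (Suc i) S = fs t - fs (t + 1)"
        unfolding GS n fs_def by (rule sum_diff[OF fin sub])
      also have "\<dots> = act (T * (\<Prod>r\<in>{1..p0}. - qd_op Q K r) -
          T * ((\<Prod>r\<in>{1..p0}. - qd_op Q K r) * - qd_op Q K (Suc p0))) (level Q h (Suc i)) c"
        unfolding f0 f1 act_diff by simp
      also have "T * (\<Prod>r\<in>{1..p0}. - qd_op Q K r) -
          T * ((\<Prod>r\<in>{1..p0}. - qd_op Q K r) * - qd_op Q K (Suc p0)) =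
          T * (\<Prod>r\<in>{1..p0}. - qd_op Q K r) * (1 - - qd_op Q K (Suc p0))"
        by (simp only: right_diff_distrib mult_1_right mult.assoc)
      finally show ?thesis unfolding freeze_ops using tC by (simp add: flag_op_def)
    qed
  qed
  then show ?case unfolding S_def mk_def .
qed

subsection \<open>Alternating sequences and prefix sums\<close>

text \<open>The induction carries the last nonzero entry: it is 1 if the prefix sum is 1, and -1 or
  absent if it is 0. This fixes the next nonzero entry.\<close>

lemma alternating_first_prefix:
  fixes f :: "nat \<Rightarrow> int"
  assumes v: "\<And>x. x \<in> {p..q} \<Longrightarrow> f x \<in> {-1, 0, 1}"
    and alt: "alternating {p..q} f"
    and first: "\<And>x. x \<in> {p..q} \<Longrightarrow> f x \<noteq> 0 \<Longrightarrow> (\<And>y. y \<in> {p..q} \<Longrightarrow> y < x \<Longrightarrow> f y = 0) \<Longrightarrow> f x = 1"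
    and r: "r \<le> Suc q"
  shows "(\<Sum>x\<in>{p..<r}. f x) \<in> {0, 1}"
proof -
  define s where "s r = (\<Sum>x\<in>{p..<r}. f x)" for r
  let ?last = "\<lambda>r z. z \<in> {p..<r} \<and> (\<forall>y. z < y \<and> y < r \<longrightarrow> f y = 0)"
  have "(s r = 0 \<and> ((\<forall>y\<in>{p..<r}. f y = 0) \<or> (\<exists>z. ?last r z \<and> f z = -1))) \<or>
      (s r = 1 \<and> (\<exists>z. ?last r z \<and> f z = 1))"
    using r
  proof (induction r)
    case (Suc r)
    show ?case
    proof (cases "p \<le> r")
      case False
      then show ?thesis by (simp add: s_def)
    next
      case True
      have rq: "r \<in> {p..q}" using True Suc.prems by simp
      have s: "s (Suc r) = s r + f r" using True by (simp add: s_def add.commute)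
      have keep: "?last (Suc r) z" if "?last r z" "f r = 0" for z
        using that by (auto simp: less_Suc_eq)
      have new: "?last (Suc r) r" using True by auto
      have opp: "f r = - f z" if z: "?last r z" "f z \<in> {-1, 1}" and fr: "f r \<noteq> 0" for z
      proof -
        have "sgn (f r) = - sgn (f z)"
          using alt[unfolded alternating_def, rule_format, of z r] z fr rq by auto
        then show ?thesis using v[OF rq] z fr by auto
      qed
      have IH: "(s r = 0 \<and> ((\<forall>y\<in>{p..<r}. f y = 0) \<or> (\<exists>z. ?last r z \<and> f z = -1))) \<or>
          (s r = 1 \<and> (\<exists>z. ?last r z \<and> f z = 1))"
        using Suc.IH Suc.prems by simp
      show ?thesis
      proof (cases "f r = 0")
        case True
        have "\<forall>y\<in>{p..<Suc r}. f y = 0" if "\<forall>y\<in>{p..<r}. f y = 0"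
          using that True by (auto simp: less_Suc_eq)
        moreover have "s (Suc r) = s r" using s True by simp
        ultimately show ?thesis using IH keep[OF _ True] by (metis (no_types, lifting))
      next
        case fr: False
        from IH consider (none) "s r = 0" "\<forall>y\<in>{p..<r}. f y = 0"
          | (minus) z where "s r = 0" "?last r z" "f z = -1"
          | (plus) z where "s r = 1" "?last r z" "f z = 1" by blast
        then show ?thesis
        proof cases
          case none
          then have "f r = 1" using first[OF rq fr] by auto
          then show ?thesis using none(1) new unfolding s by auto
        next
          case (minus z)
          then have "f r = 1" using opp[of z] fr by simp
          then show ?thesis using minus(1) new unfolding s by auto
        next
          case (plus z)
          then have "f r = -1" using opp[of z] fr by simp
          then show ?thesis using plus(1) new unfolding s by auto
        qed
      qed
    qed
  qed (simp add: s_def)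
  then show ?thesis unfolding s_def by blast
qed

lemma prefix_alternating_first:
  fixes f :: "nat \<Rightarrow> int"
  assumes "\<And>r. r \<le> Suc q \<Longrightarrow> (\<Sum>x\<in>{p..<r}. f x) \<in> {0, 1}"
  shows "alternating {p..q} f"
    and "x \<in> {p..q} \<Longrightarrow> f x \<noteq> 0 \<Longrightarrow> (\<And>y. y \<in> {p..q} \<Longrightarrow> y < x \<Longrightarrow> f y = 0) \<Longrightarrow> f x = 1"
    and "x \<in> {p..q} \<Longrightarrow> f x \<in> {-1, 0, 1}"
proof -
  define s where "s r = (\<Sum>x\<in>{p..<r}. f x)" for r
  have S: "s (Suc x) = s x + f x" if "x \<in> {p..q}" for x using that by (simp add: s_def add.commute)
  have v: "s r = 0 \<or> s r = 1" if "r \<le> Suc q" for r using assms[OF that] by (simp add: s_def)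
  show "f x \<in> {-1, 0, 1}" if x: "x \<in> {p..q}"
    using S[OF x] v[of x] v[of "Suc x"] x by auto
  show "f x = 1" if x: "x \<in> {p..q}" "f x \<noteq> 0" "\<And>y. y \<in> {p..q} \<Longrightarrow> y < x \<Longrightarrow> f y = 0"
  proof -
    have "s x = 0" unfolding s_def using x by (intro sum.neutral) auto
    then show ?thesis using S[OF x(1)] v[of "Suc x"] x by auto
  qed
  show "alternating {p..q} f"
    unfolding alternating_def
  proof (intro ballI impI)
    fix x y assume x: "x \<in> {p..q}" and y: "y \<in> {p..q}"
      and xy: "x < y \<and> f x \<noteq> 0 \<and> f y \<noteq> 0 \<and> (\<forall>z\<in>{p..q}. x < z \<and> z < y \<longrightarrow> f z = 0)"
    have "s y = s (Suc x) + (\<Sum>z\<in>{Suc x..<y}. f z)"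
      unfolding s_def using x y xy by (subst sum.atLeastLessThan_concat) auto
    moreover have "(\<Sum>z\<in>{Suc x..<y}. f z) = 0" using x y xy by (intro sum.neutral) auto
    ultimately have "s y = s x + f x" using S[OF x] by simp
    moreover have "s (Suc y) = s y + f y" by (rule S[OF y])
    moreover have "s x = 0 \<or> s x = 1" "s y = 0 \<or> s y = 1" "s (Suc y) = 0 \<or> s (Suc y) = 1"
      by (rule v; use x y in simp)+
    moreover have "f x \<noteq> 0" "f y \<noteq> 0" using xy by simp_all
    ultimately have "f x = 1 \<and> f y = -1 \<or> f x = -1 \<and> f y = 1" by linarith
    then show "sgn (f y) = - sgn (f x)" by auto
  qed
qed

text \<open>For rows the leading 1 is not among the axioms. If the first nonzero entry were -1, the
  negated sequence would start with 1 and have sum 0 or 1, but its sum is -1.\<close>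

lemma alternating_sum_one_first:
  fixes f :: "nat \<Rightarrow> int"
  assumes v: "\<And>x. x \<in> {p..q} \<Longrightarrow> f x \<in> {-1, 0, 1}"
    and alt: "alternating {p..q} f" and one: "(\<Sum>x\<in>{p..q}. f x) = 1"
    and x: "x \<in> {p..q}" "f x \<noteq> 0" "\<And>y. y \<in> {p..q} \<Longrightarrow> y < x \<Longrightarrow> f y = 0"
  shows "f x = 1"
proof (rule ccontr)
  assume "f x \<noteq> 1"
  then have fx: "f x = -1" using v[OF x(1)] x(2) by auto
  have "(\<Sum>x\<in>{p..<Suc q}. - f x) \<in> {0, 1}"
  proof (rule alternating_first_prefix[where q = q])
    show "alternating {p..q} (\<lambda>x. - f x)" using alt by (simp add: alternating_def)
    show "- f y = 1" if y: "y \<in> {p..q}" "- f y \<noteq> 0" "\<And>z. z \<in> {p..q} \<Longrightarrow> z < y \<Longrightarrow> - f z = 0" for y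
    proof -
      have "x = y" using y x by (metis linorder_neqE_nat neg_equal_0_iff_equal)
      then show ?thesis using fx by simp
    qed
  qed (use v in auto)
  then show False using one by (simp add: sum_negf atLeastLessThanSuc_atLeastAtMost)
qed

section \<open>Trapezoids in terms of prefix sums\<close>

lemma row_cells_eq: "1 \<le> i \<Longrightarrow> i \<le> n \<Longrightarrow> row_cells n (2 * w + 3) i = {i..2 * (n + w + 1) - i}"
  by (auto simp: row_cells_def cells_def)

lemma col_cells_eq:
  "1 \<le> j \<Longrightarrow> j \<le> 2 * (n + w) + 1 \<Longrightarrow>
    col_cells n (2 * w + 3) j = {1..min n (min j (2 * (n + w + 1) - j))}"
  by (auto simp: col_cells_def cells_def)

text \<open>Alternation with leading 1 amounts to prefix sums in {0, 1}; for rows the leading 1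
  comes from the row sum. With l = 2w + 3 the axis of symmetry is column n + w + 1.\<close>

lemma as_trapezoid_iff_prefix:
  fixes n w :: nat
  defines "b \<equiv> (\<lambda>j. min n (min j (2 * (n + w + 1) - j)))"
  shows "as_trapezoid n (2 * w + 3) a \<longleftrightarrow>
    a \<in> cells n (2 * w + 3) \<rightarrow>\<^sub>E {-1, 0, 1} \<and>
    (\<forall>i\<in>{1..n}. \<forall>r\<le>Suc (2 * (n + w + 1) - i). (\<Sum>j\<in>{i..<r}. a (i, j)) \<in> {0, 1}) \<and>
    (\<forall>i\<in>{1..n}. (\<Sum>j\<in>{i..2 * (n + w + 1) - i}. a (i, j)) = 1) \<and>
    (\<forall>j\<in>{1..2 * (n + w) + 1}. \<forall>r\<le>Suc (b j). (\<Sum>i\<in>{1..<r}. a (i, j)) \<in> {0, 1}) \<and>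
    (\<forall>j\<in>{n + 1..n + 2 * w + 1}. (\<Sum>i\<in>{1..b j}. a (i, j)) = 0)"
    (is "?L \<longleftrightarrow> ?R")
proof
  note rc = row_cells_eq[where n = n and w = w]
  have cc: "col_cells n (2 * w + 3) j = {1..b j}" if "1 \<le> j" "j \<le> 2 * (n + w) + 1" for j
    using col_cells_eq[OF that] by (simp add: b_def)
  have e: "2 * n + (2 * w + 3) - 2 = 2 * (n + w) + 1" "n + (2 * w + 3) - 2 = n + 2 * w + 1" by auto
  {
    assume L: ?L
    note L' = L[unfolded as_trapezoid_def e]
    have cell: "a z \<in> {-1, 0, 1}" if "z \<in> cells n (2 * w + 3)" for z
      using PiE_mem[OF conjunct1[OF L'] that] .
    have vr: "a (i, j) \<in> {-1, 0, 1}" if "i \<in> {1..n}" "j \<in> {i..2 * (n + w + 1) - i}" for i j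
      by (rule cell) (use that in \<open>auto simp: cells_def\<close>)
    have vc: "a (i, j) \<in> {-1, 0, 1}" if "j \<in> {1..2 * (n + w) + 1}" "i \<in> {1..b j}" for i j
      by (rule cell) (use that in \<open>auto simp: cells_def b_def\<close>)
    have sum1: "(\<Sum>j\<in>{i..2 * (n + w + 1) - i}. a (i, j)) = 1" if "i \<in> {1..n}" for i
    proof -
      have "(\<Sum>j\<in>row_cells n (2 * w + 3) i. a (i, j)) = 1" using L' that by blast
      then show ?thesis using rc[of i] that by simp
    qed
    have "(\<Sum>j\<in>{i..<r}. a (i, j)) \<in> {0, 1}" if i: "i \<in> {1..n}" and r: "r \<le> Suc (2 * (n + w + 1) - i)" for i r
    proof (rule alternating_first_prefix[OF vr[OF i] _ _ r])
      have "alternating (row_cells n (2 * w + 3) i) (\<lambda>j. a (i, j))" using L' i by blast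
      then show alt: "alternating {i..2 * (n + w + 1) - i} (\<lambda>j. a (i, j))" using rc[of i] i by simp
      show "a (i, x) = 1" if "x \<in> {i..2 * (n + w + 1) - i}" "a (i, x) \<noteq> 0"
        "\<And>y. y \<in> {i..2 * (n + w + 1) - i} \<Longrightarrow> y < x \<Longrightarrow> a (i, y) = 0" for x
        by (rule alternating_sum_one_first[OF vr[OF i] alt sum1[OF i] that])
    qed
    moreover have "(\<Sum>i\<in>{1..<r}. a (i, j)) \<in> {0, 1}" if j: "j \<in> {1..2 * (n + w) + 1}" and r: "r \<le> Suc (b j)" for j r
    proof (rule alternating_first_prefix[OF vc[OF j] _ _ r])
      have cj: "col_cells n (2 * w + 3) j = {1..b j}" using j cc[of j] by auto
      show "alternating {1..b j} (\<lambda>i. a (i, j))" using L' j cj by metis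
      show "a (x, j) = 1" if x: "x \<in> {1..b j}" "a (x, j) \<noteq> 0"
        "\<And>y. y \<in> {1..b j} \<Longrightarrow> y < x \<Longrightarrow> a (y, j) = 0" for x
      proof -
        have "\<forall>i\<in>col_cells n (2 * w + 3) j. a (i, j) \<noteq> 0 \<and>
            (\<forall>k\<in>col_cells n (2 * w + 3) j. k < i \<longrightarrow> a (k, j) = 0) \<longrightarrow> a (i, j) = 1"
          using L' j by blast
        then show ?thesis unfolding cj using x by blast
      qed
    qed
    moreover have "(\<Sum>i\<in>{1..b j}. a (i, j)) = 0" if j: "j \<in> {n + 1..n + 2 * w + 1}" for j
    proof -
      have "col_sum n (2 * w + 3) a j = 0" using L' j by blast
      moreover have "col_cells n (2 * w + 3) j = {1..b j}" using j by (intro cc) auto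
      ultimately show ?thesis by (simp add: col_sum_def)
    qed
    moreover have "a \<in> cells n (2 * w + 3) \<rightarrow>\<^sub>E {-1, 0, 1}" using L' by blast
    ultimately show ?R using sum1 by blast
  next
    assume R: ?R
    then have pr: "(\<Sum>j\<in>{i..<r}. a (i, j)) \<in> {0, 1}" if "i \<in> {1..n}" "r \<le> Suc (2 * (n + w + 1) - i)" for i r
      using that by blast
    from R have pc: "(\<Sum>i\<in>{1..<r}. a (i, j)) \<in> {0, 1}" if "j \<in> {1..2 * (n + w) + 1}" "r \<le> Suc (b j)" for j r
      using that by blast
    have R5: "(\<Sum>i\<in>{1..b j}. a (i, j)) = 0" if "j \<in> {n + 1..n + 2 * w + 1}" for j using R that by blast
    show ?L unfolding as_trapezoid_def e
    proof (intro conjI ballI impI)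
      show "a \<in> cells n (2 * w + 3) \<rightarrow>\<^sub>E {-1, 0, 1}" using R by blast
      show "alternating (row_cells n (2 * w + 3) i) (\<lambda>j. a (i, j))" if "i \<in> {1..n}" for i
        using prefix_alternating_first(1)[OF pr[OF that]] rc[of i] that by simp
      show "(\<Sum>j\<in>row_cells n (2 * w + 3) i. a (i, j)) = 1" if "i \<in> {1..n}" for i
      proof -
        have "(\<Sum>j\<in>{i..2 * (n + w + 1) - i}. a (i, j)) = 1" using R that by blast
        then show ?thesis using rc[of i] that by simp
      qed
      show "alternating (col_cells n (2 * w + 3) j) (\<lambda>i. a (i, j))" if "j \<in> {1..2 * (n + w) + 1}" for j
        using prefix_alternating_first(1)[OF pc[OF that]] cc[of j] that by simp
      show "a (i, j) = 1" if j: "j \<in> {1..2 * (n + w) + 1}" and i: "i \<in> col_cells n (2 * w + 3) j"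
        and nz: "a (i, j) \<noteq> 0 \<and> (\<forall>k\<in>col_cells n (2 * w + 3) j. k < i \<longrightarrow> a (k, j) = 0)" for i j
      proof -
        have cj: "col_cells n (2 * w + 3) j = {1..b j}" using j by (intro cc) auto
        show ?thesis
          by (rule prefix_alternating_first(2)[OF pc[OF j]]) (use i nz in \<open>auto simp: cj\<close>)
      qed
      show "col_sum n (2 * w + 3) a j = 0" if j: "j \<in> {n + 1..n + 2 * w + 1}" for j
      proof -
        have cj: "col_cells n (2 * w + 3) j = {1..b j}" using j by (intro cc) auto
        show ?thesis using R5[OF j] by (simp add: col_sum_def cj)
      qed
    qed
  }
qed

text \<open>The central entries of a symmetric trapezoid are forced to be 1, -1, 1, ..., so the left
  halves of the rows sum to 0, 1, 0, .... This is the origin of the sizes i div 2.\<close>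

definition half_ok :: "nat \<Rightarrow> nat \<Rightarrow> (nat \<times> nat \<Rightarrow> int) \<Rightarrow> bool" where
  "half_ok n w a \<longleftrightarrow>
     (\<forall>i\<in>{1..n}. \<forall>r\<le>n + w + 1. (\<Sum>j\<in>{i..<r}. a (i, j)) \<in> {0, 1}) \<and>
     (\<forall>i\<in>{1..n}. (\<Sum>j\<in>{i..<n + w + 1}. a (i, j)) = of_bool (even i)) \<and>
     (\<forall>i\<in>{1..n}. a (i, n + w + 1) = 1 - 2 * of_bool (even i)) \<and>
     (\<forall>j\<in>{1..n + w}. \<forall>r\<le>Suc (min n j). (\<Sum>i\<in>{1..<r}. a (i, j)) \<in> {0, 1}) \<and>
     (\<forall>j\<in>{n + 1..n + w}. (\<Sum>i\<in>{1..n}. a (i, j)) = 0)"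

lemma sum_reflect:
  fixes f :: "nat \<Rightarrow> int"
  assumes sym: "\<And>j. i \<le> j \<Longrightarrow> j \<le> 2 * c - i \<Longrightarrow> f j = f (2 * c - j)"
    and i: "i < c" and r: "c < r" "r \<le> Suc (2 * c - i)"
  shows "(\<Sum>j\<in>{i..<r}. f j) = 2 * (\<Sum>j\<in>{i..<c}. f j) + f c - (\<Sum>j\<in>{i..<Suc (2 * c) - r}. f j)"
proof -
  have "(\<Sum>j\<in>{i..<r}. f j) = (\<Sum>j\<in>{i..<c}. f j) + (\<Sum>j\<in>{c..<r}. f j)"
    using i r by (subst sum.atLeastLessThan_concat) auto
  also have "(\<Sum>j\<in>{c..<r}. f j) = f c + (\<Sum>j\<in>{Suc c..<r}. f j)"
    using r by (simp add: sum.atLeast_Suc_lessThan)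
  also have "(\<Sum>j\<in>{Suc c..<r}. f j) = (\<Sum>j\<in>{Suc (2 * c) - r..<c}. f j)"
    by (rule sum.reindex_bij_witness[where i = "\<lambda>j. 2 * c - j" and j = "\<lambda>j. 2 * c - j"])
      (use i r in \<open>auto simp: sym[symmetric]\<close>)
  also have "(\<Sum>j\<in>{i..<c}. f j) = (\<Sum>j\<in>{i..<Suc (2 * c) - r}. f j) + (\<Sum>j\<in>{Suc (2 * c) - r..<c}. f j)"
    using i r by (subst sum.atLeastLessThan_concat) auto
  finally show ?thesis
    using \<open>(\<Sum>j\<in>{i..<c}. f j) = (\<Sum>j\<in>{i..<Suc (2 * c) - r}. f j) + (\<Sum>j\<in>{Suc (2 * c) - r..<c}. f j)\<close>
    by simp
qed

lemma symmetric_trapezoid_iff_half: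
  assumes n: "even n" and a: "a \<in> cells n (2 * w + 3) \<rightarrow>\<^sub>E {-1, 0, 1}"
    and vs: "vertically_symmetric n (2 * w + 3) a"
  shows "as_trapezoid n (2 * w + 3) a \<longleftrightarrow> half_ok n w a"
proof -
  define c where "c = n + w + 1"
  define b where "b j = min n (min j (2 * c - j))" for j
  have c2: "2 * n + (2 * w + 3) - 1 = 2 * c" "2 * (n + w) + 1 = 2 * c - 1" by (auto simp: c_def)
  have sym: "a (i, j) = a (i, 2 * c - j)" if "1 \<le> i" "i \<le> n" "i \<le> j" "j \<le> 2 * c - i" for i j
  proof -
    have "(i, j) \<in> cells n (2 * w + 3)" using that by (auto simp: cells_def c_def)
    from bspec[OF vs[unfolded vertically_symmetric_def c2] this] show ?thesis
      by (simp only: split_conv)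
  qed
  have refl: "(\<Sum>j\<in>{i..<r}. a (i, j)) = 2 * (\<Sum>j\<in>{i..<c}. a (i, j)) + a (i, c) - (\<Sum>j\<in>{i..<Suc (2 * c) - r}. a (i, j))"
    if "i \<in> {1..n}" "c < r" "r \<le> Suc (2 * c - i)" for i r
  proof (rule sum_reflect)
    show "a (i, j) = a (i, 2 * c - j)" if "i \<le> j" "j \<le> 2 * c - i" for j
      by (rule sym) (use that \<open>i \<in> {1..n}\<close> in auto)
  qed (use that in \<open>simp_all add: c_def\<close>)
  have total: "(\<Sum>j\<in>{i..2 * c - i}. a (i, j)) = 2 * (\<Sum>j\<in>{i..<c}. a (i, j)) + a (i, c)" if i: "i \<in> {1..n}" for i
  proof -
    have "c < Suc (2 * c - i)" using i by (auto simp: c_def)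
    moreover have "Suc (2 * c) - Suc (2 * c - i) = i" using i by (auto simp: c_def)
    ultimately show ?thesis
      using refl[OF i, of "Suc (2 * c - i)"] by (simp add: atLeastLessThanSuc_atLeastAtMost)
  qed
  have b1: "b j = min n j" if "j \<le> c" for j using that by (auto simp: b_def)
  have b2: "b (2 * c - j) = b j" if "j \<le> 2 * c" for j using that by (auto simp: b_def)
  have bc: "b c = n" by (auto simp: b_def c_def)
  have colsym: "a (i, j) = a (i, 2 * c - j)" if "1 \<le> i" "i \<le> b j" "1 \<le> j" "j \<le> 2 * c" for i j
    by (rule sym) (use that in \<open>auto simp: b_def\<close>)
  have iff: "as_trapezoid n (2 * w + 3) a \<longleftrightarrow>
    (\<forall>i\<in>{1..n}. \<forall>r\<le>Suc (2 * c - i). (\<Sum>j\<in>{i..<r}. a (i, j)) \<in> {0, 1}) \<and>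
    (\<forall>i\<in>{1..n}. (\<Sum>j\<in>{i..2 * c - i}. a (i, j)) = 1) \<and>
    (\<forall>j\<in>{1..2 * c - 1}. \<forall>r\<le>Suc (b j). (\<Sum>i\<in>{1..<r}. a (i, j)) \<in> {0, 1}) \<and>
    (\<forall>j\<in>{n + 1..n + 2 * w + 1}. (\<Sum>i\<in>{1..b j}. a (i, j)) = 0)"
    using as_trapezoid_iff_prefix[of n w a] a unfolding c2 b_def c_def by blast
  have hok: "half_ok n w a \<longleftrightarrow>
     (\<forall>i\<in>{1..n}. \<forall>r\<le>c. (\<Sum>j\<in>{i..<r}. a (i, j)) \<in> {0, 1}) \<and>
     (\<forall>i\<in>{1..n}. (\<Sum>j\<in>{i..<c}. a (i, j)) = of_bool (even i)) \<and>
     (\<forall>i\<in>{1..n}. a (i, c) = 1 - 2 * of_bool (even i)) \<and>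
     (\<forall>j\<in>{1..n + w}. \<forall>r\<le>Suc (min n j). (\<Sum>i\<in>{1..<r}. a (i, j)) \<in> {0, 1}) \<and>
     (\<forall>j\<in>{n + 1..n + w}. (\<Sum>i\<in>{1..n}. a (i, j)) = 0)"
    unfolding half_ok_def c_def ..
  show ?thesis
  proof
    assume L: "as_trapezoid n (2 * w + 3) a"
    have pr: "(\<Sum>j\<in>{i..<r}. a (i, j)) \<in> {0, 1}" if "i \<in> {1..n}" "r \<le> Suc (2 * c - i)" for i r
      using L that unfolding iff by blast
    have one: "2 * (\<Sum>j\<in>{i..<c}. a (i, j)) + a (i, c) = 1" if "i \<in> {1..n}" for i
      using L that total[OF that] unfolding iff by force
    have pc: "(\<Sum>i\<in>{1..<r}. a (i, j)) \<in> {0, 1}" if "j \<in> {1..2 * c - 1}" "r \<le> Suc (b j)" for j r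
      using L that unfolding iff by blast
    have z: "(\<Sum>i\<in>{1..b j}. a (i, j)) = 0" if "j \<in> {n + 1..n + 2 * w + 1}" for j
      using L that unfolding iff by blast
    \<comment> \<open>The row sum 1 is twice a number in {0, 1} plus the central entry.\<close>
    have pm: "a (i, c) = 1 \<or> a (i, c) = -1" if i: "i \<in> {1..n}" for i
    proof -
      have "c \<le> Suc (2 * c - i)" using i by (auto simp: c_def)
      from one[OF i] pr[OF i this] show ?thesis by auto
    qed
    \<comment> \<open>No central entry is 0, so the prefix sums of the central column, being 0 or 1,
      must alternate.\<close>
    have cen: "r \<le> n \<Longrightarrow> (\<Sum>i\<in>{1..<Suc r}. a (i, c)) = of_bool (odd r)" for r
    proof (induction r)
      case (Suc r)
      have "(\<Sum>i\<in>{1..<Suc (Suc r)}. a (i, c)) = of_bool (odd r) + a (Suc r, c)"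
        using Suc by simp
      moreover have "(\<Sum>i\<in>{1..<Suc (Suc r)}. a (i, c)) \<in> {0, 1}"
        by (rule pc) (use Suc.prems bc in \<open>auto simp: c_def\<close>)
      ultimately show ?case using pm[of "Suc r"] Suc.prems by (cases "odd r") auto
    qed simp
    have ctr: "a (i, c) = 1 - 2 * of_bool (even i)" if i: "i \<in> {1..n}" for i
    proof -
      obtain r where r: "i = Suc r" using i by (cases i) auto
      have "(\<Sum>i\<in>{1..<Suc (Suc r)}. a (i, c)) = (\<Sum>i\<in>{1..<Suc r}. a (i, c)) + a (Suc r, c)" by simp
      then show ?thesis using cen[of r] cen[of "Suc r"] i by (auto simp: r)
    qed
    show "half_ok n w a"
      unfolding hok
    proof (intro conjI ballI allI impI)
      show "(\<Sum>j\<in>{i..<r}. a (i, j)) \<in> {0, 1}" if "i \<in> {1..n}" "r \<le> c" for i r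
        by (rule pr) (use that in \<open>auto simp: c_def\<close>)
      show "(\<Sum>j\<in>{i..<c}. a (i, j)) = of_bool (even i)" if "i \<in> {1..n}" for i
        using one[OF that] ctr[OF that] by simp
      show "a (i, c) = 1 - 2 * of_bool (even i)" if "i \<in> {1..n}" for i by (rule ctr[OF that])
      show "(\<Sum>i\<in>{1..<r}. a (i, j)) \<in> {0, 1}" if "j \<in> {1..n + w}" "r \<le> Suc (min n j)" for j r
        by (rule pc) (use that b1[of j] in \<open>auto simp: c_def\<close>)
      show "(\<Sum>i\<in>{1..n}. a (i, j)) = 0" if "j \<in> {n + 1..n + w}" for j
      proof -
        have "b j = n" using that b1[of j] by (auto simp: c_def)
        then show ?thesis using z[of j] that by auto
      qed
    qed
  next
    assume H: "half_ok n w a"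
    have pr: "(\<Sum>j\<in>{i..<r}. a (i, j)) \<in> {0, 1}" if "i \<in> {1..n}" "r \<le> c" for i r
      using H that unfolding hok by blast
    have hs: "(\<Sum>j\<in>{i..<c}. a (i, j)) = of_bool (even i)" if "i \<in> {1..n}" for i
      using H that unfolding hok by blast
    have ctr: "a (i, c) = 1 - 2 * of_bool (even i)" if "i \<in> {1..n}" for i
      using H that unfolding hok by blast
    have pc: "(\<Sum>i\<in>{1..<r}. a (i, j)) \<in> {0, 1}" if "j \<in> {1..n + w}" "r \<le> Suc (min n j)" for j r
      using H that unfolding hok by blast
    have z: "(\<Sum>i\<in>{1..n}. a (i, j)) = 0" if "j \<in> {n + 1..n + w}" for j
      using H that unfolding hok by blast
    have cen: "r \<le> n \<Longrightarrow> (\<Sum>i\<in>{1..<Suc r}. a (i, c)) = of_bool (odd r)" for r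
      by (induction r) (auto simp: ctr)
    have csym: "(\<Sum>i\<in>{1..<r}. a (i, j)) = (\<Sum>i\<in>{1..<r}. a (i, 2 * c - j))"
      if "1 \<le> j" "j \<le> 2 * c" "r \<le> Suc (b j)" for j r
      by (intro sum.cong refl colsym) (use that in auto)
    show "as_trapezoid n (2 * w + 3) a"
      unfolding iff
    proof (intro conjI ballI allI impI)
      show "(\<Sum>j\<in>{i..2 * c - i}. a (i, j)) = 1" if "i \<in> {1..n}" for i
        using total[OF that] hs[OF that] ctr[OF that] by simp
      show "(\<Sum>j\<in>{i..<r}. a (i, j)) \<in> {0, 1}" if i: "i \<in> {1..n}" and r: "r \<le> Suc (2 * c - i)" for i r
      proof (cases "r \<le> c")
        \<comment> \<open>By symmetry, a prefix reaching beyond the centre has sum 1 minus that of a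
          shorter prefix.\<close>
        case False
        then have "(\<Sum>j\<in>{i..<r}. a (i, j)) = 1 - (\<Sum>j\<in>{i..<Suc (2 * c) - r}. a (i, j))"
          using refl[OF i _ r] hs[OF i] ctr[OF i] by simp
        moreover have "(\<Sum>j\<in>{i..<Suc (2 * c) - r}. a (i, j)) \<in> {0, 1}"
          by (rule pr[OF i]) (use False in simp)
        ultimately show ?thesis by auto
      qed (use pr i in blast)
      show "(\<Sum>i\<in>{1..<r}. a (i, j)) \<in> {0, 1}" if j: "j \<in> {1..2 * c - 1}" and r: "r \<le> Suc (b j)" for j r
      proof -
        consider "j < c" | "j = c" | "c < j" by linarith
        then show ?thesis
        proof cases
          case 1
          then show ?thesis using pc[of j r] j r b1[of j] by (auto simp: c_def)
        next
          case 2
          then show ?thesis using cen[of "r - 1"] r bc by (cases r) auto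
        next
          case 3
          have "(\<Sum>i\<in>{1..<r}. a (i, 2 * c - j)) \<in> {0, 1}"
            by (rule pc) (use 3 j r b1[of "2 * c - j"] b2[of j] in \<open>auto simp: c_def\<close>)
          moreover have "(\<Sum>i\<in>{1..<r}. a (i, j)) = (\<Sum>i\<in>{1..<r}. a (i, 2 * c - j))"
            by (rule csym) (use j r in auto)
          ultimately show ?thesis by simp
        qed
      qed
      show "(\<Sum>i\<in>{1..b j}. a (i, j)) = 0" if j: "j \<in> {n + 1..n + 2 * w + 1}" for j
      proof -
        consider "j < c" | "j = c" | "c < j" by linarith
        then show ?thesis
        proof cases
          case 1
          then show ?thesis using z[of j] b1[of j] j by (auto simp: c_def)
        next
          \<comment> \<open>The central column must have sum 0, and does so because n is
            even.\<close>
          case 2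
          then show ?thesis using cen[of n] n bc by (simp add: atLeastLessThanSuc_atLeastAtMost)
        next
          case 3
          then have "2 * c - j \<in> {n + 1..n + w}" using j by (auto simp: c_def)
          moreover from this have "b j = n" using b1[of "2 * c - j"] b2[of j] j by (auto simp: c_def)
          ultimately show ?thesis
            using z[of "2 * c - j"] csym[of j "Suc n"] j
            by (auto simp: atLeastLessThanSuc_atLeastAtMost c_def)
        qed
      qed
    qed
  qed
qed

subsection \<open>Trapezoids as sequences of interlacing sets\<close>

definition paths :: "nat \<Rightarrow> int \<Rightarrow> int set \<Rightarrow> nat \<Rightarrow> int set \<Rightarrow> (nat \<Rightarrow> int set) set" where
  "paths n h C i S = {T \<in> {..i} \<rightarrow>\<^sub>E UNIV. T i = S \<and> (\<forall>j<i. T j \<in> preds n h C (Suc j) (T (Suc j)))}"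

lemma preds_good:
  assumes "S' \<in> preds n h C (Suc i) S"
  shows "finite S'" "card S' = i div 2" "\<And>x. x \<in> S' \<Longrightarrow> x < h"
  using assms by (auto simp: preds_def il_sets_def Let_def)

lemma finite_preds:
  assumes "finite S" "card S = Suc i div 2" "\<And>x. x \<in> S \<Longrightarrow> x < h"
  shows "finite (preds n h C (Suc i) S)"
proof -
  obtain e where e: "strict_mono_on {1..Suc i div 2} e" "e ` {1..Suc i div 2} = S"
    using strict_mono_on_enumeration[OF assms(1)] assms(2) by auto
  have "finite (il_sets (e ` {1..Suc i div 2}) (i div 2) h (int (Suc i) - int n - 1))"
    by (rule finite_il_sets[OF e(1)]) (use e assms in auto)
  then show ?thesis
    unfolding e(2) by (rule finite_subset[rotated]) (auto simp: preds_def Let_def)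
qed

lemma paths_Suc:
  "bij_betw (\<lambda>(S', T). T(Suc i := S)) (SIGMA S':preds n h C (Suc i) S. paths n h C i S') (paths n h C (Suc i) S)"
proof (rule bij_betw_byWitness[where f' = "\<lambda>T. (T i, T(Suc i := undefined))"])
  show "\<forall>z\<in>SIGMA S':preds n h C (Suc i) S. paths n h C i S'.
      (\<lambda>T. (T i, T(Suc i := undefined))) ((\<lambda>(S', T). T(Suc i := S)) z) = z"
  proof
    fix z assume z: "z \<in> (SIGMA S':preds n h C (Suc i) S. paths n h C i S')"
    obtain S' T where ST: "z = (S', T)" by (cases z)
    have "T (Suc i) = undefined" "T i = S'"
      using z by (auto simp: ST paths_def PiE_def extensional_def)
    then have "T(Suc i := undefined) = T" by (intro fun_upd_idem)
    then show "(\<lambda>T. (T i, T(Suc i := undefined))) ((\<lambda>(S', T). T(Suc i := S)) z) = z"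
      using \<open>T i = S'\<close> by (simp add: ST)
  qed
  show "\<forall>T\<in>paths n h C (Suc i) S. (\<lambda>(S', T). T(Suc i := S)) (T i, T(Suc i := undefined)) = T"
    by (auto simp: paths_def intro: fun_upd_idem)
  show "(\<lambda>(S', T). T(Suc i := S)) ` (SIGMA S':preds n h C (Suc i) S. paths n h C i S') \<subseteq> paths n h C (Suc i) S"
  proof
    fix T' assume "T' \<in> (\<lambda>(S', T). T(Suc i := S)) ` (SIGMA S':preds n h C (Suc i) S. paths n h C i S')"
    then obtain T where T': "T' = T(Suc i := S)" and T: "T i \<in> preds n h C (Suc i) S" "T \<in> paths n h C i (T i)"
      by (auto simp: paths_def)
    have "T' \<in> {..Suc i} \<rightarrow>\<^sub>E UNIV" using T(2) by (auto simp: T' paths_def PiE_def extensional_def)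
    moreover have "T' j \<in> preds n h C (Suc j) (T' (Suc j))" if "j < Suc i" for j
      using that T by (cases "j = i") (auto simp: T' paths_def)
    ultimately show "T' \<in> paths n h C (Suc i) S" by (simp add: paths_def T')
  qed
  show "(\<lambda>T. (T i, T(Suc i := undefined))) ` paths n h C (Suc i) S \<subseteq>
      (SIGMA S':preds n h C (Suc i) S. paths n h C i S')"
  proof
    fix z assume "z \<in> (\<lambda>T. (T i, T(Suc i := undefined))) ` paths n h C (Suc i) S"
    then obtain T where z: "z = (T i, T(Suc i := undefined))" and T: "T \<in> paths n h C (Suc i) S" by auto
    have st: "T j \<in> preds n h C (Suc j) (T (Suc j))" if "j < Suc i" for j using T that by (simp add: paths_def)
    have "T(Suc i := undefined) \<in> {..i} \<rightarrow>\<^sub>E UNIV"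
      using T by (auto simp: paths_def PiE_def extensional_def)
    moreover have "T i \<in> preds n h C (Suc i) S" using st[of i] T by (simp add: paths_def)
    ultimately show "z \<in> (SIGMA S':preds n h C (Suc i) S. paths n h C i S')"
      using st by (simp add: z paths_def)
  qed
qed

lemma finite_paths:
  assumes "finite S" "card S = i div 2" "\<And>x. x \<in> S \<Longrightarrow> x < h"
  shows "finite (paths n h C i S)"
  using assms
proof (induction i arbitrary: S)
  case 0
  have "paths n h C 0 S \<subseteq> {\<lambda>j. if j = 0 then S else undefined}"
    by (auto simp: paths_def PiE_def extensional_def fun_eq_iff)
  then show ?case using finite_subset by blast
next
  case (Suc i)
  have "finite (SIGMA S':preds n h C (Suc i) S. paths n h C i S')"
    by (intro finite_SigmaI finite_preds Suc.prems Suc.IH preds_good) auto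
  then show ?case using bij_betw_finite[OF paths_Suc] by blast
qed

lemma wsum_eq_sum_paths:
  assumes "finite S" "card S = i div 2" "\<And>x. x \<in> S \<Longrightarrow> x < h"
  shows "wsum Q n h C i S = (\<Sum>T\<in>paths n h C i S. Q ^ (\<Sum>j<i. card (T j - T (Suc j))))"
  using assms
proof (induction i arbitrary: S)
  case 0
  have "paths n h C 0 S = {\<lambda>j. if j = 0 then S else undefined}"
    by (auto simp: paths_def PiE_def extensional_def fun_eq_iff)
  then show ?case by simp
next
  case (Suc i)
  have "wsum Q n h C (Suc i) S = (\<Sum>S'\<in>preds n h C (Suc i) S. \<Sum>T\<in>paths n h C i S'.
      Q ^ card (S' - S) * Q ^ (\<Sum>j<i. card (T j - T (Suc j))))"
    unfolding wsum.simps
  proof (intro sum.cong refl)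
    fix S' assume S': "S' \<in> preds n h C (Suc i) S"
    have "wsum Q n h C i S' = (\<Sum>T\<in>paths n h C i S'. Q ^ (\<Sum>j<i. card (T j - T (Suc j))))"
      by (rule Suc.IH) (use preds_good[OF S'] in auto)
    then show "Q ^ card (S' - S) * wsum Q n h C i S' = (\<Sum>T\<in>paths n h C i S'.
      Q ^ card (S' - S) * Q ^ (\<Sum>j<i. card (T j - T (Suc j))))"
      by (simp add: sum_distrib_left)
  qed
  also have "\<dots> = (\<Sum>(S', T)\<in>(SIGMA S':preds n h C (Suc i) S. paths n h C i S').
      Q ^ card (S' - S) * Q ^ (\<Sum>j<i. card (T j - T (Suc j))))"
  proof (rule sum.Sigma)
    show "finite (preds n h C (Suc i) S)" by (rule finite_preds[OF Suc.prems])
    show "\<forall>S'\<in>preds n h C (Suc i) S. finite (paths n h C i S')"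
      by (intro ballI finite_paths) (auto dest: preds_good)
  qed
  also have "\<dots> = (\<Sum>z\<in>(SIGMA S':preds n h C (Suc i) S. paths n h C i S').
      (\<lambda>T. Q ^ (\<Sum>j<Suc i. card (T j - T (Suc j)))) ((\<lambda>(S', T). T(Suc i := S)) z))"
  proof (intro sum.cong refl)
    fix z assume "z \<in> (SIGMA S':preds n h C (Suc i) S. paths n h C i S')"
    then obtain S' T where z: "z = (S', T)" "T i = S'" by (auto simp: paths_def)
    have "(\<Sum>j<i. card ((T(Suc i := S)) j - (T(Suc i := S)) (Suc j))) = (\<Sum>j<i. card (T j - T (Suc j)))"
      by (intro sum.cong) auto
    then show "(case z of (S', T) \<Rightarrow> Q ^ card (S' - S) * Q ^ (\<Sum>j<i. card (T j - T (Suc j)))) =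
      (\<lambda>T. Q ^ (\<Sum>j<Suc i. card (T j - T (Suc j)))) ((\<lambda>(S', T). T(Suc i := S)) z)"
      using z by (simp add: power_add mult.commute)
  qed
  also have "\<dots> = (\<Sum>T\<in>paths n h C (Suc i) S. Q ^ (\<Sum>j<Suc i. card (T j - T (Suc j))))"
    by (rule sum.reindex_bij_betw[OF paths_Suc])
  finally show ?case .
qed

section \<open>Column numbers and counting functions\<close>

definition colnum :: "nat \<Rightarrow> nat \<Rightarrow> int" where
  "colnum n j = int j - int n - 1"

lemma colnum_column [simp]: "- int n \<le> x \<Longrightarrow> colnum n (column_numbered n x) = x"
  by (simp add: colnum_def column_numbered_def)

lemma column_colnum [simp]: "column_numbered n (colnum n j) = j"
  by (simp add: colnum_def column_numbered_def)

lemma column_range: "x \<in> {- int n..<int w} \<Longrightarrow> column_numbered n x \<in> {1..n + w}"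
  by (auto simp: column_numbered_def)

lemma colnum_range: "j \<in> {1..n + w} \<Longrightarrow> colnum n j \<in> {- int n..<int w}"
  by (auto simp: colnum_def)

lemma cnt_columns:
  assumes S: "S \<subseteq> {- int n..<int w}" and r: "r \<le> n + w + 1"
  shows "int (cnt S (colnum n r - 1)) = (\<Sum>j\<in>{1..<r}. of_bool (colnum n j \<in> S))"
proof -
  have "{s \<in> S. s \<le> colnum n r - 1} = colnum n ` {j \<in> {1..<r}. colnum n j \<in> S}"
  proof
    show "{s \<in> S. s \<le> colnum n r - 1} \<subseteq> colnum n ` {j \<in> {1..<r}. colnum n j \<in> S}"
    proof
      fix s assume s: "s \<in> {s \<in> S. s \<le> colnum n r - 1}"
      have "s = colnum n (column_numbered n s)" using s S by auto
      moreover have "column_numbered n s \<in> {1..<r}"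
      proof -
        have "- int n \<le> s" "s \<le> colnum n r - 1" using s S by auto
        then show ?thesis by (auto simp: column_numbered_def colnum_def)
      qed
      ultimately show "s \<in> colnum n ` {j \<in> {1..<r}. colnum n j \<in> S}" using s by auto
    qed
  qed (auto simp: colnum_def)
  moreover have "inj_on (colnum n) A" for A by (auto simp: inj_on_def colnum_def)
  ultimately have "cnt S (colnum n r - 1) = card {j \<in> {1..<r}. colnum n j \<in> S}"
    by (simp add: cnt_def card_image)
  then show ?thesis by (simp add: Int_def)
qed

text \<open>The counting functions jump only at numbers of columns in the range, so finitely many
  prefixes decide the condition for all integers.\<close>

lemma interlaces_columns:
  assumes S: "S \<subseteq> {- int n..<int w}" "S' \<subseteq> {- int n..<int w}"
  shows "interlaces S S' \<longleftrightarrow> (\<forall>r\<in>{1..n + w + 1}.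
    (\<Sum>j\<in>{1..<r}. of_bool (colnum n j \<in> S) - of_bool (colnum n j \<in> S') :: int) \<in> {0, 1})"
proof -
  have eq: "(\<Sum>j\<in>{1..<r}. of_bool (colnum n j \<in> S) - of_bool (colnum n j \<in> S') :: int) =
      int (cnt S (colnum n r - 1)) - int (cnt S' (colnum n r - 1))" if "r \<in> {1..n + w + 1}" for r
    using that S by (simp add: cnt_columns[where w = w] sum_subtractf)
  have dom: "\<exists>r\<in>{1..n + w + 1}. \<forall>A. A \<subseteq> {- int n..<int w} \<longrightarrow> cnt A x = cnt A (colnum n r - 1)" for x
  proof -
    consider "x < - int n" | "x \<in> {- int n..<int w}" | "int w \<le> x" by force
    then show ?thesis
    proof cases
      case 1
      have "cnt A x = cnt A (colnum n 1 - 1)" if "A \<subseteq> {- int n..<int w}" for A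
      proof -
        have "{s \<in> A. s \<le> x} = {}" "{s \<in> A. s \<le> colnum n 1 - 1} = {}"
          using that 1 by (auto simp: colnum_def)
        then show ?thesis unfolding cnt_def by (simp only:)
      qed
      then show ?thesis by (intro bexI[of _ 1]) auto
    next
      case 2
      have "colnum n (Suc (column_numbered n x)) - 1 = x" using 2 by (simp add: colnum_def column_numbered_def)
      then show ?thesis using column_range[OF 2] by (intro bexI[of _ "Suc (column_numbered n x)"]) auto
    next
      case 3
      have "cnt A x = cnt A (colnum n (n + w + 1) - 1)" if "A \<subseteq> {- int n..<int w}" for A
      proof -
        have "{s \<in> A. s \<le> x} = A" "{s \<in> A. s \<le> colnum n (n + w + 1) - 1} = A"
          using that 3 by (auto simp: colnum_def)
        then show ?thesis unfolding cnt_def by (simp only:)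
      qed
      then show ?thesis by (intro bexI[of _ "n + w + 1"]) auto
    qed
  qed
  show ?thesis
  proof
    assume L: "interlaces S S'"
    show "\<forall>r\<in>{1..n + w + 1}.
      (\<Sum>j\<in>{1..<r}. of_bool (colnum n j \<in> S) - of_bool (colnum n j \<in> S') :: int) \<in> {0, 1}"
    proof
      fix r assume r: "r \<in> {1..n + w + 1}"
      have "cnt S' (colnum n r - 1) \<le> cnt S (colnum n r - 1)" "cnt S (colnum n r - 1) \<le> cnt S' (colnum n r - 1) + 1"
        using L by (auto simp: interlaces_def)
      then show "(\<Sum>j\<in>{1..<r}. of_bool (colnum n j \<in> S) - of_bool (colnum n j \<in> S') :: int) \<in> {0, 1}"
        unfolding eq[OF r] by auto
    qed
  next
    assume R: "\<forall>r\<in>{1..n + w + 1}.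
      (\<Sum>j\<in>{1..<r}. of_bool (colnum n j \<in> S) - of_bool (colnum n j \<in> S') :: int) \<in> {0, 1}"
    show "interlaces S S'"
      unfolding interlaces_def
    proof
      fix x
      obtain r where r: "r \<in> {1..n + w + 1}" and
        *: "\<And>A. A \<subseteq> {- int n..<int w} \<Longrightarrow> cnt A x = cnt A (colnum n r - 1)" using dom by blast
      have "int (cnt S (colnum n r - 1)) - int (cnt S' (colnum n r - 1)) \<in> {0, 1}"
        using R r unfolding eq[OF r, symmetric] by blast
      then show "cnt S' x \<le> cnt S x \<and> cnt S x \<le> cnt S' x + 1"
        using *[OF S(1)] *[OF S(2)] by auto
    qed
  qed
qed

lemma card_columns:
  assumes S: "S \<subseteq> {- int n..<int w}"
  shows "int (card S) = (\<Sum>j\<in>{1..<n + w + 1}. of_bool (colnum n j \<in> S))"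
proof -
  have "{s \<in> S. s \<le> colnum n (n + w + 1) - 1} = S" using S by (auto simp: colnum_def)
  then show ?thesis using cnt_columns[OF S, of "n + w + 1"] by (simp add: cnt_def)
qed

text \<open>The relation between an array and its sequence of sets, shared by both directions of the
  bijection. It covers the cells left of the centre; the central column and the right half are
  determined separately.\<close>

locale seq_array =
  fixes n w :: nat and a :: "nat \<times> nat \<Rightarrow> int" and T :: "nat \<Rightarrow> int set"
  assumes key: "\<And>i j. 1 \<le> i \<Longrightarrow> i \<le> n \<Longrightarrow> i \<le> j \<Longrightarrow> j \<le> n + w \<Longrightarrow>
      a (i, j) = of_bool (colnum n j \<in> T i) - of_bool (colnum n j \<in> T (i - 1))"
    and frozen: "\<And>i x. i < n \<Longrightarrow> x < int i - int n \<Longrightarrow> x \<in> T (Suc i) \<longleftrightarrow> x \<in> T i"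
    and T0: "T 0 = {}"
    and sub: "\<And>i. i \<le> n \<Longrightarrow> T i \<subseteq> {- int n..<int w}"
begin

lemma column_prefix:
  assumes "j \<in> {1..n + w}" "r \<le> min n j"
  shows "(\<Sum>i\<in>{1..<Suc r}. a (i, j)) = of_bool (colnum n j \<in> T r)"
  using assms(2)
proof (induction r)
  case 0
  then show ?case by (simp add: T0)
next
  case (Suc r)
  have "(\<Sum>i\<in>{1..<Suc (Suc r)}. a (i, j)) = (\<Sum>i\<in>{1..<Suc r}. a (i, j)) + a (Suc r, j)" by simp
  also have "\<dots> = of_bool (colnum n j \<in> T (Suc r))"
    using Suc assms(1) key[of "Suc r" j] by simp
  finally show ?case .
qed

lemma frozen_column:
  assumes "j \<le> i" "i \<le> n"
  shows "colnum n j \<in> T i \<longleftrightarrow> colnum n j \<in> T j"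
  using assms
proof (induction i rule: dec_induct)
  case (step i)
  then show ?case using frozen[of i "colnum n j"] by (simp add: colnum_def)
qed simp

text \<open>Columns j < i have ended before row i and contribute 0, so the sum may start at 1 and
  becomes a difference of counting functions.\<close>

lemma row_prefix:
  assumes i: "i \<in> {1..n}" and r: "r \<le> n + w + 1"
  shows "(\<Sum>j\<in>{i..<r}. a (i, j)) =
    (\<Sum>j\<in>{1..<r}. of_bool (colnum n j \<in> T i) - of_bool (colnum n j \<in> T (i - 1)))"
proof -
  have "(\<Sum>j\<in>{i..<r}. a (i, j)) = (\<Sum>j\<in>{i..<r}. of_bool (colnum n j \<in> T i) - of_bool (colnum n j \<in> T (i - 1)))"
    using i r by (intro sum.cong refl key) auto
  also have "\<dots> = (\<Sum>j\<in>{1..<r}. of_bool (colnum n j \<in> T i) - of_bool (colnum n j \<in> T (i - 1)))"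
  proof (rule sum.mono_neutral_left)
    show "\<forall>j\<in>{1..<r} - {i..<r}. of_bool (colnum n j \<in> T i) - of_bool (colnum n j \<in> T (i - 1)) = (0 :: int)"
    proof
      fix j assume "j \<in> {1..<r} - {i..<r}"
      then have "colnum n j < int (i - 1) - int n" "i - 1 < n" "Suc (i - 1) = i" using i by (auto simp: colnum_def)
      then show "of_bool (colnum n j \<in> T i) - of_bool (colnum n j \<in> T (i - 1)) = (0 :: int)"
        using frozen[of "i - 1" "colnum n j"] by simp
    qed
  qed (use i in auto)
  finally show ?thesis .
qed

text \<open>Row prefixes give interlacing, half row sums the sizes, and the columns with sum 0 the
  negativity of \<open>T n\<close>. Column prefix sums are indicators, hence always 0 or 1.\<close>

lemma half_ok_iff:
  assumes ctr: "\<And>i. i \<in> {1..n} \<Longrightarrow> a (i, n + w + 1) = 1 - 2 * of_bool (even i)"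
  shows "half_ok n w a \<longleftrightarrow> (\<forall>i<n. interlaces (T (Suc i)) (T i)) \<and> (\<forall>i\<le>n. card (T i) = i div 2) \<and>
    (\<forall>x\<in>T n. x < 0)"
proof
  assume H: "half_ok n w a"
  have "interlaces (T (Suc i)) (T i)" if "i < n" for i
  proof -
    have "(\<Sum>j\<in>{1..<r}. of_bool (colnum n j \<in> T (Suc i)) - of_bool (colnum n j \<in> T i) :: int) \<in> {0, 1}"
      if r: "r \<in> {1..n + w + 1}" for r
    proof -
      have "(\<Sum>j\<in>{Suc i..<r}. a (Suc i, j)) \<in> {0, 1}"
        using H \<open>i < n\<close> r unfolding half_ok_def by auto
      then show ?thesis using row_prefix[of "Suc i" r] \<open>i < n\<close> r by simp
    qed
    then show ?thesis using interlaces_columns[of "T (Suc i)" n w "T i"] sub that by simp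
  qed
  moreover have "i \<le> n \<Longrightarrow> card (T i) = i div 2" for i
  proof (induction i)
    case (Suc i)
    have "(\<Sum>j\<in>{Suc i..<n + w + 1}. a (Suc i, j)) = of_bool (even (Suc i))"
      using H Suc.prems unfolding half_ok_def by auto
    then have "int (card (T (Suc i))) - int (card (T i)) = of_bool (even (Suc i))"
      using row_prefix[of "Suc i" "n + w + 1"] Suc.prems card_columns[OF sub, of "Suc i"] card_columns[OF sub, of i]
      by (simp add: sum_subtractf)
    then show ?case using Suc by (cases "even i") (auto elim!: evenE oddE)
  qed (simp add: T0)
  moreover have "x < 0" if "x \<in> T n" for x
  proof (rule ccontr)
    assume "\<not> x < 0"
    define j where "j = column_numbered n x"
    have xr: "x \<in> {- int n..<int w}" using that sub[of n] by auto
    then have j: "j \<in> {1..n + w}" "colnum n j = x" using column_range[OF xr] by (auto simp: j_def)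
    have "j \<in> {n + 1..n + w}" using j \<open>\<not> x < 0\<close> by (auto simp: colnum_def)
    then have "(\<Sum>i\<in>{1..n}. a (i, j)) = 0" using H unfolding half_ok_def by blast
    moreover have "(\<Sum>i\<in>{1..<Suc n}. a (i, j)) = of_bool (colnum n j \<in> T n)"
      by (rule column_prefix) (use j \<open>j \<in> {n + 1..n + w}\<close> in auto)
    ultimately show False using that j(2) by (simp add: atLeastLessThanSuc_atLeastAtMost)
  qed
  ultimately show "(\<forall>i<n. interlaces (T (Suc i)) (T i)) \<and> (\<forall>i\<le>n. card (T i) = i div 2) \<and> (\<forall>x\<in>T n. x < 0)"
    by blast
next
  assume R: "(\<forall>i<n. interlaces (T (Suc i)) (T i)) \<and> (\<forall>i\<le>n. card (T i) = i div 2) \<and> (\<forall>x\<in>T n. x < 0)"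
  show "half_ok n w a" unfolding half_ok_def
  proof (intro conjI ballI allI impI)
    show "(\<Sum>j\<in>{i..<r}. a (i, j)) \<in> {0, 1}" if i: "i \<in> {1..n}" and r: "r \<le> n + w + 1" for i r
    proof (cases "r = 0")
      case False
      have i1: "Suc (i - 1) = i" "i - 1 < n" using i by auto
      have il: "interlaces (T i) (T (i - 1))" using R i1 by metis
      have "i \<le> n" "i - 1 \<le> n" using i by auto
      from il[unfolded interlaces_columns[OF sub[OF this(1)] sub[OF this(2)]]]
      show ?thesis using False r unfolding row_prefix[OF i r] by auto
    qed simp
    show "(\<Sum>j\<in>{i..<n + w + 1}. a (i, j)) = of_bool (even i)" if i: "i \<in> {1..n}" for i
    proof -
      have "i \<le> n" "i - 1 \<le> n" using i by auto
      note s = sub[OF this(1)] sub[OF this(2)]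
      have "(\<Sum>j\<in>{i..<n + w + 1}. a (i, j)) = int (card (T i)) - int (card (T (i - 1)))"
        using row_prefix[OF i, of "n + w + 1"] card_columns[OF s(1)] card_columns[OF s(2)]
        by (simp add: sum_subtractf)
      also have "\<dots> = int (i div 2) - int ((i - 1) div 2)" using R i by auto
      also have "\<dots> = of_bool (even i)" using i by (cases "even i") (auto elim!: evenE oddE)
      finally show ?thesis .
    qed
    show "a (i, n + w + 1) = 1 - 2 * of_bool (even i)" if "i \<in> {1..n}" for i using ctr[OF that] .
    show "(\<Sum>i\<in>{1..<r}. a (i, j)) \<in> {0, 1}" if j: "j \<in> {1..n + w}" and r: "r \<le> Suc (min n j)" for j r
    proof (cases r)
      case (Suc r')
      then show ?thesis using column_prefix[OF j, of r'] r by simp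
    qed simp
    show "(\<Sum>i\<in>{1..n}. a (i, j)) = 0" if j: "j \<in> {n + 1..n + w}" for j
    proof -
      have "colnum n j \<notin> T n" using R j by (force simp: colnum_def)
      moreover have "(\<Sum>i\<in>{1..<Suc n}. a (i, j)) = of_bool (colnum n j \<in> T n)"
        by (rule column_prefix) (use j in auto)
      ultimately show ?thesis by (simp add: atLeastLessThanSuc_atLeastAtMost)
    qed
  qed
qed

lemma col_cells_left: "j \<in> {1..n} \<Longrightarrow> col_cells n (2 * w + 3) j = {1..j}"
  by (subst col_cells_eq) auto

lemma one_column_iff:
  assumes j: "j \<in> {1..n}"
  shows "one_column n (2 * w + 3) a j \<longleftrightarrow> colnum n j \<in> T n"
proof -
  have "(\<Sum>i\<in>{1..<Suc j}. a (i, j)) = of_bool (colnum n j \<in> T j)"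
    by (rule column_prefix) (use j in auto)
  then have "col_sum n (2 * w + 3) a j = of_bool (colnum n j \<in> T j)"
    unfolding col_sum_def col_cells_left[OF j] by (simp add: atLeastLessThanSuc_atLeastAtMost)
  moreover have "colnum n j \<in> T n \<longleftrightarrow> colnum n j \<in> T j" by (rule frozen_column) (use j in auto)
  ultimately show ?thesis by (simp add: one_column_def)
qed

lemma ten_column_iff:
  assumes j: "j \<in> {1..n}" and "colnum n j \<in> T n"
  shows "ten_column n (2 * w + 3) a j \<longleftrightarrow> colnum n j \<in> T (j - 1)"
proof -
  have "colnum n j \<in> T j" using frozen_column[of j n] assms by auto
  then have "a (j, j) = 0 \<longleftrightarrow> colnum n j \<in> T (j - 1)" using key[of j j] j by auto
  moreover have "Max (col_cells n (2 * w + 3) j) = j"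
    unfolding col_cells_left[OF j] using j by (intro Max_eqI) auto
  ultimately show ?thesis using one_column_iff[OF j] assms by (simp add: ten_column_def)
qed

lemma one_column_vector_eq:
  assumes neg: "\<forall>x\<in>T n. x < 0"
  shows "one_column_vector n (2 * w + 3) a = sorted_list_of_set (T n)"
proof -
  have "{int j - int n - 1 | j. j \<in> {1..n} \<and> one_column n (2 * w + 3) a j} = T n"
  proof (intro Set.set_eqI iffI)
    fix x assume "x \<in> {int j - int n - 1 | j. j \<in> {1..n} \<and> one_column n (2 * w + 3) a j}"
    then show "x \<in> T n" using one_column_iff by (auto simp: colnum_def)
  next
    fix x assume x: "x \<in> T n"
    then have xr: "- int n \<le> x" "x < 0" using sub[of n] neg by auto
    define j where "j = column_numbered n x"
    have j: "j \<in> {1..n}" "colnum n j = x" using xr by (auto simp: j_def column_numbered_def colnum_def)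
    then show "x \<in> {int j - int n - 1 | j. j \<in> {1..n} \<and> one_column n (2 * w + 3) a j}"
      using one_column_iff[OF j(1)] x by (auto simp: colnum_def)
  qed
  then show ?thesis by (simp add: one_column_vector_def)
qed

lemma Q_weight_eq:
  "Q_weight Q n (2 * w + 3) a = Q ^ (\<Sum>i<n. card (T i - T (Suc i)))"
proof -
  let ?A = "{(i, j). (i, j) \<in> cells n (2 * w + 3) \<and> j \<le> n - 1 + (2 * w + 3 - 1) div 2 \<and> a (i, j) = -1}"
  let ?B = "SIGMA i:{..<n}. T i - T (Suc i)"
  have "bij_betw (\<lambda>(i, x). (Suc i, column_numbered n x)) ?B ?A"
  proof (rule bij_betw_byWitness[where f' = "\<lambda>(i, j). (i - 1, colnum n j)"])
    show "\<forall>z\<in>?B. (\<lambda>(i, j). (i - 1, colnum n j)) ((\<lambda>(i, x). (Suc i, column_numbered n x)) z) = z"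
    proof
      fix z assume z: "z \<in> ?B"
      obtain i x where ix: "z = (i, x)" by (cases z)
      have "- int n \<le> x" using z sub[of i] by (auto simp: ix)
      then show "(\<lambda>(i, j). (i - 1, colnum n j)) ((\<lambda>(i, x). (Suc i, column_numbered n x)) z) = z"
        by (simp add: ix)
    qed
    show "\<forall>z\<in>?A. (\<lambda>(i, x). (Suc i, column_numbered n x)) ((\<lambda>(i, j). (i - 1, colnum n j)) z) = z"
      by (auto simp: cells_def)
    show "(\<lambda>(i, x). (Suc i, column_numbered n x)) ` ?B \<subseteq> ?A"
    proof
      fix z assume "z \<in> (\<lambda>(i, x). (Suc i, column_numbered n x)) ` ?B"
      then obtain i x where z: "z = (Suc i, column_numbered n x)" and i: "i < n" and x: "x \<in> T i" "x \<notin> T (Suc i)"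
        by auto
      define j where "j = column_numbered n x"
      have xr: "x \<in> {- int n..<int w}" using x(1) sub[of i] i by auto
      have j: "j \<in> {1..n + w}" "colnum n j = x" using column_range[OF xr] xr by (auto simp: j_def)
      \<comment> \<open>An element that is lost belongs to a column that has not ended, so its cell
        exists.\<close>
      have "int i - int n \<le> x" using frozen[OF i, of x] x by force
      then have ij: "Suc i \<le> j" using j by (auto simp: colnum_def)
      have "a (Suc i, j) = -1" using key[of "Suc i" j] i ij j x by auto
      then show "z \<in> ?A" using i ij j unfolding z j_def[symmetric] by (auto simp: cells_def)
    qed
    show "(\<lambda>(i, j). (i - 1, colnum n j)) ` ?A \<subseteq> ?B"
    proof
      fix z assume "z \<in> (\<lambda>(i, j). (i - 1, colnum n j)) ` ?A"
      then obtain i j where z: "z = (i - 1, colnum n j)" and ij: "(i, j) \<in> cells n (2 * w + 3)"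
        "j \<le> n - 1 + (2 * w + 3 - 1) div 2" "a (i, j) = -1" by auto
      have i: "1 \<le> i" "i \<le> n" "i \<le> j" "j \<le> n + w" using ij by (auto simp: cells_def)
      then have "colnum n j \<notin> T i" "colnum n j \<in> T (i - 1)" using key[of i j] ij(3) by (auto split: if_splits simp: of_bool_def)
      then show "z \<in> ?B" using i by (auto simp: z)
    qed
  qed
  then have "card ?A = card ?B" using bij_betw_same_card by force
  also have "\<dots> = (\<Sum>i<n. card (T i - T (Suc i)))"
  proof (rule card_SigmaI)
    show "\<forall>i\<in>{..<n}. finite (T i - T (Suc i))"
    proof
      fix i assume "i \<in> {..<n}"
      then have "finite (T i)" by (intro finite_subset[OF sub]) auto
      then show "finite (T i - T (Suc i))" by simp
    qed
  qed simp
  finally show ?thesis by (simp add: Q_weight_def)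
qed

end

subsection \<open>The product formula\<close>

lemma prod_pairs_fst:
  "(\<Prod>(s, t)\<in>pairs m. g s t) = (\<Prod>s\<in>{1..m}. \<Prod>t\<in>{s<..m}. g s t :: 'b::comm_monoid_mult)"
proof -
  have "pairs m = (SIGMA s:{1..m}. {s<..m})" by (auto simp: pairs_def)
  then show ?thesis by (simp add: prod.Sigma)
qed

lemma prod_pairs_snd:
  "(\<Prod>(s, t)\<in>pairs m. g s t) = (\<Prod>t\<in>{1..m}. \<Prod>s\<in>{1..<t}. g s t :: 'b::comm_monoid_mult)"
proof -
  have "(\<Prod>t\<in>{1..m}. \<Prod>s\<in>{1..<t}. g s t) = (\<Prod>(t, s)\<in>(SIGMA t:{1..m}. {1..<t}). g s t)"
    by (simp add: prod.Sigma)
  also have "\<dots> = (\<Prod>(s, t)\<in>pairs m. g s t)"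
    by (rule prod.reindex_bij_witness[where i = prod.swap and j = prod.swap]) (auto simp: pairs_def)
  finally show ?thesis ..
qed

lemma gbinomial_Suc_eq:
  fixes x :: "'a::field_char_0"
  shows "of_nat (Suc k) * (x gchoose Suc k) = (x gchoose k) * (x - of_nat k)"
  using gbinomial_mult_1[of x k] by (simp add: algebra_simps)

text \<open>The new factors are z + j + 1 and z - j, with product z (z + 1) - j (j + 1). So for e =
  0 the binomials are polynomials in z (z + 1), which explains the two kinds of factors in the
  product formula.\<close>

lemma sbinom_Suc:
  fixes h x :: int and j :: nat
  defines "z \<equiv> of_int (x - h) :: 'a::field_char_0"
  shows "sbinom h 0 (Suc j) x = sbinom h 0 j x * (- (z * (z + 1)) + of_nat (Suc j * j)) / of_nat (Suc (2 * j) * Suc (Suc (2 * j)))"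
proof -
  let ?y = "z + of_nat j"
  have "of_nat (Suc (2 * j)) * (?y gchoose Suc (2 * j)) = (?y gchoose (2 * j)) * (?y - of_nat (2 * j))"
    by (rule gbinomial_Suc_eq)
  moreover have "of_nat (Suc (Suc (2 * j))) * ((?y + 1) gchoose Suc (Suc (2 * j))) = (?y + 1) * (?y gchoose Suc (2 * j))"
    by (rule Suc_times_gbinomial)
  ultimately have "of_nat (Suc (2 * j)) * (of_nat (Suc (Suc (2 * j))) * ((?y + 1) gchoose Suc (Suc (2 * j)))) =
      (?y + 1) * ((?y gchoose (2 * j)) * (?y - of_nat (2 * j)))"
    by (metis (no_types, lifting) mult.left_commute)
  also have "\<dots> = (?y gchoose (2 * j)) * - (- (z * (z + 1)) + of_nat (Suc j * j))"
    by (simp add: algebra_simps)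
  finally have main: "((?y + 1) gchoose Suc (Suc (2 * j))) * of_nat (Suc (2 * j) * Suc (Suc (2 * j))) =
      - ((?y gchoose (2 * j)) * (- (z * (z + 1)) + of_nat (Suc j * j)))"
    by (simp only: of_nat_mult mult_minus_right mult_ac)
  have nz: "(of_nat (Suc (2 * j) * Suc (Suc (2 * j))) :: 'a) \<noteq> 0"
    by (simp only: of_nat_eq_0_iff) simp
  have "sbinom h 0 (Suc j) x * of_nat (Suc (2 * j) * Suc (Suc (2 * j))) =
      sbinom h 0 j x * (- (z * (z + 1)) + of_nat (Suc j * j))"
  proof -
    have e: "of_int (x - h) + of_nat (Suc j) = ?y + (1 :: 'a)" "2 * Suc j + 0 = Suc (Suc (2 * j))"
      by (simp_all add: z_def)
    show ?thesis
      unfolding sbinom_def e mult.assoc main unfolding z_def[symmetric] by (simp add: mult.assoc)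
  qed
  then show ?thesis by (rule eq_divide_imp[OF nz])
qed

text \<open>Splits the leading coefficients 1 / (2j)! of the determinant into the denominators of
  \<open>base_poly\<close>.\<close>

lemma prod_odd_even_fact:
  "(\<Prod>i<m. of_nat (m - i) * of_nat (m + 1 + i) :: 'a::field_char_0) = fact (2 * m)"
proof -
  have "fact m * (\<Prod>i<k. of_nat (m + 1 + i)) = (fact (m + k) :: 'a)" for k
    by (induction k) (simp_all add: mult_ac)
  moreover have "(\<Prod>i<m. of_nat (m - i) :: 'a) = fact m"
    by (simp add: fact_prod_rev lessThan_atLeast0)
  ultimately show ?thesis by (simp add: prod.distrib mult_2)
qed

text \<open>A Vandermonde determinant in V = -z (z + 1): column j has degree j in V, and V_t - V_s
  factors into a difference and a sum of the variables.\<close>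

lemma bdet_0_product:
  "bdet h 0 m c = (\<Prod>(i, j)\<in>pairs m.
     (of_int (c i) - of_int (c j)) * (of_int (c i) + of_int (c j) - 2 * of_int h + 1) /
     ((of_nat j - of_nat i) * (of_nat i + of_nat j - 1) :: 'a::field_char_0))"
proof -
  define V where "V i = (let z = of_int (c i - h) in - (z * (z + 1)) :: 'a)" for i
  define R where "R j = (\<Prod>t<j. [:of_nat (Suc t * t), 1 :: 'a:])" for j
  define p where "p j = smult (inverse (fact (2 * j))) (R j)" for j
  have poly: "poly (p j) (V i) = sbinom h 0 j (c i)" for i j
  proof (induction j)
    case (Suc j)
    have "poly (p (Suc j)) (V i) = poly (p j) (V i) * (V i + of_nat (Suc j * j)) / of_nat (Suc (2 * j) * Suc (Suc (2 * j)))"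
      by (simp add: p_def R_def poly_prod field_simps)
    then have "poly (p (Suc j)) (V i) =
        sbinom h 0 j (c i) * (V i + of_nat (Suc j * j)) / of_nat (Suc (2 * j) * Suc (Suc (2 * j)))"
      by (simp only: Suc.IH)
    then show ?case unfolding sbinom_Suc V_def Let_def .
  qed (simp add: p_def R_def)
  have deg: "degree (R j) = j" for j
    unfolding R_def by (subst degree_prod_eq_sum_degree) auto
  have "lead_coeff (R j) = 1" for j
    by (simp add: R_def lead_coeff_prod)
  then have coeff: "poly.coeff (p j) j = inverse (fact (2 * j))" for j
    using deg by (simp add: p_def)
  have "bdet h 0 m c = det (mat m m (\<lambda>(i, j). poly (p j) (V (Suc i))))"
    by (simp add: bdet_def altdet_def poly)
  also have "\<dots> = (\<Prod>j<m. poly.coeff (p j) j) * (\<Prod>j<m. \<Prod>i<j. V (Suc j) - V (Suc i))"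
    by (rule det_poly_vandermonde) (auto simp: p_def deg intro: le_trans[OF degree_smult_le])
  also have "(\<Prod>j<m. poly.coeff (p j) j) =
      inverse (\<Prod>j<m. \<Prod>i<j. of_nat (j - i) * of_nat (j + 1 + i))"
    by (simp only: coeff prod_odd_even_fact prod_inversef[symmetric] comp_def)
  finally have "bdet h 0 m c = (\<Prod>j<m. \<Prod>i<j. V (Suc j) - V (Suc i)) /
      (\<Prod>j<m. \<Prod>i<j. of_nat (j - i) * of_nat (j + 1 + i))"
    by (simp only: divide_inverse mult.commute)
  also have "\<dots> = (\<Prod>j<m. \<Prod>i<j. (V (Suc j) - V (Suc i)) / (of_nat (j - i) * of_nat (j + 1 + i)))"
    by (simp only: prod_dividef)
  also have "\<dots> = (\<Prod>t\<in>{1..m}. \<Prod>s\<in>{1..<t}. (V t - V s) / ((of_nat t - of_nat s) * (of_nat s + of_nat t - 1)))"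
  proof (rule prod.reindex_bij_witness[where i = "\<lambda>t. t - 1" and j = Suc])
    fix j assume "j \<in> {..<m}"
    show "(\<Prod>s\<in>{1..<Suc j}. (V (Suc j) - V s) / ((of_nat (Suc j) - of_nat s) * (of_nat s + of_nat (Suc j) - 1))) =
        (\<Prod>i<j. (V (Suc j) - V (Suc i)) / (of_nat (j - i) * of_nat (j + 1 + i)))"
      by (rule prod.reindex_bij_witness[where i = Suc and j = "\<lambda>t. t - 1"])
        (auto simp: of_nat_diff algebra_simps)
  qed auto
  also have "\<dots> = (\<Prod>(s, t)\<in>pairs m. (V t - V s) / ((of_nat t - of_nat s) * (of_nat s + of_nat t - 1)))"
    by (rule prod_pairs_snd[symmetric])
  also have "\<dots> = (\<Prod>(i, j)\<in>pairs m.
     (of_int (c i) - of_int (c j)) * (of_int (c i) + of_int (c j) - 2 * of_int h + 1) /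
     ((of_nat j - of_nat i) * (of_nat i + of_nat j - 1)))"
  proof (intro prod.cong refl)
    have "V t - V s = (of_int (c s) - of_int (c t)) * (of_int (c s) + of_int (c t) - 2 * of_int h + 1)" for s t
      by (simp add: V_def Let_def algebra_simps)
    then show "(case z of (s, t) \<Rightarrow> (V t - V s) / ((of_nat t - of_nat s) * (of_nat s + of_nat t - 1))) =
        (case z of (i, j) \<Rightarrow> (of_int (c i) - of_int (c j)) * (of_int (c i) + of_int (c j) - 2 * of_int h + 1) /
     ((of_nat j - of_nat i) * (of_nat i + of_nat j - 1)))" for z
      by (cases z) simp
  qed
  finally show ?thesis .
qed

lemma act_prod_shb_power:
  assumes "finite A"
  shows "act (\<Prod>i\<in>A. shb i ^ k i) f c = f (\<lambda>i. if i \<in> A then c i - int (k i) else c i)"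
  using assms
proof (induction A arbitrary: c rule: finite_induct)
  case (insert b A)
  have pw: "act (shb b ^ k) g c = g (c(b := c b - int k))" for k g c
  proof (induction k arbitrary: c)
    case (Suc k)
    have "(c(b := c b - 1))(b := (c(b := c b - 1)) b - int k) = c(b := c b - int (Suc k))" by auto
    then show ?case by (simp only: power_Suc act_mult act_shb Suc)
  qed simp
  have "(\<lambda>i. if i \<in> A then (c(b := c b - int (k b))) i - int (k i) else (c(b := c b - int (k b))) i) =
      (\<lambda>i. if i \<in> insert b A then c i - int (k i) else c i)"
    using insert.hyps by auto
  then show ?case using insert by (simp add: act_mult pw)
qed simp

text \<open>Here 2b + n + 1 = 2w + 2N - 1, and moving c_i by N - i absorbs the terms in i and j of
  both factors.\<close>

lemma base_poly_eq:
  "(base_poly (2 * N) (2 * w + 3) :: 'a::field_char_0 polyfun) = act (\<Prod>i\<in>{1..N}. shb i ^ (N - i)) (bdet (int w) 0 N)"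
proof
  fix c
  have "act (\<Prod>i\<in>{1..N}. shb i ^ (N - i)) (bdet (int w) 0 N :: 'a polyfun) c =
      bdet (int w) 0 N (\<lambda>i. if i \<in> {1..N} then c i - int (N - i) else c i)"
    by (rule act_prod_shb_power) simp
  also have "\<dots> = base_poly (2 * N) (2 * w + 3) c"
    unfolding bdet_0_product base_poly_def Let_def
  proof (rule prod.cong, goal_cases)
    case 1
    show ?case by (simp add: pairs_def)
  next
    case (2 z)
    then obtain i j where z: "z = (i, j)" "1 \<le> i" "i < j" "j \<le> N" by auto
    have s: "of_int (int (N - i)) = (of_nat N - of_nat i :: 'a)" "of_int (int (N - j)) = (of_nat N - of_nat j :: 'a)"
      using z by (simp_all add: of_nat_diff)
    have b: "2 * ((of_nat (2 * w + 3) - 5) / 2) + of_nat (2 * N) + 1 = (2 * of_nat w + 2 * of_nat N - 1 :: 'a)"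
      by (simp add: field_simps)
    have eq: "(of_int (c i - int (N - i)) - of_int (c j - int (N - j))) *
        (of_int (c i - int (N - i)) + of_int (c j - int (N - j)) - 2 * of_int (int w) + 1) =
        (of_int (c j) - of_int (c i) + of_nat j - of_nat i) *
        (2 * of_nat w + 2 * of_nat N - 1 - of_int (c i) - of_int (c j) - of_nat i - of_nat j :: 'a)"
      unfolding of_int_diff s by (simp add: algebra_simps)
    have in1: "i \<in> {1..N}" "j \<in> {1..N}" using z by auto
    show ?case unfolding z(1) split_conv b if_P[OF in1(1)] if_P[OF in1(2)] eq ..
  qed
  finally show "(base_poly (2 * N) (2 * w + 3) :: 'a polyfun) c = act (\<Prod>i\<in>{1..N}. shb i ^ (N - i)) (bdet (int w) 0 N) c" ..
qed

section \<open>Products of operators as Laurent polynomials\<close>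

lemma op_prod_Nil [simp]: "op_prod [] = id" and op_prod_Cons [simp]: "op_prod (F # Fs) = F \<circ> op_prod Fs"
  by (simp_all add: op_prod_def)

lemma op_prod_append: "op_prod (Fs @ Gs) = op_prod Fs \<circ> op_prod Gs"
  by (induction Fs) auto

lemma op_prod_concat: "op_prod (concat Fss) = op_prod (map op_prod Fss)"
  by (induction Fss) (auto simp: op_prod_append)

lemma op_prod_act:
  assumes "nilp K f" "\<And>x f. x \<in> set xs \<Longrightarrow> nilp K f \<Longrightarrow> F x f = act (g x) f"
  shows "op_prod (map F xs) f = act (prod_list (map g xs)) f"
  using assms(2)
proof (induction xs)
  case (Cons x xs)
  then show ?case using nilp_act[OF assms(1)] by (simp add: act_mult)
qed simp

lemma op_prod_act':
  assumes "\<And>x. x \<in> set xs \<Longrightarrow> F x = act (g x)"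
  shows "op_prod (map F xs) = act (prod_list (map g xs))"
  using assms
proof (induction xs)
  case Nil
  show ?case by (rule ext) simp
next
  case (Cons x xs)
  then have "F x = act (g x)" "op_prod (map F xs) = act (prod_list (map g xs))" by simp_all
  then show ?case by (intro ext) (simp add: act_mult)
qed

lemma prod_list_upt: "prod_list (map g [a..<b]) = (\<Prod>i\<in>{a..<b}. g i :: 'b::comm_monoid_mult)"
  by (induction b) (auto simp: atLeastLessThanSuc mult.commute)

lemma F_poly_eq_level_even: "F_poly Q (2 * N) (2 * w + 3) = level_even Q (int w) N"
proof -
  define a where "a = (scal (2 - Q) :: 'a shift_op)"
  define P where "P s t = (shf s + shb t - a * (shf s * shb t)) * (shf s + shf t - a * (shf s * shf t))" for s t
  have pair: "pair_op1 Q s t \<circ> pair_op2 Q s t = act (P s t)" for s t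
  proof -
    have sh: "shiftE r g = act (shf r) g" "shiftE_inv r g = act (shb r) g" for r and g :: "'a polyfun"
      by (simp_all add: shiftE_def shiftE_inv_def act_shf act_shb)
    have pp: "pair_op1 Q s t g = act (shf s + shb t - a * (shf s * shb t)) g"
      "pair_op2 Q s t g = act (shf s + shf t - a * (shf s * shf t)) g" for g
      by (simp_all only: pair_op1_def pair_op2_def sh act_mult act_add act_diff act_scal a_def)
    show ?thesis by (rule ext) (simp only: comp_apply pp P_def act_mult)
  qed
  \<comment> \<open>E_s E_t^-1 is taken out of the first factor and E_s E_t out of the second;
    together this is E_s^2.\<close>
  have P: "P s t = (shf s * shf s) * bfac Q s t" for s t
  proof -
    have 1: "shf s + shb t - a * (shf s * shb t) = shf s * shb t * (shb s + shf t - a)"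
    proof -
      have "shf s * shb t * (shb s + shf t - a) = (shf s * shb s) * shb t + (shf t * shb t) * shf s - a * (shf s * shb t)"
        by (simp only: distrib_left right_diff_distrib mult_ac)
      then show ?thesis by simp
    qed
    have 2: "shf s + shf t - a * (shf s * shf t) = shf s * shf t * (shb s + shb t - a)"
    proof -
      have "shf s * shf t * (shb s + shb t - a) = (shf s * shb s) * shf t + (shf t * shb t) * shf s - a * (shf s * shf t)"
        by (simp only: distrib_left right_diff_distrib mult_ac)
      then show ?thesis by simp
    qed
    have "P s t = (shf t * shb t) * ((shf s * shf s) * bfac Q s t)"
      unfolding P_def 1 2 bfac_def a_def[symmetric] by (simp only: mult_ac)
    then show ?thesis by simp
  qed
  have "F_poly Q (2 * N) (2 * w + 3) =
      act (\<Prod>t\<in>{1..N}. \<Prod>s\<in>{1..<t}. P s t) (base_poly (2 * N) (2 * w + 3))"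
  proof -
    have "op_prod [pair_op1 Q s t \<circ> pair_op2 Q s t. t \<leftarrow> [1..<N + 1], s \<leftarrow> [1..<t]] =
        act (prod_list (map (\<lambda>t. \<Prod>s\<in>{1..<t}. P s t) [1..<N + 1]))"
      unfolding op_prod_concat map_map comp_def[of op_prod]
      by (rule op_prod_act') (simp add: op_prod_act'[where g = "\<lambda>s. P s _"] pair prod_list_upt)
    then show ?thesis
      unfolding F_poly_def prod_list_upt by (simp add: atLeastLessThanSuc_atLeastAtMost)
  qed
  also have "\<dots> = act ((\<Prod>(s, t)\<in>pairs N. P s t) * (\<Prod>i\<in>{1..N}. shb i ^ (N - i))) (bdet (int w) 0 N)"
    unfolding base_poly_eq prod_pairs_snd act_mult ..
  also have "(\<Prod>(s, t)\<in>pairs N. P s t) * (\<Prod>i\<in>{1..N}. shb i ^ (N - i)) = bop Q N"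
  proof -
    have sq: "(\<Prod>(s, t)\<in>pairs N. shf s :: 'a shift_op) = (\<Prod>s\<in>{1..N}. shf s ^ (N - s))"
      unfolding prod_pairs_fst by simp
    have "(\<Prod>(s, t)\<in>pairs N. P s t) =
        (\<Prod>(s, t)\<in>pairs N. shf s) * (\<Prod>(s, t)\<in>pairs N. shf s) * (\<Prod>(s, t)\<in>pairs N. bfac Q s t)"
      unfolding P by (simp add: prod.distrib case_prod_unfold)
    then have "(\<Prod>(s, t)\<in>pairs N. P s t) * (\<Prod>i\<in>{1..N}. shb i ^ (N - i)) =
        (\<Prod>s\<in>{1..N}. shf s ^ (N - s) * shb s ^ (N - s)) * bop Q N"
      unfolding bop_def sq prod.distrib by (simp only: mult_ac)
    also have "(\<Prod>s\<in>{1..N}. shf s ^ (N - s) * shb s ^ (N - s)) = (1 :: 'a shift_op)"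
      by (simp flip: power_mult_distrib)
    finally show ?thesis by simp
  qed
  finally show ?thesis by (simp add: level_even_def)
qed

lemma op_prod_comprehension:
  "op_prod (concat (map (\<lambda>i. if B i then [F i] else []) xs)) = op_prod (map F (filter B xs))"
  by (induction xs) auto

lemma prod_list_filter:
  "prod_list (map g (filter B xs)) = prod_list (map (\<lambda>i. if B i then g i else 1) xs)"
  by (induction xs) auto

lemma neg_qdiff_eq_act: "nilp K f \<Longrightarrow> neg_qdiff Q r f = act (- qd_op Q K r) f"
  by (simp add: neg_qdiff_def qdiff_eq_act act_uminus)

lemma neg_qdiff_pow_eq_act: "nilp K f \<Longrightarrow> (neg_qdiff Q r ^^ k) f = act ((- qd_op Q K r) ^ k) f"
  by (induction k) (simp, simp only: funpow.simps comp_apply neg_qdiff_eq_act[OF nilp_act] power_Suc act_mult)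

lemma id_plus_qdiff_eq_act: "nilp K f \<Longrightarrow> id_plus_qdiff Q r f = act (1 + qd_op Q K r) f"
  by (simp add: id_plus_qdiff_def qdiff_eq_act act_add)

text \<open>Each factor meets a function that still satisfies \<open>nilp K\<close>, so every
  \<Delta>^Q may be truncated and the factors collected variable by variable.\<close>

lemma operators_eq_act:
  assumes f: "nilp K f" and c: "\<And>r. r \<in> {1..N} \<Longrightarrow> c r \<le> -1"
  shows "op_prod [neg_qdiff Q i. i \<leftarrow> [1..<N + 1], c i \<in> C]
     (op_prod [id_plus_qdiff Q i. i \<leftarrow> [1..<N + 1], c i \<notin> C]
       (op_prod [neg_qdiff Q r ^^ nat (- c r - 1). r \<leftarrow> [1..<N + 1]] f)) =
    act (freeze_ops Q K C (2 * N) (2 * N) c) f"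
proof -
  let ?A = "\<Prod>i\<in>{1..<N + 1}. if c i \<in> C then - qd_op Q K i else 1"
  let ?B = "\<Prod>i\<in>{1..<N + 1}. if c i \<notin> C then 1 + qd_op Q K i else 1"
  let ?E = "\<Prod>r\<in>{1..<N + 1}. (- qd_op Q K r) ^ nat (- c r - 1)"
  have E: "op_prod [neg_qdiff Q r ^^ nat (- c r - 1). r \<leftarrow> [1..<N + 1]] f = act ?E f"
    by (subst op_prod_act[OF f, where g = "\<lambda>r. (- qd_op Q K r) ^ nat (- c r - 1)"])
      (simp_all add: neg_qdiff_pow_eq_act prod_list_upt del: upt_Suc)
  have B: "op_prod [id_plus_qdiff Q i. i \<leftarrow> [1..<N + 1], c i \<notin> C] g = act ?B g" if "nilp K g" for g
    unfolding op_prod_comprehension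
    by (subst op_prod_act[OF that, where g = "\<lambda>r. 1 + qd_op Q K r"])
      (simp_all add: id_plus_qdiff_eq_act prod_list_filter prod_list_upt del: upt_Suc)
  have A: "op_prod [neg_qdiff Q i. i \<leftarrow> [1..<N + 1], c i \<in> C] g = act ?A g" if "nilp K g" for g
    unfolding op_prod_comprehension
    by (subst op_prod_act[OF that, where g = "\<lambda>r. - qd_op Q K r"])
      (simp_all add: neg_qdiff_eq_act prod_list_filter prod_list_upt del: upt_Suc)
  have "{r \<in> {1..2 * N div 2}. c r + int (2 * N) + 1 \<le> int (2 * N)} = {1..<N + 1}"
    using c by fastforce
  moreover have "int (2 * N) - (c r + int (2 * N) + 1) = - c r - 1" for r by simp
  ultimately have "freeze_ops Q K C (2 * N) (2 * N) c =
      (\<Prod>r\<in>{1..<N + 1}. flag_op Q K C r (c r) * (- qd_op Q K r) ^ nat (- c r - 1))"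
    unfolding freeze_ops_def by (simp only:)
  also have "\<dots> = ?A * (?B * ?E)"
    unfolding prod.distrib[symmetric] by (intro prod.cong) (auto simp: flag_op_def)
  finally show ?thesis
    unfolding E B[OF nilp_act[OF f]] A[OF nilp_act[OF nilp_act[OF f]]] by (simp only: act_mult)
qed

section \<open>The bijection between trapezoids and sequences of sets\<close>

definition seq_of :: "nat \<Rightarrow> nat \<Rightarrow> (nat \<times> nat \<Rightarrow> int) \<Rightarrow> nat \<Rightarrow> int set" where
  "seq_of n w a = (\<lambda>i\<in>{..n}. {x \<in> {- int n..<int w}.
     (\<Sum>i'\<in>{1..<Suc (min i (column_numbered n x))}. a (i', column_numbered n x)) = 1})"

definition array_of :: "nat \<Rightarrow> nat \<Rightarrow> (nat \<Rightarrow> int set) \<Rightarrow> nat \<times> nat \<Rightarrow> int" where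
  "array_of n w T = (\<lambda>(i, j)\<in>cells n (2 * w + 3).
     if j = n + w + 1 then 1 - 2 * of_bool (even i)
     else (let x = colnum n (min j (2 * (n + w + 1) - j)) in of_bool (x \<in> T i) - of_bool (x \<in> T (i - 1))))"

text \<open>The \<open>min\<close> expresses freezing: a column j \<le> n has only j rows, and its
  sum stays what it is after row j.\<close>

lemma seq_of_iff:
  assumes "i \<le> n" "j \<in> {1..n + w}"
  shows "colnum n j \<in> seq_of n w a i \<longleftrightarrow> (\<Sum>i'\<in>{1..<Suc (min i j)}. a (i', j)) = 1"
  using assms colnum_range[OF assms(2)] by (simp add: seq_of_def del: sum.op_ivl_Suc)

lemma seq_array_seq_of:
  assumes H: "half_ok n w a"
  shows "seq_array n w a (seq_of n w a)"
proof
  fix i j assume ij: "1 \<le> i" "i \<le> n" "i \<le> j" "j \<le> n + w"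
  have pc: "(\<Sum>i\<in>{1..<r}. a (i, j)) \<in> {0, 1}" if "r \<le> Suc (min n j)" for r
    using H that ij unfolding half_ok_def by auto
  have "of_bool (colnum n j \<in> seq_of n w a r) = (\<Sum>i'\<in>{1..<Suc r}. a (i', j))" if "r \<le> i" for r
    using that ij pc[of "Suc r"] by (subst seq_of_iff) (auto simp: min_def)
  from this[of i] this[of "i - 1"] show "a (i, j) =
      of_bool (colnum n j \<in> seq_of n w a i) - of_bool (colnum n j \<in> seq_of n w a (i - 1))"
    using ij by (cases i) auto
next
  fix i x assume i: "i < n" and x: "x < int i - int n"
  have "min (Suc i) (column_numbered n x) = min i (column_numbered n x)"
    using x by (simp add: column_numbered_def min_def)
  then show "x \<in> seq_of n w a (Suc i) \<longleftrightarrow> x \<in> seq_of n w a i"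
    using i by (simp add: seq_of_def)
next
  show "seq_of n w a 0 = {}" by (auto simp: seq_of_def)
next
  show "seq_of n w a i \<subseteq> {- int n..<int w}" if "i \<le> n" for i using that by (auto simp: seq_of_def)
qed

lemma preds_iff:
  "S' \<in> preds n h C (Suc i) S \<longleftrightarrow> finite S' \<and> card S' = i div 2 \<and> (\<forall>x\<in>S'. x < h) \<and> interlaces S S' \<and>
    (\<forall>x<int i - int n. x \<in> S \<longleftrightarrow> x \<in> S') \<and>
    (colnum n (Suc i) \<in> S \<longrightarrow> (colnum n (Suc i) \<in> S' \<longleftrightarrow> colnum n (Suc i) \<in> C))"
  by (auto simp: preds_def il_sets_def Let_def colnum_def)

lemma seq_array_array_of:
  assumes T: "T \<in> paths n (int w) C n S" and S: "S \<subseteq> {- int n..<int w}" and n: "0 < n"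
  shows "seq_array n w (array_of n w T) T"
proof -
  have nx: "T i \<in> preds n (int w) C (Suc i) (T (Suc i))" if "i < n" for i using T that by (simp add: paths_def)
  have Tn: "T n = S" using T by (simp add: paths_def)
  have up: "x < int w" if "x \<in> T i" "i \<le> n" for x i
    using that nx[of i] S Tn by (cases "i = n") (auto simp: preds_iff)
  have fin: "finite (T i)" if "i \<le> n" for i
    using that nx[of i] Tn finite_subset[OF S] by (cases "i = n") (auto simp: preds_iff)
  \<comment> \<open>\<open>preds\<close> does not mention the lower bound -n. It is inherited from
    S, since interlacing never lets the number of elements below -n grow from
    \<open>T (Suc i)\<close> to \<open>T i\<close>.\<close>
  have lo: "cnt (T i) (- int n - 1) = 0" if "i \<le> n" for i
    using that
  proof (induction rule: inc_induct)
    case base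
    have "{s \<in> T n. s \<le> - int n - 1} = {}" using S Tn by auto
    then show ?case unfolding cnt_def by (simp only: card.empty)
  next
    case (step i)
    have "cnt (T i) (- int n - 1) \<le> cnt (T (Suc i)) (- int n - 1)"
      using nx[of i] step.hyps unfolding preds_iff interlaces_def by auto
    then show ?case using step.IH by simp
  qed
  have sub: "T i \<subseteq> {- int n..<int w}" if i: "i \<le> n" for i
  proof
    fix x assume x: "x \<in> T i"
    have "{s \<in> T i. s \<le> - int n - 1} = {}" using lo[OF i] fin[OF i] by (simp add: cnt_def)
    then have "- int n \<le> x" using x by force
    then show "x \<in> {- int n..<int w}" using up[OF x i] by simp
  qed
  show ?thesis
  proof
    fix i j assume ij: "1 \<le> i" "i \<le> n" "i \<le> j" "j \<le> n + w"
    have "(i, j) \<in> cells n (2 * w + 3)" using ij by (auto simp: cells_def)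
    moreover have "min j (2 * (n + w + 1) - j) = j" using ij by simp
    ultimately show "array_of n w T (i, j) = of_bool (colnum n j \<in> T i) - of_bool (colnum n j \<in> T (i - 1))"
      using ij by (simp add: array_of_def Let_def)
  next
    show "x \<in> T (Suc i) \<longleftrightarrow> x \<in> T i" if "i < n" "x < int i - int n" for i x
      using nx[OF that(1)] that(2) by (auto simp: preds_iff)
  next
    show "T 0 = {}"
    proof -
      have "card (T 0) = 0" using nx[of 0] n by (simp add: preds_iff)
      then show ?thesis using fin[of 0] by simp
    qed
  next
    show "T i \<subseteq> {- int n..<int w}" if "i \<le> n" for i by (rule sub[OF that])
  qed
qed

lemma array_of_center: "i \<in> {1..n} \<Longrightarrow> array_of n w T (i, n + w + 1) = 1 - 2 * of_bool (even i)"
  by (auto simp: array_of_def cells_def)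

lemma array_of_PiE: "array_of n w T \<in> cells n (2 * w + 3) \<rightarrow>\<^sub>E {-1, 0, 1}"
proof (rule PiE_I)
  fix z assume "z \<in> cells n (2 * w + 3)"
  then show "array_of n w T z \<in> {-1, 0, 1}"
    by (cases z) (simp add: array_of_def Let_def of_bool_def)
next
  fix z assume "z \<notin> cells n (2 * w + 3)"
  then show "array_of n w T z = undefined" by (simp add: array_of_def)
qed

lemma array_of_symmetric: "vertically_symmetric n (2 * w + 3) (array_of n w T)"
  unfolding vertically_symmetric_def
proof (intro ballI, clarify)
  fix i j assume ij: "(i, j) \<in> cells n (2 * w + 3)"
  define k where "k = 2 * n + (2 * w + 3) - 1 - j"
  have jk: "j + k = 2 * (n + w + 1)" using ij by (auto simp: cells_def k_def)
  have "(i, k) \<in> cells n (2 * w + 3)" using ij by (auto simp: cells_def k_def)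
  moreover have "k = n + w + 1 \<longleftrightarrow> j = n + w + 1" using jk by auto
  moreover have "min k (2 * (n + w + 1) - k) = min j (2 * (n + w + 1) - j)"
  proof -
    have "2 * (n + w + 1) - k = j" "2 * (n + w + 1) - j = k" using jk by auto
    then show ?thesis by (simp only: min.commute)
  qed
  ultimately show "array_of n w T (i, j) = array_of n w T (i, 2 * n + (2 * w + 3) - 1 - j)"
    using ij unfolding k_def[symmetric] by (simp add: array_of_def)
qed

lemma array_of_seq_of:
  assumes a: "a \<in> cells n (2 * w + 3) \<rightarrow>\<^sub>E {-1, 0, 1}" and vs: "vertically_symmetric n (2 * w + 3) a"
    and H: "half_ok n w a"
  shows "array_of n w (seq_of n w a) = a"
proof (rule PiE_ext[OF array_of_PiE a])
  fix z assume z: "z \<in> cells n (2 * w + 3)"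
  obtain i j where ij: "z = (i, j)" by (cases z)
  have i: "1 \<le> i" "i \<le> n" "i \<le> j" "j \<le> 2 * (n + w + 1) - i" using z by (auto simp: ij cells_def)
  interpret seq_array n w a "seq_of n w a" by (rule seq_array_seq_of[OF H])
  define m where "m = min j (2 * (n + w + 1) - j)"
  show "array_of n w (seq_of n w a) z = a z"
  proof (cases "j = n + w + 1")
    case True
    then show ?thesis using H i array_of_center[of i n w] unfolding ij half_ok_def by auto
  next
    case False
    have m: "i \<le> m" "m \<le> n + w" using i False by (auto simp: m_def)
    have "array_of n w (seq_of n w a) z =
        of_bool (colnum n m \<in> seq_of n w a i) - of_bool (colnum n m \<in> seq_of n w a (i - 1))"
      using z False by (simp add: ij array_of_def Let_def m_def)
    also have "\<dots> = a (i, m)" using key[OF i(1,2) m] by simp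
    also have "\<dots> = a (i, j)"
    proof (cases "j \<le> n + w")
      case True
      then show ?thesis by (simp add: m_def)
    next
      case False
      then have "m = 2 * n + (2 * w + 3) - 1 - j" using i by (auto simp: m_def)
      moreover from bspec[OF vs[unfolded vertically_symmetric_def] z]
      have "a (i, j) = a (i, 2 * n + (2 * w + 3) - 1 - j)" unfolding ij split_conv .
      ultimately show ?thesis by simp
    qed
    finally show ?thesis by (simp add: ij)
  qed
qed

lemma seq_of_array_of:
  assumes T: "T \<in> paths n (int w) C n S" and S: "S \<subseteq> {- int n..<int w}" and n: "0 < n"
  shows "seq_of n w (array_of n w T) = T"
proof -
  interpret seq_array n w "array_of n w T" T by (rule seq_array_array_of[OF T S n])
  have "seq_of n w (array_of n w T) \<in> {..n} \<rightarrow>\<^sub>E UNIV" by (simp add: seq_of_def)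
  moreover have "T \<in> {..n} \<rightarrow>\<^sub>E UNIV" using T by (simp add: paths_def)
  ultimately show ?thesis
  proof (rule PiE_ext)
    fix i assume i: "i \<in> {..n}"
    show "seq_of n w (array_of n w T) i = T i"
    proof (rule Set.set_eqI)
      fix x
      show "x \<in> seq_of n w (array_of n w T) i \<longleftrightarrow> x \<in> T i"
      proof (cases "x \<in> {- int n..<int w}")
        case True
        define j where "j = column_numbered n x"
        have j: "j \<in> {1..n + w}" "colnum n j = x" using column_range[OF True] True by (auto simp: j_def)
        have "x \<in> seq_of n w (array_of n w T) i \<longleftrightarrow>
            (\<Sum>i'\<in>{1..<Suc (min i j)}. array_of n w T (i', j)) = 1"
          using seq_of_iff[of i n j w] i j by auto
        also have "\<dots> \<longleftrightarrow> x \<in> T (min i j)"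
          using column_prefix[OF j(1), of "min i j"] i j by simp
        also have "\<dots> \<longleftrightarrow> x \<in> T i"
          using frozen_column[of j i] i j by (cases "i \<le> j") (auto simp: min_def)
        finally show ?thesis .
      next
        case False
        then show ?thesis using sub[of i] i by (auto simp: seq_of_def)
      qed
    qed
  qed
qed

lemma sorted_list_of_set_image:
  assumes "strict_mono_on {1..N} (c :: nat \<Rightarrow> int)"
  shows "sorted_list_of_set (c ` {1..N}) = map c [1..<N + 1]"
proof -
  have "sorted_wrt (<) (map c [1..<N + 1])"
    unfolding sorted_wrt_map
  proof (rule sorted_wrt_mono_rel[OF _ sorted_wrt_upt])
    show "c x < c y" if "x \<in> set [1..<N + 1]" "y \<in> set [1..<N + 1]" "x < y" for x y
      using that by (intro strict_mono_onD[OF assms]) auto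
  qed
  then have "sorted_list_of_set (set (map c [1..<N + 1])) = map c [1..<N + 1]"
    by (intro sorted_list_of_set.idem_if_sorted_distinct) (auto simp: strict_sorted_iff)
  moreover have "set (map c [1..<N + 1]) = c ` {1..N}"
    by (simp add: atLeastLessThanSuc_atLeastAtMost del: upt_Suc)
  ultimately show ?thesis by simp
qed

lemma sum_symmetric_trapezoids:
  fixes Q :: "'a::field_char_0"
  assumes n: "n = 2 * N" "0 < N" and c: "strict_mono_on {1..N} c"
    and cr: "\<And>r. r \<in> {1..N} \<Longrightarrow> - int n \<le> c r \<and> c r \<le> -1"
  shows "(\<Sum>a\<in>symmetric_trapezoids n (2 * w + 3) c C. Q_weight Q n (2 * w + 3) a) =
    (\<Sum>T\<in>paths n (int w) C n (c ` {1..N}). Q ^ (\<Sum>i<n. card (T i - T (Suc i))))"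
proof -
  define S where "S = c ` {1..N}"
  have S: "S \<subseteq> {- int n..<int w}" "finite S" using cr by (fastforce simp: S_def)+
  have neg: "x < 0" if "x \<in> S" for x using that cr by (fastforce simp: S_def)
  have n0: "0 < n" and ev: "even n" and nN: "n div 2 = N" using n by auto
  have cardS: "card S = N" unfolding S_def using card_image[OF strict_mono_on_imp_inj_on[OF c]] by simp
  have vec: "sorted_list_of_set S = map c [1..<N + 1]" unfolding S_def by (rule sorted_list_of_set_image[OF c])
  \<comment> \<open>Moves the condition on 10-columns from the entries c_r to the rows, where
    \<open>preds\<close> tests it: column i + 1 ends in row i + 1.\<close>
  have flag: "(\<forall>r\<in>{1..N}. ten_column n (2 * w + 3) a (column_numbered n (c r)) \<longleftrightarrow> c r \<in> C) \<longleftrightarrow>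
      (\<forall>i<n. colnum n (Suc i) \<in> T (Suc i) \<longrightarrow> (colnum n (Suc i) \<in> T i \<longleftrightarrow> colnum n (Suc i) \<in> C))"
    if sa: "seq_array n w a T" and Tn: "T n = S" for a T
  proof -
    interpret seq_array n w a T by (rule sa)
    have mem: "colnum n (Suc i) \<in> T (Suc i) \<longleftrightarrow> colnum n (Suc i) \<in> S" if "i < n" for i
      using frozen_column[of "Suc i" n] that Tn by simp
    have ten: "ten_column n (2 * w + 3) a (Suc i) \<longleftrightarrow> colnum n (Suc i) \<in> T i" if "i < n" "colnum n (Suc i) \<in> S" for i
      using ten_column_iff[of "Suc i"] that Tn by simp
    show ?thesis
    proof
      assume L: "\<forall>r\<in>{1..N}. ten_column n (2 * w + 3) a (column_numbered n (c r)) \<longleftrightarrow> c r \<in> C"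
      show "\<forall>i<n. colnum n (Suc i) \<in> T (Suc i) \<longrightarrow> (colnum n (Suc i) \<in> T i \<longleftrightarrow> colnum n (Suc i) \<in> C)"
      proof (intro allI impI)
        fix i assume i: "i < n" "colnum n (Suc i) \<in> T (Suc i)"
        then have iS: "colnum n (Suc i) \<in> S" using mem by simp
        then obtain r where r: "r \<in> {1..N}" "c r = colnum n (Suc i)" by (auto simp: S_def)
        have "ten_column n (2 * w + 3) a (Suc i) \<longleftrightarrow> colnum n (Suc i) \<in> C"
          using bspec[OF L r(1)] unfolding r(2) column_colnum .
        then show "colnum n (Suc i) \<in> T i \<longleftrightarrow> colnum n (Suc i) \<in> C" using ten[OF i(1) iS] by simp
      qed
    next
      assume R: "\<forall>i<n. colnum n (Suc i) \<in> T (Suc i) \<longrightarrow> (colnum n (Suc i) \<in> T i \<longleftrightarrow> colnum n (Suc i) \<in> C)"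
      show "\<forall>r\<in>{1..N}. ten_column n (2 * w + 3) a (column_numbered n (c r)) \<longleftrightarrow> c r \<in> C"
      proof
        fix r assume r: "r \<in> {1..N}"
        define i where "i = column_numbered n (c r) - 1"
        have "c r + int n + 1 \<ge> 1" "c r + int n + 1 \<le> int n" using cr[OF r] by auto
        then have i: "i < n" "Suc i = column_numbered n (c r)" by (auto simp: i_def column_numbered_def)
        have colnum: "colnum n (Suc i) = c r" unfolding i(2) using cr[OF r] by simp
        have iS: "colnum n (Suc i) \<in> S" unfolding colnum S_def using r by simp
        have "colnum n (Suc i) \<in> T i \<longleftrightarrow> colnum n (Suc i) \<in> C" using R i(1) mem[OF i(1)] iS by blast
        then show "ten_column n (2 * w + 3) a (column_numbered n (c r)) \<longleftrightarrow> c r \<in> C"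
          using ten[OF i(1) iS] colnum i(2) by simp
      qed
    qed
  qed
  show ?thesis
    unfolding S_def[symmetric]
  proof (rule sum.reindex_bij_witness[where i = "array_of n w" and j = "seq_of n w"])
    fix a assume "a \<in> symmetric_trapezoids n (2 * w + 3) c C"
    then have a: "as_trapezoid n (2 * w + 3) a" "vertically_symmetric n (2 * w + 3) a"
      "one_column_vector n (2 * w + 3) a = map c [1..<N + 1]"
      "\<forall>r\<in>{1..N}. ten_column n (2 * w + 3) a (column_numbered n (c r)) \<longleftrightarrow> c r \<in> C"
      by (auto simp: symmetric_trapezoids_def nN)
    have PiE: "a \<in> cells n (2 * w + 3) \<rightarrow>\<^sub>E {-1, 0, 1}" using a(1) by (simp add: as_trapezoid_def)
    have H: "half_ok n w a" using symmetric_trapezoid_iff_half[OF ev PiE a(2)] a(1) by simp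
    let ?T = "seq_of n w a"
    interpret seq_array n w a ?T by (rule seq_array_seq_of[OF H])
    have ctr: "a (i, n + w + 1) = 1 - 2 * of_bool (even i)" if "i \<in> {1..n}" for i
      using H that unfolding half_ok_def by blast
    have "half_ok n w a \<longleftrightarrow> (\<forall>i<n. interlaces (?T (Suc i)) (?T i)) \<and> (\<forall>i\<le>n. card (?T i) = i div 2) \<and>
        (\<forall>x\<in>?T n. x < 0)"
      by (rule half_ok_iff) (rule ctr)
    with H have hi: "(\<forall>i<n. interlaces (?T (Suc i)) (?T i)) \<and> (\<forall>i\<le>n. card (?T i) = i div 2) \<and>
        (\<forall>x\<in>?T n. x < 0)" by blast
    have Tn: "?T n = S"
    proof -
      have "finite (?T n)" using finite_subset[OF sub[of n]] by simp
      moreover have "sorted_list_of_set (?T n) = sorted_list_of_set S"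
      proof -
        have "\<forall>x\<in>?T n. x < 0" using hi by blast
        from one_column_vector_eq[OF this] show ?thesis unfolding a(3) vec ..
      qed
      ultimately show ?thesis using S(2) by (metis set_sorted_list_of_set)
    qed
    show "array_of n w (seq_of n w a) = a" by (rule array_of_seq_of[OF PiE a(2) H])
    have "?T i \<in> preds n (int w) C (Suc i) (?T (Suc i))" if i: "i < n" for i
    proof -
      have "finite (?T i)" using finite_subset[OF sub[of i]] i by simp
      moreover have "\<forall>x\<in>?T i. x < int w" using sub[of i] i by auto
      moreover have "colnum n (Suc i) \<in> ?T (Suc i) \<longrightarrow> (colnum n (Suc i) \<in> ?T i \<longleftrightarrow> colnum n (Suc i) \<in> C)"
        using flag[OF seq_array_axioms Tn] a(4) i by blast
      ultimately show ?thesis using hi i frozen[OF i] unfolding preds_iff by simp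
    qed
    then show "?T \<in> paths n (int w) C n S" using Tn by (simp add: paths_def seq_of_def[of n w a])
    show "Q ^ (\<Sum>i<n. card (?T i - ?T (Suc i))) = Q_weight Q n (2 * w + 3) a"
      by (rule Q_weight_eq[symmetric])
  next
    fix T assume T: "T \<in> paths n (int w) C n S"
    let ?a = "array_of n w T"
    interpret seq_array n w ?a T by (rule seq_array_array_of[OF T S(1) n0])
    show "seq_of n w ?a = T" by (rule seq_of_array_of[OF T S(1) n0])
    have Tn: "T n = S" using T by (simp add: paths_def)
    have nx: "T i \<in> preds n (int w) C (Suc i) (T (Suc i))" if "i < n" for i using T that by (simp add: paths_def)
    have "card (T i) = i div 2" if "i \<le> n" for i
      using nx[of i] that Tn cardS nN by (cases "i = n") (auto simp: preds_iff)
    moreover have "interlaces (T (Suc i)) (T i)" if "i < n" for i using nx[OF that] by (simp add: preds_iff)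
    moreover have "half_ok n w ?a \<longleftrightarrow> (\<forall>i<n. interlaces (T (Suc i)) (T i)) \<and> (\<forall>i\<le>n. card (T i) = i div 2) \<and>
        (\<forall>x\<in>T n. x < 0)"
      by (rule half_ok_iff) (rule array_of_center)
    ultimately have H: "half_ok n w ?a" using neg Tn by blast
    have "as_trapezoid n (2 * w + 3) ?a"
      using symmetric_trapezoid_iff_half[OF ev array_of_PiE array_of_symmetric] H by blast
    moreover have "one_column_vector n (2 * w + 3) ?a = map c [1..<N + 1]"
    proof -
      have "\<forall>x\<in>T n. x < 0" using neg Tn by blast
      from one_column_vector_eq[OF this] show ?thesis unfolding Tn vec .
    qed
    moreover have "\<forall>i<n. colnum n (Suc i) \<in> T (Suc i) \<longrightarrow> (colnum n (Suc i) \<in> T i \<longleftrightarrow> colnum n (Suc i) \<in> C)"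
      using nx by (auto simp: preds_iff)
    then have "\<forall>r\<in>{1..N}. ten_column n (2 * w + 3) ?a (column_numbered n (c r)) \<longleftrightarrow> c r \<in> C"
      using flag[OF seq_array_axioms Tn] by blast
    ultimately show "?a \<in> symmetric_trapezoids n (2 * w + 3) c C"
      unfolding symmetric_trapezoids_def nN using array_of_symmetric by blast
  qed
qed

theorem theorem4p1:
  fixes n l :: nat and c :: "nat \<Rightarrow> int" and C10 :: "int set" and Q :: "'a::field_char_0"
  assumes "n \<ge> 2" and "even n" and "l \<ge> 3" and "odd l"
    and "strict_mono_on {1..n div 2} c"
    and "\<forall>i\<in>{1..n div 2}. - int n \<le> c i \<and> c i \<le> -1"
    and "C10 \<subseteq> c ` {1..n div 2}"
    and "Q \<noteq> 0"
  shows "(\<Sum>a\<in>symmetric_trapezoids n l c C10. Q_weight Q n l a) =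
    op_prod [neg_qdiff Q i. i \<leftarrow> [1..<n div 2 + 1], c i \<in> C10]
     (op_prod [id_plus_qdiff Q i. i \<leftarrow> [1..<n div 2 + 1], c i \<notin> C10]
       (op_prod [neg_qdiff Q r ^^ nat (- c r - 1). r \<leftarrow> [1..<n div 2 + 1]]
         (F_poly Q n l))) c"
proof -
  obtain N where n: "n = 2 * N" using \<open>even n\<close> by (elim evenE)
  \<comment> \<open>w is the number of the central column n + w + 1, hence the h of the
    levels.\<close>
  obtain w where l: "l = 2 * w + 3"
  proof -
    obtain v where "l = 2 * v + 1" using \<open>odd l\<close> by (elim oddE)
    then have "l = 2 * (v - 1) + 3" using \<open>l \<ge> 3\<close> by simp
    then show ?thesis by (rule that)
  qed
  have nN: "n div 2 = N" and N0: "0 < N" using n \<open>n \<ge> 2\<close> by auto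
  have c: "strict_mono_on {1..N} c" using assms(5) nN by simp
  have cr: "- int n \<le> c r \<and> c r \<le> -1" if "r \<in> {1..N}" for r using assms(6) nN that by simp
  have cw: "c r < int w" if "r \<in> {1..N}" for r using cr[OF that] by simp
  have level: "level Q (int w) n = F_poly Q n l" using n by (simp add: level_def F_poly_eq_level_even l)
  \<comment> \<open>The entries of the determinant have degree at most 2(N - 1) < n, so K = n serves
    for every truncation.\<close>
  have nilp: "nilp n (F_poly Q n l)"
    unfolding n l F_poly_eq_level_even level_even_def by (rule nilp_act[OF nilp_bdet]) (use N0 in auto)
  have "(\<Sum>a\<in>symmetric_trapezoids n l c C10. Q_weight Q n l a) =
      (\<Sum>T\<in>paths n (int w) C10 n (c ` {1..N}). Q ^ (\<Sum>i<n. card (T i - T (Suc i))))"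
    unfolding l by (rule sum_symmetric_trapezoids[OF n N0 c cr])
  also have "\<dots> = wsum Q n (int w) C10 n (c ` {1..N})"
    by (rule wsum_eq_sum_paths[symmetric])
      (use cw nN card_image[OF strict_mono_on_imp_inj_on[OF c]] in auto)
  also have "\<dots> = act (freeze_ops Q n C10 n n c) (F_poly Q n l) c"
    using wsum_eq_act[OF \<open>Q \<noteq> 0\<close>, of n n c "int w" n C10] c cw unfolding nN level by simp
  also have "\<dots> = act (freeze_ops Q n C10 (2 * N) (2 * N) c) (F_poly Q n l) c"
    unfolding n ..
  also have "act (freeze_ops Q n C10 (2 * N) (2 * N) c) (F_poly Q n l) =
      op_prod [neg_qdiff Q i. i \<leftarrow> [1..<N + 1], c i \<in> C10]
       (op_prod [id_plus_qdiff Q i. i \<leftarrow> [1..<N + 1], c i \<notin> C10]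
         (op_prod [neg_qdiff Q r ^^ nat (- c r - 1). r \<leftarrow> [1..<N + 1]] (F_poly Q n l)))"
    by (rule operators_eq_act[OF nilp, symmetric]) (use cr in auto)
  finally show ?thesis unfolding nN .
qed

end
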